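(* Let $(a,b)\in\mathcal{P}$ and let $f_{a,b}(z)=\sum_{k=0}^\infty \xi_k z^k$, where $\{\xi_k\}_{k\in\mathbb{Z}}$ is the stationary, centered, complex Gaussian process with covariance function $\mathbb{E}[\xi_k\overline{\xi_l}]=\gamma(l-k)$, where $\gamma(0)=1$, $\gamma(k)=a$ for $|k|=1$, $\gamma(k)=b$ for $|k|=2$, and $\gamma(k)=0$ otherwise. For $r\in(0,1)$ let $N_{f_{a,b}}(r)$ be the number of zeros of $f_{a,b}$ in $\{z\in\mathbb{C}:|z|<r\}$. Then the following asymptotics hold as $r\to 1_-$. (I) If $a^2/8+(b-1/4)^2=1/16$ and $1/6<b\le 1/2$, then $$\mathbb{E}N_{f_{a,b}}(r)=\frac{r^2}{1-r^2}-\sqrt{\frac{2b}{6b-1}}\,\frac{1}{(1-r^2)^{1/2}}+O(1).$$ (II) If $b=|a|-1/2$ and $-1/2\le b<1/6$, then $$\mathbb{E}N_{f_{a,b}}(r)=\frac{r^2}{1-r^2}-\frac12\sqrt{\frac{1-2b}{1-6b}}\,\frac{1}{(1-r^2)^{1/2}}+O(1).$$ (III) If $(a,b)=(\pm 2/3,1/6)$, then $$\mathbb{E}N_{f_{a,b}}(r)=\frac{r^2}{1-r^2}-\frac{1}{2^{5/4}}\,\frac{1}{(1-r^2)^{3/4}}+O\left(\frac{1}{(1-r^2)^{1/4}}\right).$$ (IV) If $(a,b)$ is in the interior of $\mathcal{P}$, then there exists a non-negative constant $C(a,b)$ such that $$\mathbb{E}N_{f_{a,b}}(r)=\frac{r^2}{1-r^2}-C(a,b)+O(1-r^2),$$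 and the constant $C(a,b)$ is positive except for $(a,b)=(0,0)$.
   Context: The region $\mathcal{P}\subset\mathbb{R}^2$ is $\mathcal{P}=\mathcal{P}_1\cup\mathcal{P}_2$ with $$\mathcal{P}_1=\left\{(a,b)\in\mathbb{R}^2: \frac{a^2}{8}+\left(b-\frac14\right)^2\le\frac1{16}\right\},$$ $$\mathcal{P}_2=\left\{(a,b)\in\mathbb{R}^2: \frac{a^2}{8}+\left(b-\frac14\right)^2\ge\frac1{16},\ |a|-\frac12\le b\le\frac16\right\}.$$ It is exactly the set of $(a,b)\in\mathbb{R}^2$ for which the covariance function $\gamma$ in the claim is positive definite. Complex Gaussian processes are centered and circularly symmetric, so that their law is determined by the covariance $\mathbb{E}[\xi_k\overline{\xi_l}]$. The power series $f_{a,b}$ has radius of convergence $1$ almost surely. The implied constants in $O(\cdot)$ may depend on $(a,b)$.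
   Formalization: Part (II) is proved for -1/2<b<1/6; at the endpoint (a,b)=(0,-1/2) the printed coefficient 1/2·sqrt((1-2b)/(1-6b)) is false (the spectral density has two zeros there), and the formula is proved with the corrected coefficient sqrt((1-2b)/(1-6b))=1/sqrt(2). *)

theory Defs
  imports "HOL-Probability.Probability" "HOL-Complex_Analysis.Complex_Analysis"
    "HOL-Library.Landau_Symbols"
begin

definition region_P1 :: "(real \<times> real) set" where
  "region_P1 = {(a, b). a\<^sup>2 / 8 + (b - 1/4)\<^sup>2 \<le> 1/16}"

definition region_P2 :: "(real \<times> real) set" where
  "region_P2 = {(a, b). a\<^sup>2 / 8 + (b - 1/4)\<^sup>2 \<ge> 1/16 \<and> \<bar>a\<bar> - 1/2 \<le> b \<and> b \<le> 1/6}"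

definition region_P :: "(real \<times> real) set" where
  "region_P = region_P1 \<union> region_P2"

definition cov_fun :: "real \<Rightarrow> real \<Rightarrow> int \<Rightarrow> real" where
  "cov_fun a b k =
     (if k = 0 then 1 else if \<bar>k\<bar> = 1 then a else if \<bar>k\<bar> = 2 then b else 0)"

text \<open>Real Gaussian variables are allowed to be degenerate (almost surely constant).\<close>

definition gaussian_rv :: "'w measure \<Rightarrow> ('w \<Rightarrow> real) \<Rightarrow> bool" where
  "gaussian_rv M X \<longleftrightarrow> X \<in> borel_measurable M \<and>
     (\<exists>\<mu>. (AE \<omega> in M. X \<omega> = \<mu>) \<or>
          (\<exists>\<sigma>>0. distributed M lborel X (normal_density \<mu> \<sigma>)))"

text \<open>A complex process is Gaussian if its real and imaginary parts are jointly Gaussian. The real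
  linear combinations of the \<open>Re (\<xi> k)\<close> and \<open>Im (\<xi> k)\<close> are exactly the
  real parts of the complex linear combinations of the \<open>\<xi> k\<close>.\<close>

definition complex_gaussian_process :: "'w measure \<Rightarrow> (int \<Rightarrow> 'w \<Rightarrow> complex) \<Rightarrow> bool" where
  "complex_gaussian_process M \<xi> \<longleftrightarrow> (\<forall>k. \<xi> k \<in> borel_measurable M) \<and>
     (\<forall>J c. finite J \<longrightarrow> gaussian_rv M (\<lambda>\<omega>. Re (\<Sum>k\<in>J. c k * \<xi> k \<omega>)))"

definition process_law :: "'w measure \<Rightarrow> (int \<Rightarrow> 'w \<Rightarrow> complex) \<Rightarrow> (int \<Rightarrow> complex) measure" where
  "process_law M \<xi> = distr M (PiM UNIV (\<lambda>_. borel)) (\<lambda>\<omega> k. \<xi> k \<omega>)"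

definition centered :: "'w measure \<Rightarrow> (int \<Rightarrow> 'w \<Rightarrow> complex) \<Rightarrow> bool" where
  "centered M \<xi> \<longleftrightarrow> (\<forall>k. (LINT \<omega>|M. \<xi> k \<omega>) = 0)"

definition circularly_symmetric :: "'w measure \<Rightarrow> (int \<Rightarrow> 'w \<Rightarrow> complex) \<Rightarrow> bool" where
  "circularly_symmetric M \<xi> \<longleftrightarrow>
     (\<forall>\<theta>. process_law M (\<lambda>k \<omega>. cis \<theta> * \<xi> k \<omega>) = process_law M \<xi>)"

definition stationary :: "'w measure \<Rightarrow> (int \<Rightarrow> 'w \<Rightarrow> complex) \<Rightarrow> bool" where
  "stationary M \<xi> \<longleftrightarrow> (\<forall>n. process_law M (\<lambda>k. \<xi> (k + n)) = process_law M \<xi>)"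

definition has_covariance ::
    "'w measure \<Rightarrow> (int \<Rightarrow> 'w \<Rightarrow> complex) \<Rightarrow> (int \<Rightarrow> real) \<Rightarrow> bool" where
  "has_covariance M \<xi> \<gamma> \<longleftrightarrow>
     (\<forall>k l. (LINT \<omega>|M. \<xi> k \<omega> * cnj (\<xi> l \<omega>)) = complex_of_real (\<gamma> (l - k)))"

definition stationary_gaussian :: 
    "'w measure \<Rightarrow> (int \<Rightarrow> 'w \<Rightarrow> complex) \<Rightarrow> (int \<Rightarrow> real) \<Rightarrow> bool" where
  "stationary_gaussian M \<xi> \<gamma> \<longleftrightarrow> prob_space M \<and> complex_gaussian_process M \<xi> \<and>
     centered M \<xi> \<and> circularly_symmetric M \<xi> \<and> stationary M \<xi> \<and> has_covariance M \<xi> \<gamma>"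

definition random_series :: "(int \<Rightarrow> 'w \<Rightarrow> complex) \<Rightarrow> 'w \<Rightarrow> complex \<Rightarrow> complex" where
  "random_series \<xi> \<omega> z = (\<Sum>k. \<xi> (int k) \<omega> * z ^ k)"

text \<open>Zeros are counted with multiplicity. The sum over the (possibly infinite) zero set is taken in
  the extended nonnegative reals.\<close>

definition zero_count :: "(complex \<Rightarrow> complex) \<Rightarrow> real \<Rightarrow> ennreal" where
  "zero_count f r = (\<Sum>\<^sub>\<infinity>z\<in>{z. norm z < r \<and> f z = 0}. ennreal (of_int (zorder f z)))"

text \<open>The nonnegative integral does not depend on the values of \<open>zero_count\<close> on null sets,
  even where these values fail to be measurable; this matters on the null event on which the series
  does not converge in the whole unit disc. An infinite expectation would be mapped to 0, which is
  incompatible with any asymptotics of the form \<open>r\<^sup>2 / (1 - r\<^sup>2) * (1 + o(1))\<close>.\<close>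

definition expected_zeros :: "'w measure \<Rightarrow> (int \<Rightarrow> 'w \<Rightarrow> complex) \<Rightarrow> real \<Rightarrow> real" where
  "expected_zeros M \<xi> r = enn2real (\<integral>\<^sup>+\<omega>. zero_count (random_series \<xi> \<omega>) r \<partial>M)"

end

theory Submission
  imports Defs "HOL-Real_Asymp.Real_Asymp"
begin

text \<open>Almost surely the logarithmic derivative of \<open>f = f\<^sub>a\<^sub>,\<^sub>b\<close> is integrable over \<open>|z| = r\<close>, so the argument
  principle expresses the number of zeros as the mean of \<open>z f'(z) / f(z)\<close> over this circle. Since
  \<open>f'(z) - \<kappa> f(z)\<close> is independent of \<open>f(z)\<close> for \<open>\<kappa> = E[f'(z) cnj (f(z))] / E[|f(z)|\<^sup>2]\<close>, the expectation of
  \<open>f'(z) / f(z)\<close> is \<open>\<kappa>\<close>, which is explicit. With \<open>A = a r\<close> and \<open>B = b r\<^sup>2\<close> this leaves \<open>r\<^sup>2 / (1 - r\<^sup>2) + 1\<close> minus the mean of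
  \<open>(1 + A cos \<theta>) / (1 + 2 A cos \<theta> + 2 B cos 2\<theta>)\<close>, an algebraic function of \<open>A\<close> and \<open>B\<close> whose singularity at
  \<open>r = 1\<close> is read off after the substitution \<open>u = sqrt (1 - r\<^sup>2)\<close>.\<close>

section \<open>A trigonometric mean\<close>

text \<open>The denominator of the mean is the Poisson extension to radius \<open>r\<close> of the
  spectral density \<open>1 + 2 a cos \<theta> + 2 b cos 2\<theta>\<close>, and the zeros of this
  density on the unit circle decide the case. Near a zero of order \<open>k\<close> the extension is
  comparable to \<open>(1 - r) + |\<theta> - \<theta>0|^k\<close>, so a double zero contributes a
  term of order \<open>(1 - r^2)^(-1/2)\<close> and a quadruple zero one of order
  \<open>(1 - r^2)^(-3/4)\<close>. On the arc \<open>b > 1/6\<close> of the ellipse there are two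
  double zeros, at \<open>cos \<theta> = - a / (4 b)\<close>; on the open segments one, at 0 or pi;
  at \<open>(0, -1/2)\<close> both of these; at the corners \<open>(\<plusminus>2/3, 1/6)\<close>
  one quadruple zero; in the interior none. On the probabilistic side the obstacle is the pole of
  \<open>Y / X\<close> at \<open>X = 0\<close>. No joint density is used: all Gaussian facts are
  read off characteristic functions. Independence is a factorization, moments are derivatives, and
  inverse powers of \<open>|X|\<close> are integrals over \<open>s\<close> of the weights
  \<open>exp (- s^2 |X|^2 / 2)\<close>, which are mixtures of characters of
  \<open>X\<close>.\<close>

lemma has_integral_circle_mean:
  assumes "g holomorphic_on cball 0 1"
  shows "((\<lambda>t. g (cis (2 * pi * t))) has_integral g 0) {0..1}"
proof -
  have "((\<lambda>u. g u / (u - 0)) has_contour_integral (2 * of_real pi * \<i> * g 0)) (circlepath 0 1)"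
    using assms by (intro Cauchy_integral_circlepath_simple) auto
  hence "((\<lambda>t. g (circlepath 0 1 t) / circlepath 0 1 t * 
           vector_derivative (circlepath 0 1) (at t within {0..1})) has_integral (2 * of_real pi * \<i> * g 0)) {0..1}"
    by (simp add: has_contour_integral_def)
  hence "((\<lambda>t. (2 * of_real pi * \<i>) * g (cis (2 * pi * t))) has_integral (2 * of_real pi * \<i> * g 0)) {0..1}"
    by (rule has_integral_eq[rotated])
      (auto simp: vector_derivative_circlepath01, simp add: circlepath cis_conv_exp mult_ac)
  hence "((\<lambda>t. inverse (2 * of_real pi * \<i>) * ((2 * of_real pi * \<i>) * g (cis (2 * pi * t)))) has_integral
      inverse (2 * of_real pi * \<i>) * (2 * of_real pi * \<i> * g 0)) {0..1}"
    by (rule has_integral_mult_right)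
  thus ?thesis by (simp add: field_simps)
qed

text \<open>These are the stability conditions of a real quadratic. A non-real root satisfies
  \<open>p2 * |w|^2 = 1\<close>, hence lies outside the closed disc. For real
  \<open>x \<noteq> 0\<close> the value strictly exceeds
  \<open>(1 - |x|) * (1 - p2 * |x|)\<close>.\<close>

lemma quadratic_nonzero_unit_disc:
  fixes p1 p2 :: real and w :: complex
  assumes p2: "\<bar>p2\<bar> < 1" and p1: "\<bar>p1\<bar> < 1 + p2" and w: "norm w \<le> 1"
  shows "1 + of_real p1 * w + of_real p2 * w\<^sup>2 \<noteq> 0"
proof
  assume eq: "1 + of_real p1 * w + of_real p2 * w\<^sup>2 = 0"
  define x y where "x = Re w" and "y = Im w"
  have re: "1 + p1 * x + p2 * (x\<^sup>2 - y\<^sup>2) = 0" and im: "y * (p1 + 2 * p2 * x) = 0"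
    using eq by (simp_all add: complex_eq_iff x_def y_def power2_eq_square algebra_simps)
  have xy: "x\<^sup>2 + y\<^sup>2 \<le> 1"
    using w power_mono[OF w, of 2] by (simp add: cmod_power2 x_def y_def)
  show False
  proof (cases "y = 0")
    case True
    have x1: "\<bar>x\<bar> \<le> 1"
      using xy True by (simp add: abs_square_le_1)
    have "1 + p1 * x + p2 * x\<^sup>2 = 0" using re True by simp
    moreover have "1 + p1 * x + p2 * x\<^sup>2 > 0"
    proof (cases "x = 0")
      case False
      have "\<bar>p1 * x\<bar> < (1 + p2) * \<bar>x\<bar>"
        using p1 False by (simp add: abs_mult)
      moreover have "(1 - \<bar>x\<bar>) * (1 - p2 * \<bar>x\<bar>) \<ge> 0"
      proof (intro mult_nonneg_nonneg)
        have "p2 * \<bar>x\<bar> \<le> \<bar>p2\<bar> * \<bar>x\<bar>" by (intro mult_right_mono) auto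
        also have "\<dots> \<le> 1 * 1" using p2 x1 by (intro mult_mono) auto
        finally show "1 - p2 * \<bar>x\<bar> \<ge> 0" by simp
      qed (use x1 in auto)
      moreover have "(1 - \<bar>x\<bar>) * (1 - p2 * \<bar>x\<bar>) = 1 + p2 * x\<^sup>2 - (1 + p2) * \<bar>x\<bar>"
        by (simp add: algebra_simps power2_eq_square)
      ultimately show ?thesis by linarith
    qed auto
    ultimately show False by simp
  next
    case False
    hence "p1 = - 2 * p2 * x" using im by (simp add: add_eq_0_iff)
    hence "1 = p2 * (x\<^sup>2 + y\<^sup>2)" using re by (simp add: algebra_simps power2_eq_square)
    also have "\<dots> \<le> \<bar>p2\<bar> * (x\<^sup>2 + y\<^sup>2)" by (intro mult_right_mono) auto
    also have "\<dots> \<le> \<bar>p2\<bar> * 1" using xy by (intro mult_left_mono) auto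
    finally show False using p2 by simp
  qed
qed

lemma circle_mean_factorized:
  fixes p1 p2 A B y :: real
  assumes p2: "\<bar>p2\<bar> < 1" and p1: "\<bar>p1\<bar> < 1 + p2"
    and y: "y * (1 + p1\<^sup>2 + p2\<^sup>2) = 1" and A: "A = y * p1 * (1 + p2)" and B: "B = y * p2"
  shows "((\<lambda>t. (1 + A * cos (2 * pi * t)) / (1 + 2 * A * cos (2 * pi * t) + 2 * B * cos (2 * (2 * pi * t))))
    has_integral (1 + p2)\<^sup>2 * (1 + p2\<^sup>2) / (((1 + p2)\<^sup>2 - p1\<^sup>2) * (1 - p2\<^sup>2))) {0..1}"
proof -
  txt \<open>The integrand is the real part of \<open>g\<close>, whose mean over the circle is \<open>g 0 = P0\<close>.\<close>
  define P0 where "P0 = (1 + p2)\<^sup>2 * (1 + p2\<^sup>2) / (((1 + p2)\<^sup>2 - p1\<^sup>2) * (1 - p2\<^sup>2))"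
  define P1 where "P1 = p1 - P0 * p1 * (1 - p2) / (1 + p2)"
  define P2 where "P2 = - p2 * P0"
  define m where "m = 1 + p1\<^sup>2 + p2\<^sup>2"
  define g where "g = (\<lambda>w. (of_real P0 + of_real P1 * w + of_real P2 * w\<^sup>2) / (1 + of_real p1 * w + of_real p2 * w\<^sup>2) :: complex)"
  have ne: "1 + of_real p1 * w + of_real p2 * w\<^sup>2 \<noteq> 0" if "norm w \<le> 1" for w :: complex
    using quadratic_nonzero_unit_disc[OF p2 p1 that] .
  have m0: "m > 0" unfolding m_def by (simp add: add_pos_nonneg)
  have p2': "1 + p2 > 0" "1 - p2 > 0" using p2 by auto
  have sq: "(1 + p2)\<^sup>2 - p1\<^sup>2 > 0"
    using p1 by (simp add: abs_square_less_1 power2_strict_mono)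
  have "1 - p2\<^sup>2 = (1 + p2) * (1 - p2)" by (simp add: algebra_simps power2_eq_square)
  hence sq2: "1 - p2\<^sup>2 > 0" using p2' by simp
  have e0: "P0 * (((1 + p2)\<^sup>2 - p1\<^sup>2) * (1 - p2)) = (1 + p2) * (1 + p2\<^sup>2)"
    unfolding P0_def using sq sq2 p2' \<open>1 - p2\<^sup>2 = _\<close> by (simp add: divide_simps) (simp add: power2_eq_square)
  have e1: "(1 + p2) * P1 = p1 * (1 + p2) - P0 * p1 * (1 - p2)"
    unfolding P1_def using p2' by (simp add: field_simps)
  \<comment> \<open>With numerator \<open>P\<close> and denominator \<open>q\<close> of
    \<open>g\<close>, the real part of \<open>P * cnj q\<close> has the coefficients of
    \<open>c0\<close> and \<open>c1\<close> at 1 and \<open>cos \<theta>\<close>, and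
    \<open>P0 * p2 + P2\<close> at \<open>cos 2\<theta>\<close>. \<open>P0\<close>,
    \<open>P1\<close>, \<open>P2\<close> solve the linear system that prescribes \<open>m\<close>,
    \<open>m * A\<close> and 0 for them.\<close>
  have c0: "P0 + P1 * p1 + P2 * p2 = m"
  proof -
    have "(1 + p2) * (P0 + P1 * p1 + P2 * p2) = P0 * (1 - p2\<^sup>2) * (1 + p2) + p1 * ((1 + p2) * P1)"
      by (simp add: P2_def algebra_simps power2_eq_square)
    also have "\<dots> = P0 * (((1 + p2)\<^sup>2 - p1\<^sup>2) * (1 - p2)) + p1\<^sup>2 * (1 + p2)"
      unfolding e1 by (simp add: algebra_simps power2_eq_square)
    also have "\<dots> = (1 + p2) * m" unfolding e0 m_def by (simp add: algebra_simps)
    finally show ?thesis using p2' by simp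
  qed
  have c1: "P0 * p1 + P1 + P1 * p2 + P2 * p1 = p1 * (1 + p2)"
    using e1 by (simp add: P2_def algebra_simps)
  have "g holomorphic_on cball 0 1"
    unfolding g_def using ne by (intro holomorphic_intros) auto
  from has_integral_linear[OF has_integral_circle_mean[OF this] bounded_linear_Re]
  have "((\<lambda>t. Re (g (cis (2 * pi * t)))) has_integral P0) {0..1}"
    by (simp add: o_def g_def)
  moreover have "Re (g (cis \<theta>)) = (1 + A * cos \<theta>) / (1 + 2 * A * cos \<theta> + 2 * B * cos (2 * \<theta>))" for \<theta>
  proof -
    define c s where "c = cos \<theta>" and "s = sin \<theta>"
    have cs: "s\<^sup>2 = 1 - c\<^sup>2" unfolding c_def s_def by (simp add: sin_squared_eq)
    define P where "P = of_real P0 + of_real P1 * cis \<theta> + of_real P2 * (cis \<theta>)\<^sup>2"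
    define q where "q = 1 + of_real p1 * cis \<theta> + of_real p2 * (cis \<theta>)\<^sup>2"
    have rP: "Re P = P0 + P1 * c + P2 * (2 * c\<^sup>2 - 1)" "Im P = P1 * s + P2 * (2 * s * c)"
      using cs by (simp_all add: P_def c_def s_def power2_eq_square)
    have rq: "Re q = 1 + p1 * c + p2 * (2 * c\<^sup>2 - 1)" "Im q = p1 * s + p2 * (2 * s * c)"
      using cs by (simp_all add: q_def c_def s_def power2_eq_square)
    have n: "(Re q)\<^sup>2 + (Im q)\<^sup>2 = m + 2 * (p1 * (1 + p2)) * c + 2 * p2 * (2 * c\<^sup>2 - 1)"
    proof -
      have "(Re q)\<^sup>2 + (Im q)\<^sup>2 = (1 + p1 * c + p2 * (2 * c\<^sup>2 - 1))\<^sup>2 + s\<^sup>2 * (p1 + 2 * p2 * c)\<^sup>2"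
        unfolding rq by (simp add: power2_eq_square algebra_simps)
      thus ?thesis unfolding cs m_def by (simp add: power2_eq_square algebra_simps)
    qed
    have d: "Re P * Re q + Im P * Im q = m + p1 * (1 + p2) * c"
    proof -
      have "Re P * Re q + Im P * Im q = (P0 + P1 * c + P2 * (2 * c\<^sup>2 - 1)) * (1 + p1 * c + p2 * (2 * c\<^sup>2 - 1))
         + s\<^sup>2 * (P1 + 2 * P2 * c) * (p1 + 2 * p2 * c)"
        unfolding rP rq by (simp add: power2_eq_square algebra_simps)
      also have "\<dots> = (P0 + P1 * p1 + P2 * p2) + (P0 * p1 + P1 + P1 * p2 + P2 * p1) * c + (P0 * p2 + P2) * (2 * c\<^sup>2 - 1)"
        unfolding cs by (simp add: power2_eq_square algebra_simps)
      finally show ?thesis unfolding c0 c1 by (simp add: P2_def)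
    qed
    have ym: "m * y = 1" using y unfolding m_def by (simp add: mult.commute)
    have mA: "p1 * (1 + p2) = m * A" "p2 = m * B"
      unfolding A B by (simp_all add: mult.assoc[symmetric] ym)
    have "Re (P / q) = (Re P * Re q + Im P * Im q) / ((Re q)\<^sup>2 + (Im q)\<^sup>2)"
      by (simp add: Re_divide)
    also have "\<dots> = (m * (1 + A * c)) / (m * (1 + 2 * A * c + 2 * B * (2 * c\<^sup>2 - 1)))"
    proof -
      have "m + 2 * (m * A) * c + 2 * p2 * (2 * c\<^sup>2 - 1) = m * (1 + 2 * A * c + 2 * B * (2 * c\<^sup>2 - 1))"
        using mA(2) by (simp add: algebra_simps)
      thus ?thesis unfolding n d mA(1) by (simp add: algebra_simps)
    qed
    also have "\<dots> = (1 + A * c) / (1 + 2 * A * c + 2 * B * (2 * c\<^sup>2 - 1))" using m0 by simp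
    finally show ?thesis
      unfolding g_def P_def q_def by (simp add: cos_double_cos c_def)
  qed
  ultimately show ?thesis unfolding P0_def by simp
qed

text \<open>The coefficients of the Fejer-Riesz factor are eliminated here. \<open>R\<close> is the
  product of the values of \<open>1 + 2 A cos \<theta> + 2 B cos 2\<theta>\<close> at 0 and pi, so
  it tends to 0 when a zero reaches a real point of the circle. The factor
  \<open>1 - 6 * B + sqrt R\<close> tends to 0 when a pair of zeros reaches non-real points of the
  circle.\<close>

definition mean_fun :: "real \<Rightarrow> real \<Rightarrow> real" where
  "mean_fun A B = (let R = (1 + 2 * B)\<^sup>2 - 4 * A\<^sup>2 in
     (sqrt R + 1 + 2 * B - 2 * A\<^sup>2) / (sqrt R * sqrt ((1 - 6 * B + sqrt R) * (1 + 2 * B + sqrt R))))"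

text \<open>The points \<open>x = 1\<close> and \<open>x = -1\<close> give the first two claims,
  since \<open>R\<close> is the product of the two values there. For \<open>B \<ge> 1/6\<close> the
  parabola in \<open>x\<close> has its minimum at \<open>- A / (4 * B)\<close>, and positivity there
  is exactly \<open>(6 * B - 1)^2 < R\<close>.\<close>

lemma
  fixes A B :: real
  assumes pos: "\<And>x. \<bar>x\<bar> \<le> 1 \<Longrightarrow> 1 + 2 * A * x + 2 * B * (2 * x\<^sup>2 - 1) > 0"
  shows discriminant_pos: "(1 + 2 * B)\<^sup>2 - 4 * A\<^sup>2 > 0"
    and sum_endpoints_pos: "1 + 2 * B > 2 * \<bar>A\<bar>"
    and outer_factor_pos: "1 - 6 * B + sqrt ((1 + 2 * B)\<^sup>2 - 4 * A\<^sup>2) > 0"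
proof -
  have e: "1 + 2 * B + 2 * A > 0" "1 + 2 * B - 2 * A > 0"
    using pos[of 1] pos[of "-1"] by simp_all
  show s: "1 + 2 * B > 2 * \<bar>A\<bar>" using e by simp
  have "(1 + 2 * B)\<^sup>2 - 4 * A\<^sup>2 = (1 + 2 * B + 2 * A) * (1 + 2 * B - 2 * A)"
    by (simp add: algebra_simps power2_eq_square)
  thus R: "(1 + 2 * B)\<^sup>2 - 4 * A\<^sup>2 > 0" using e by simp
  show "1 - 6 * B + sqrt ((1 + 2 * B)\<^sup>2 - 4 * A\<^sup>2) > 0"
  proof (cases "B < 1/6")
    case False
    hence B: "B \<ge> 1/6" by simp
    \<comment> \<open>The minimum lies in the allowed range because
      \<open>2 * |A| < 1 + 2 * B \<le> 8 * B\<close>.\<close>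
    have "\<bar>- A / (4 * B)\<bar> \<le> 1" using s B by (simp add: field_simps)
    note * = pos[OF this]
    define x where "x = - A / (4 * B)"
    have A: "A = - 4 * B * x" using B by (simp add: x_def)
    have "1 - 2 * B - 4 * B * x\<^sup>2 > 0"
      using * unfolding x_def[symmetric] by (simp add: A power2_eq_square algebra_simps)
    hence "4 * B * (1 - 2 * B - 4 * B * x\<^sup>2) > 0" using B by simp
    hence "A\<^sup>2 < 4 * B * (1 - 2 * B)" unfolding A by (simp add: algebra_simps power2_eq_square)
    hence "(6 * B - 1)\<^sup>2 < (1 + 2 * B)\<^sup>2 - 4 * A\<^sup>2"
      by (simp add: power2_eq_square algebra_simps)
    hence "6 * B - 1 < sqrt ((1 + 2 * B)\<^sup>2 - 4 * A\<^sup>2)"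
      by (rule real_less_rsqrt)
    thus ?thesis by simp
  qed (use R in \<open>simp add: add_pos_pos\<close>)
qed

lemma
  fixes A B :: real
  assumes pos: "\<And>x. \<bar>x\<bar> \<le> 1 \<Longrightarrow> 1 + 2 * A * x + 2 * B * (2 * x\<^sup>2 - 1) > 0"
  shows circle_mean: "((\<lambda>t. (1 + A * cos (2 * pi * t)) / (1 + 2 * A * cos (2 * pi * t) + 2 * B * cos (2 * (2 * pi * t))))
      has_integral mean_fun A B) {0..1}"
    and mean_fun_ge_1: "mean_fun A B \<ge> 1"
    and mean_fun_eq_1_iff: "mean_fun A B = 1 \<longleftrightarrow> A = 0 \<and> B = 0"
proof -
  txt \<open>Fejer-Riesz: \<open>1 + 2 A cos \<theta> + 2 B cos 2\<theta> = y |1 + p1 w + p2 w\<^sup>2|\<^sup>2\<close> with \<open>w = cis \<theta>\<close>. Comparing coefficients,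
    \<open>s = y + B\<^sup>2 / y\<close> solves a quadratic equation with discriminant \<open>R\<close>.\<close>
  define R where "R = (1 + 2 * B)\<^sup>2 - 4 * A\<^sup>2"
  define s where "s = (1 - 2 * B + sqrt R) / 2"
  \<comment> \<open>Both square roots carry the plus sign, which selects the outer factor: the
    larger \<open>y\<close> gives \<open>|p2| < 1\<close>, and the larger \<open>s\<close> gives
    \<open>s + 2 * B > |A|\<close>, hence \<open>|p1| < 1 + p2\<close>.\<close>
  define y where "y = (s + sqrt (s\<^sup>2 - 4 * B\<^sup>2)) / 2"
  define p1 where "p1 = A / (y + B)"
  define p2 where "p2 = B / y"
  have R0: "R > 0" and AB: "1 + 2 * B > 2 * \<bar>A\<bar>" and out: "1 - 6 * B + sqrt R > 0"
    using discriminant_pos[OF pos] sum_endpoints_pos[OF pos] outer_factor_pos[OF pos] by (auto simp: R_def)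
  have R2: "(sqrt R)\<^sup>2 = R" using R0 by simp
  have s1: "s - 2 * B > 0" "s + 2 * B > \<bar>A\<bar>"
    using out AB R0 by (simp_all add: s_def field_simps) (smt (verit) real_sqrt_gt_zero)
  have s0: "s > 2 * \<bar>B\<bar>" using s1 by linarith
  have sB: "s\<^sup>2 - 4 * B\<^sup>2 = (s - 2 * B) * (s + 2 * B)" by (simp add: power2_eq_square algebra_simps)
  have S0: "s\<^sup>2 - 4 * B\<^sup>2 > 0" unfolding sB using s1 by (intro mult_pos_pos) auto
  have S2: "(sqrt (s\<^sup>2 - 4 * B\<^sup>2))\<^sup>2 = s\<^sup>2 - 4 * B\<^sup>2" using S0 by simp
  have "sqrt (s\<^sup>2 - 4 * B\<^sup>2) > 0" using S0 by simp
  moreover have "\<bar>B\<bar> < (s + t) / 2" if "t > 0" for t using s0 that by (simp add: field_simps)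
  ultimately have yB: "y > \<bar>B\<bar>" unfolding y_def by blast
  hence y0: "y > 0" "y + B > 0" by auto
  have sqr: "s\<^sup>2 - (1 - 2 * B) * s + A\<^sup>2 - 2 * B = 0"
  proof -
    have "2 * s - (1 - 2 * B) = sqrt R" by (simp add: s_def field_simps)
    hence "(2 * s - (1 - 2 * B))\<^sup>2 = R" using R2 by simp
    thus ?thesis unfolding R_def by (simp add: power2_eq_square algebra_simps)
  qed
  have yq: "y\<^sup>2 + B\<^sup>2 = s * y"
  proof -
    have "2 * y - s = sqrt (s\<^sup>2 - 4 * B\<^sup>2)" by (simp add: y_def field_simps)
    hence "(2 * y - s)\<^sup>2 = s\<^sup>2 - 4 * B\<^sup>2" using S2 by simp
    thus ?thesis by (simp add: power2_eq_square algebra_simps)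
  qed
  have p2: "\<bar>p2\<bar> < 1" using yB y0 by (simp add: p2_def)
  have yB2: "(y + B)\<^sup>2 = (s + 2 * B) * y" using yq by (simp add: power2_eq_square algebra_simps)
  have p1: "\<bar>p1\<bar> < 1 + p2"
  proof -
    have "\<bar>A\<bar> * y < (y + B)\<^sup>2" unfolding yB2 using s1 y0 by simp
    thus ?thesis using y0 by (simp add: p1_def p2_def field_simps power2_eq_square)
  qed
  have py: "y * p2 = B" "y * p1 * (1 + p2) = A"
  proof -
    show 1: "y * p2 = B" using y0 by (simp add: p2_def)
    have "y * p1 * (1 + p2) = p1 * (y + y * p2)" by (simp add: algebra_simps)
    also have "\<dots> = A" unfolding 1 using y0 by (simp add: p1_def)
    finally show "y * p1 * (1 + p2) = A" .
  qed
  have p1y: "y * p1\<^sup>2 = A\<^sup>2 / (s + 2 * B)"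
    using y0 s1 by (simp add: p1_def power_divide yB2)
  have p2y: "y * p2\<^sup>2 = B\<^sup>2 / y" by (simp add: p2_def power_divide power2_eq_square)
  have yp: "y * (1 + p1\<^sup>2 + p2\<^sup>2) = 1"
  proof -
    have "y * (1 + p1\<^sup>2 + p2\<^sup>2) = y + B\<^sup>2 / y + A\<^sup>2 / (s + 2 * B)"
      using p1y p2y by (simp add: algebra_simps)
    also have "y + B\<^sup>2 / y = s" using yq y0 by (simp add: field_simps power2_eq_square)
    also have "s + A\<^sup>2 / (s + 2 * B) = 1"
      using s1 sqr by (simp add: field_simps power2_eq_square)
    finally show ?thesis .
  qed
  define m where "m = 1 + p1\<^sup>2 + p2\<^sup>2"
  have ym: "y * m = 1" using yp by (simp add: m_def)
  have sy: "s = y * (1 + p2\<^sup>2)" using yq y0 by (simp add: p2_def field_simps power2_eq_square)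
  have sqR: "sqrt R = y * ((1 + p2)\<^sup>2 - p1\<^sup>2)"
  proof -
    have "sqrt R = 2 * s - y * m + 2 * (y * p2)" using ym py(1) by (simp add: s_def field_simps)
    thus ?thesis unfolding sy m_def by (simp add: power2_eq_square algebra_simps)
  qed
  have p2': "1 + p2 > 0" "1 - p2 > 0" using p2 by auto
  have "1 - p2\<^sup>2 = (1 + p2) * (1 - p2)" by (simp add: algebra_simps power2_eq_square)
  hence sq2: "1 - p2\<^sup>2 > 0" using p2' by simp
  have sq: "(1 + p2)\<^sup>2 - p1\<^sup>2 > 0"
    using p1 by (simp add: abs_square_less_1 power2_strict_mono)
  have sqS: "sqrt ((1 - 6 * B + sqrt R) * (1 + 2 * B + sqrt R)) = 2 * y * (1 - p2\<^sup>2)"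
  proof -
    have "(1 - 6 * B + sqrt R) * (1 + 2 * B + sqrt R) = 4 * (s\<^sup>2 - 4 * B\<^sup>2)"
      unfolding sB by (simp add: s_def algebra_simps)
    also have "\<dots> = (2 * y * (1 - p2\<^sup>2))\<^sup>2"
      unfolding sy py(1)[symmetric] by (simp add: power2_eq_square algebra_simps)
    finally show ?thesis using y0 sq2 by simp
  qed
  \<comment> \<open>Writing \<open>1\<close> as \<open>y * m\<close> makes the numerator homogeneous
    of degree two in \<open>y\<close>, so that \<open>y\<close> cancels from the quotient.\<close>
  have num: "sqrt R + 1 + 2 * B - 2 * A\<^sup>2 = 2 * y\<^sup>2 * (1 + p2)\<^sup>2 * (1 + p2\<^sup>2)"
  proof -
    have "sqrt R + 1 + 2 * B - 2 * A\<^sup>2 = y * ((1 + p2)\<^sup>2 - p1\<^sup>2) + y * m + 2 * (y * p2) - 2 * (y * p1 * (1 + p2))\<^sup>2"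
      unfolding sqR ym py by simp
    also have "\<dots> = 2 * y * (1 + p2)\<^sup>2 * (y * m - y * p1\<^sup>2)"
      by (subst (2) ym) (simp add: m_def power2_eq_square algebra_simps)
    also have "\<dots> = 2 * y\<^sup>2 * (1 + p2)\<^sup>2 * (1 + p2\<^sup>2)"
      unfolding m_def by (simp add: power2_eq_square algebra_simps)
    finally show ?thesis .
  qed
  have J: "mean_fun A B = (1 + p2)\<^sup>2 * (1 + p2\<^sup>2) / (((1 + p2)\<^sup>2 - p1\<^sup>2) * (1 - p2\<^sup>2))"
  proof -
    have "mean_fun A B = 2 * y\<^sup>2 * (1 + p2)\<^sup>2 * (1 + p2\<^sup>2) / (y * ((1 + p2)\<^sup>2 - p1\<^sup>2) * (2 * y * (1 - p2\<^sup>2)))"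
      unfolding num[symmetric] sqS[symmetric] sqR[symmetric] by (simp only: mean_fun_def R_def Let_def)
    also have "\<dots> = (2 * y\<^sup>2) * ((1 + p2)\<^sup>2 * (1 + p2\<^sup>2)) / ((2 * y\<^sup>2) * (((1 + p2)\<^sup>2 - p1\<^sup>2) * (1 - p2\<^sup>2)))"
      by (rule arg_cong2[where f = "(/)"]) (simp_all add: power2_eq_square algebra_simps)
    also have "\<dots> = (1 + p2)\<^sup>2 * (1 + p2\<^sup>2) / (((1 + p2)\<^sup>2 - p1\<^sup>2) * (1 - p2\<^sup>2))"
      using y0 by (intro mult_divide_mult_cancel_left) auto
    finally show ?thesis .
  qed
  show "((\<lambda>t. (1 + A * cos (2 * pi * t)) / (1 + 2 * A * cos (2 * pi * t) + 2 * B * cos (2 * (2 * pi * t))))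
      has_integral mean_fun A B) {0..1}"
    unfolding J by (rule circle_mean_factorized[OF p2 p1 yp]) (simp_all add: py)
  \<comment> \<open>In the coordinates \<open>p1\<close>, \<open>p2\<close> the inequality holds
    factor by factor: \<open>p1^2\<close> is dropped from the first factor and
    \<open>1 - p2^2\<close> is replaced by \<open>1 + p2^2\<close>. Equality therefore forces
    \<open>p2 = 0\<close> and then \<open>p1 = 0\<close>.\<close>
  have le: "((1 + p2)\<^sup>2 - p1\<^sup>2) * (1 - p2\<^sup>2) \<le> (1 + p2)\<^sup>2 * (1 + p2\<^sup>2)"
    using sq sq2 by (intro mult_mono) auto
  show ge: "mean_fun A B \<ge> 1"
    unfolding J using le sq sq2 by simp
  show "mean_fun A B = 1 \<longleftrightarrow> A = 0 \<and> B = 0"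
  proof
    assume "A = 0 \<and> B = 0"
    hence "p1 = 0" "p2 = 0" by (simp_all add: p1_def p2_def)
    thus "mean_fun A B = 1" unfolding J by simp
  next
    assume "mean_fun A B = 1"
    hence eq: "((1 + p2)\<^sup>2 - p1\<^sup>2) * (1 - p2\<^sup>2) = (1 + p2)\<^sup>2 * (1 + p2\<^sup>2)"
      unfolding J using sq sq2 by simp
    have "((1 + p2)\<^sup>2 - p1\<^sup>2) * (1 - p2\<^sup>2) \<le> (1 + p2)\<^sup>2 * (1 - p2\<^sup>2)"
      using sq2 by (intro mult_right_mono) auto
    with eq have "(1 + p2)\<^sup>2 * (1 + p2\<^sup>2) \<le> (1 + p2)\<^sup>2 * (1 - p2\<^sup>2)" by simp
    hence "p2 = 0" using p2' by simp
    moreover from this eq have "p1 = 0" by simp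
    ultimately show "A = 0 \<and> B = 0" using py by auto
  qed
qed

section \<open>Positivity of the spectral density\<close>

text \<open>With \<open>x = cos \<theta>\<close> this is nonnegativity of the spectral density. In
  \<open>region_P1\<close> completing the square in \<open>x\<close> leaves exactly the defect in
  the ellipse inequality. In \<open>region_P2\<close> the parabola is either concave (or linear),
  when \<open>b \<le> 0\<close>, or has its vertex at \<open>|x| \<ge> 1\<close>, since
  \<open>4 * b \<le> |a|\<close>; so its minimum is at an endpoint, where it is
  \<open>1 + 2 * b - 2 * |a| \<ge> 0\<close>.\<close>

lemma region_P_spectral_nonneg:
  assumes "(a, b) \<in> region_P" and x: "\<bar>x\<bar> \<le> 1"
  shows "1 + 2 * a * x + 2 * b * (2 * x\<^sup>2 - 1) \<ge> 0"
proof -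
  have ax: "a * x \<ge> - \<bar>a\<bar> * \<bar>x\<bar>" by (metis abs_ge_minus_self abs_mult minus_le_iff mult_minus_left)
  consider "(a, b) \<in> region_P1" | "(a, b) \<in> region_P2" using assms(1) by (auto simp: region_P_def)
  thus ?thesis
  proof cases
    case 1
    hence a2: "a\<^sup>2 \<le> 4 * b - 8 * b\<^sup>2" by (simp add: region_P1_def power2_eq_square field_simps)
    moreover have "a\<^sup>2 \<ge> 0" "b\<^sup>2 \<ge> 0" by simp_all
    ultimately have b0: "b \<ge> 0" by linarith
    show ?thesis
    proof (cases "b = 0")
      case True
      thus ?thesis using a2 by simp
    next
      case False
      have "4 * b * (1 + 2 * a * x + 2 * b * (2 * x\<^sup>2 - 1)) = (4 * b * x + a)\<^sup>2 + (4 * b - 8 * b\<^sup>2 - a\<^sup>2)"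
        by (simp add: power2_eq_square algebra_simps)
      also have "\<dots> \<ge> 0" using a2 by (intro add_nonneg_nonneg) auto
      finally show ?thesis using b0 False by (simp add: zero_le_mult_iff)
    qed
  next
    case 2
    hence h: "\<bar>a\<bar> - 1/2 \<le> b" "b \<le> 1/6" "a\<^sup>2 \<ge> 4 * b - 8 * b\<^sup>2"
      by (simp_all add: region_P2_def power2_eq_square field_simps)
    have x1: "(1 - \<bar>x\<bar>) \<ge> 0" using x by simp
    have lower: "1 + 2 * a * x + 2 * b * (2 * x\<^sup>2 - 1) \<ge> 1 - 2 * \<bar>a\<bar> * \<bar>x\<bar> + 2 * b * (2 * x\<^sup>2 - 1)"
      using ax by simp
    have id: "1 - 2 * \<bar>a\<bar> * \<bar>x\<bar> + 2 * b * (2 * x\<^sup>2 - 1) = 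
       (1 + 2 * b - 2 * \<bar>a\<bar>) + (1 - \<bar>x\<bar>) * (2 * \<bar>a\<bar> - 4 * b * (1 + \<bar>x\<bar>))"
      by (simp add: algebra_simps power2_eq_square flip: abs_mult)
    have "2 * \<bar>a\<bar> - 4 * b * (1 + \<bar>x\<bar>) \<ge> 0"
    proof (cases "b \<le> 0")
      case True
      hence "b * (1 + \<bar>x\<bar>) \<le> 0" by (intro mult_nonpos_nonneg) auto
      thus ?thesis by linarith
    next
      case False
      have "4 * b - 8 * b\<^sup>2 - (4 * b)\<^sup>2 = 4 * b * (1 - 6 * b)" by (simp add: power2_eq_square algebra_simps)
      also have "\<dots> \<ge> 0" using False h by (intro mult_nonneg_nonneg) auto
      finally have "(4 * b)\<^sup>2 \<le> a\<^sup>2" using h by linarith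
      hence "4 * b \<le> \<bar>a\<bar>" by (metis abs_le_square_iff abs_ge_self order_trans)
      moreover have "b * (1 + \<bar>x\<bar>) \<le> b * 2" using False x by (intro mult_left_mono) auto
      ultimately show ?thesis by linarith
    qed
    hence "(1 - \<bar>x\<bar>) * (2 * \<bar>a\<bar> - 4 * b * (1 + \<bar>x\<bar>)) \<ge> 0" using x1 by (rule mult_nonneg_nonneg[rotated])
    thus ?thesis using lower id h by linarith
  qed
qed

text \<open>In degree at most two, the Poisson integral at \<open>r cis \<theta>\<close> is a positive combination of the values at the four
  angles \<open>\<theta> + k \<pi>/2\<close>, whose cosines are \<open>\<plusminus>x\<close> and \<open>\<plusminus>y\<close>.\<close>

lemma region_P_spectral_dilated_pos:
  assumes "(a, b) \<in> region_P" and x: "\<bar>x\<bar> \<le> 1" and r: "0 \<le> r" "r < 1"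
  shows "1 + 2 * (a * r) * x + 2 * (b * r\<^sup>2) * (2 * x\<^sup>2 - 1) \<ge> (1 - r)\<^sup>2"
proof -
  define U where "U = (\<lambda>x. 1 + 2 * a * x + 2 * b * (2 * x\<^sup>2 - 1))"
  define y where "y = sqrt (1 - x\<^sup>2)"
  have x2: "x\<^sup>2 \<le> 1" using x by (simp add: abs_square_le_1)
  hence y2: "y\<^sup>2 = 1 - x\<^sup>2" by (simp add: y_def)
  hence "y\<^sup>2 \<le> 1" by simp
  hence y: "\<bar>y\<bar> \<le> 1" by (simp add: abs_square_le_1)
  have U0: "U x \<ge> 0" "U (-x) \<ge> 0" "U y \<ge> 0" "U (-y) \<ge> 0"
    unfolding U_def using x y by (intro region_P_spectral_nonneg[OF assms(1)]; simp)+
  have sum: "U x + U (-x) + U y + U (-y) = 4"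
    unfolding U_def by (simp add: y2 algebra_simps)
  have w: "(1 + r)\<^sup>2 \<ge> (1 - r)\<^sup>2" "1 - r\<^sup>2 \<ge> (1 - r)\<^sup>2"
    using r by (simp_all add: power2_eq_square algebra_simps mult_left_le)
  \<comment> \<open>The weights are \<open>(1 + 2 r cos \<phi> + r^2 cos 2\<phi>) / 4\<close> at the
    shifts \<open>\<phi> = 0, pi, \<plusminus>pi/2\<close>. The smallest of them is
    \<open>(1 - r)^2 / 4\<close>, and the four values of \<open>U\<close> add up to 4.\<close>
  have "1 + 2 * (a * r) * x + 2 * (b * r\<^sup>2) * (2 * x\<^sup>2 - 1) =
     ((1 + r)\<^sup>2 * U x + (1 - r)\<^sup>2 * U (-x) + (1 - r\<^sup>2) * U y + (1 - r\<^sup>2) * U (-y)) / 4"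
    unfolding U_def by (simp add: y2 field_simps) (simp add: power2_eq_square algebra_simps)
  also have "\<dots> \<ge> ((1 - r)\<^sup>2 * U x + (1 - r)\<^sup>2 * U (-x) + (1 - r)\<^sup>2 * U y + (1 - r)\<^sup>2 * U (-y)) / 4"
    using U0 w by (intro divide_right_mono add_mono mult_right_mono) auto
  also have "((1 - r)\<^sup>2 * U x + (1 - r)\<^sup>2 * U (-x) + (1 - r)\<^sup>2 * U y + (1 - r)\<^sup>2 * U (-y)) / 4
      = (1 - r)\<^sup>2 * (U x + U (-x) + U y + U (-y)) / 4" by (simp add: algebra_simps)
  finally show ?thesis unfolding sum by simp
qed

text \<open>The density at a fixed \<open>x\<close> is affine in \<open>(a, b)\<close>. Moving from
  an interior point a little against the gradient direction \<open>(x, 2 * x^2 - 1)\<close>, which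
  never vanishes, strictly lowers the value while staying in the region, where it is still
  nonnegative.\<close>

lemma interior_region_P_spectral_pos:
  assumes "(a, b) \<in> interior region_P" and x: "\<bar>x\<bar> \<le> 1"
  shows "1 + 2 * a * x + 2 * b * (2 * x\<^sup>2 - 1) > 0"
proof -
  obtain e where e: "e > 0" "ball (a, b) e \<subseteq> region_P"
    using assms(1) by (meson mem_interior)
  define c where "c = 2 * x\<^sup>2 - 1"
  define n where "n = norm (x, c)"
  have n0: "n > 0" unfolding n_def c_def by (auto simp: prod_eq_iff)
  define d where "d = e / (2 * n)"
  have d0: "d > 0" using e n0 by (simp add: d_def)
  have "dist (a, b) (a - d * x, b - d * c) = norm (d *\<^sub>R (x, c))"
    by (simp add: dist_norm)
  also have "\<dots> = e / 2" using d0 n0 e(1) by (simp add: n_def[symmetric] d_def del: scaleR_Pair)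
  also have "\<dots> < e" using e by simp
  finally have "(a - d * x, b - d * c) \<in> region_P" using e by auto
  from region_P_spectral_nonneg[OF this x]
  have "1 + 2 * a * x + 2 * b * c - 2 * d * (x\<^sup>2 + c\<^sup>2) \<ge> 0"
    unfolding c_def[symmetric] by (simp add: power2_eq_square[of x] power2_eq_square[of c] algebra_simps)
  moreover have "x\<^sup>2 + c\<^sup>2 > 0" using n0 by (simp add: n_def norm_Pair sum_power2_gt_zero_iff)
  ultimately show ?thesis using d0 unfolding c_def
    by (smt (verit, best) mult_pos_pos)
qed

section \<open>From differentiability in \<open>sqrt (1 - r^2)\<close> to Landau bounds\<close>

lemma differentiable_imp_bigo:
  fixes G :: "real \<Rightarrow> real"
  assumes "(G has_real_derivative D) (at c)"
  shows "(\<lambda>u. G u - G c) \<in> O[at c](\<lambda>u. u - c)"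
proof (rule bigoI_tendsto)
  show "((\<lambda>u. (G u - G c) / (u - c)) \<longlongrightarrow> D) (at c)"
    using assms by (simp add: has_field_derivative_iff)
  show "\<forall>\<^sub>F x in at c. x - c \<noteq> 0" by (simp add: eventually_at_filter)
qed

lemma bigo_sqrt_one_minus_square:
  fixes G :: "real \<Rightarrow> real"
  assumes "(G has_real_derivative D) (at 0)"
  shows "(\<lambda>r. G (sqrt (1 - r\<^sup>2)) - G 0) \<in> O[at_left 1](\<lambda>r. sqrt (1 - r\<^sup>2))"
proof -
  have "filterlim (\<lambda>r::real. sqrt (1 - r\<^sup>2)) (at_right 0) (at_left 1)" by real_asymp
  hence "filterlim (\<lambda>r::real. sqrt (1 - r\<^sup>2)) (at 0) (at_left 1)"
    by (rule filterlim_mono) (simp_all add: at_le)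
  from landau_o.big.compose[OF differentiable_imp_bigo[OF assms] this]
  show ?thesis by simp
qed

text \<open>Dividing the linear remainder of \<open>G\<close> at 0 by
  \<open>u = sqrt (1 - r^2)\<close> leaves a bounded term, so only \<open>G 0\<close> survives as
  the coefficient of the singularity. The asymptotics on the arc, the segments and the vertex are
  reduced to this by exhibiting a suitable \<open>G\<close>.\<close>

lemma sqrt_singularity_bigo_one:
  fixes G f :: "real \<Rightarrow> real"
  assumes G: "(G has_real_derivative D) (at 0)"
    and f: "eventually (\<lambda>r. f r = G (sqrt (1 - r\<^sup>2)) / sqrt (1 - r\<^sup>2)) (at_left 1)"
  shows "(\<lambda>r. f r - G 0 * (1 / (1 - r\<^sup>2) powr (1/2))) \<in> O[at_left 1](\<lambda>_. 1)"
proof -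
  have ev: "eventually (\<lambda>r::real. sqrt (1 - r\<^sup>2) > 0) (at_left 1)" by real_asymp
  have "(\<lambda>r. (G (sqrt (1 - r\<^sup>2)) - G 0) / sqrt (1 - r\<^sup>2)) \<in> O[at_left 1](\<lambda>r. sqrt (1 - r\<^sup>2) / sqrt (1 - r\<^sup>2))"
    by (intro landau_o.big.divide_right bigo_sqrt_one_minus_square[OF G]) (use ev in eventually_elim, simp)
  also have "(\<lambda>r::real. sqrt (1 - r\<^sup>2) / sqrt (1 - r\<^sup>2)) \<in> \<Theta>[at_left 1](\<lambda>_. 1)"
    by (rule bigthetaI_cong) (use ev in eventually_elim, simp)
  finally show ?thesis
  proof (rule landau_o.big.in_cong[THEN iffD1, rotated])
    show "\<forall>\<^sub>F r in at_left 1. (G (sqrt (1 - r\<^sup>2)) - G 0) / sqrt (1 - r\<^sup>2) = f r - G 0 * (1 / (1 - r\<^sup>2) powr (1/2))"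
      using f ev by eventually_elim (simp add: powr_half_sqrt diff_divide_distrib)
  qed
qed

section \<open>Asymptotics of the mean\<close>

lemma eventually_at_left_1_I:
  fixes g :: "real \<Rightarrow> real"
  assumes "isCont g 1" "g 1 > 0"
  shows "eventually (\<lambda>r. g r > 0) (at_left 1)"
proof -
  have "(g \<longlongrightarrow> g 1) (at_left 1)"
    using assms(1) unfolding isCont_def by (rule tendsto_within_subset) auto
  thus ?thesis using assms(2) by (rule order_tendstoD)
qed

lemma differentiable_sqrt:
  fixes f :: "real \<Rightarrow> real"
  assumes "f differentiable at x" "f x > 0"
  shows "(\<lambda>x. sqrt (f x)) differentiable at x"
proof -
  obtain D where "(f has_real_derivative D) (at x)"
    using assms(1) by (auto simp: real_differentiable_def)
  from DERIV_chain2[OF DERIV_real_sqrt[OF assms(2)] this] show ?thesis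
    by (auto simp: real_differentiable_def)
qed

text \<open>On the arc \<open>sqrt R\<close> tends to \<open>6 * b - 1 > 0\<close>, and the
  degenerate factor is \<open>1 - 6 * b * t + w\<close> with \<open>t = r^2\<close> and
  \<open>w = sqrt R\<close>. Multiplied by its conjugate \<open>w + 6 * b * t - 1\<close> it becomes
  \<open>32 * b^2 * t * u^2\<close>; under the outer square root this yields one factor
  \<open>u\<close>, while the conjugate stays away from 0 and moves to the numerator of
  \<open>G\<close>.\<close>

lemma mean_fun_asymp_ellipse:
  fixes a b :: real
  assumes ab: "a\<^sup>2 / 8 + (b - 1/4)\<^sup>2 = 1/16" and b: "b > 1/6"
  shows "(\<lambda>r. mean_fun (a * r) (b * r\<^sup>2) - sqrt (2 * b / (6 * b - 1)) * (1 / (1 - r\<^sup>2) powr (1/2)))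
    \<in> O[at_left 1](\<lambda>_. 1)"
proof -
  have a2: "a\<^sup>2 = 4 * b - 8 * b\<^sup>2" using ab by (simp add: power2_eq_square field_simps)
  define W where "W = (\<lambda>u::real. sqrt ((6 * b * (1 - u\<^sup>2) - 1)\<^sup>2 + 32 * b\<^sup>2 * (1 - u\<^sup>2) * u\<^sup>2))"
  define G where "G = (\<lambda>u. (W u + 1 + (2 * b - 2 * a\<^sup>2) * (1 - u\<^sup>2)) * sqrt (W u + 6 * b * (1 - u\<^sup>2) - 1)
     / (W u * sqrt (32 * b\<^sup>2 * (1 - u\<^sup>2) * (1 + 2 * b * (1 - u\<^sup>2) + W u))))"
  have W0: "W 0 = 6 * b - 1" using b by (simp add: W_def)
  have D1: "W differentiable at 0"
    unfolding W_def using b by (intro differentiable_sqrt derivative_intros differentiable_ident differentiable_const) auto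
  have "G differentiable at 0"
    unfolding G_def using b by (intro differentiable_sqrt derivative_intros D1) (auto simp: W0 zero_less_mult_iff)
  then obtain D where D: "(G has_real_derivative D) (at 0)" by (auto simp: real_differentiable_def)
  have "sqrt (32 * b\<^sup>2 * (1 + 2 * b + (6 * b - 1))) = 16 * b * sqrt b"
  proof -
    have "32 * b\<^sup>2 * (1 + 2 * b + (6 * b - 1)) = (16 * b)\<^sup>2 * b" by (simp add: power2_eq_square algebra_simps)
    thus ?thesis using b by (simp add: real_sqrt_mult)
  qed
  hence "G 0 = (16 * b\<^sup>2) * sqrt (2 * (6 * b - 1)) / ((6 * b - 1) * (16 * b * sqrt b))"
    unfolding G_def W0 a2 by (simp add: power2_eq_square algebra_simps)
  also have "\<dots> = sqrt 2 * (b / sqrt b) * (sqrt (6 * b - 1) / (6 * b - 1))"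
  proof -
    have "16 * b\<^sup>2 * (q * k) / (c * (16 * b * d)) = q * (b / d) * (k / c)" for q k c d :: real
      using b by (simp add: power2_eq_square) (simp add: mult_ac)
    thus ?thesis unfolding real_sqrt_mult .
  qed
  also have "\<dots> = sqrt (2 * b / (6 * b - 1))"
    using b by (simp only: real_sqrt_divide real_sqrt_mult real_div_sqrt sqrt_divide_self_eq)
      (simp add: divide_simps)
  finally have G0: "G 0 = sqrt (2 * b / (6 * b - 1))" .
  have "eventually (\<lambda>r. 6 * b * r\<^sup>2 - 1 > 0) (at_left 1)"
    using b by (intro eventually_at_left_1_I continuous_intros) auto
  moreover have "eventually (\<lambda>r::real. 1 - r\<^sup>2 > 0) (at_left 1)" by real_asymp
  ultimately have "eventually (\<lambda>r. mean_fun (a * r) (b * r\<^sup>2) = G (sqrt (1 - r\<^sup>2)) / sqrt (1 - r\<^sup>2)) (at_left 1)"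
  proof eventually_elim
    case (elim r)
    define t u w where "t = r\<^sup>2" and "u = sqrt (1 - t)" and "w = W u"
    define c V where "c = w + 6 * b * t - 1" and "V = 1 + 2 * b * t + w"
    have u: "u > 0" "u\<^sup>2 = 1 - t" using elim by (simp_all add: u_def t_def)
    have t: "6 * b * t > 1" using elim by (simp add: t_def)
    have t0: "t \<ge> 0" by (simp add: t_def)
    have "(6 * b * t - 1)\<^sup>2 + 32 * b\<^sup>2 * t * (1 - t) \<ge> (6 * b * t - 1)\<^sup>2"
      using t0 u by (simp add: less_imp_le) (metis less_eq_real_def mult_nonneg_nonneg zero_le_power2 zero_less_power)
    moreover have "(6 * b * t - 1)\<^sup>2 > 0" using t by (simp)
    ultimately have "(6 * b * t - 1)\<^sup>2 + 32 * b\<^sup>2 * t * (1 - t) > 0" by (rule less_le_trans[rotated])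
    hence w2: "w > 0" "w\<^sup>2 = (6 * b * t - 1)\<^sup>2 + 32 * b\<^sup>2 * t * (1 - t)"
      unfolding w_def W_def u(2) by simp_all
    have R: "(1 + 2 * (b * r\<^sup>2))\<^sup>2 - 4 * (a * r)\<^sup>2 = w\<^sup>2"
      unfolding w2 power_mult_distrib a2 t_def by (simp add: power2_eq_square algebra_simps)
    have c0: "c > 0" using t w2 by (simp add: c_def)
    have V0: "V > 0" using t w2 by (simp add: V_def)
    have "(1 - 6 * b * t + w) * c = w\<^sup>2 - (6 * b * t - 1)\<^sup>2"
      by (simp add: c_def power2_eq_square algebra_simps)
    also have "\<dots> = u\<^sup>2 * (32 * b\<^sup>2 * t)" unfolding w2 u by simp
    finally have "1 - 6 * b * t + w = u\<^sup>2 * (32 * b\<^sup>2 * t) / c" using c0 by (simp add: field_simps)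
    hence "sqrt ((1 - 6 * b * t + w) * V) = sqrt (u\<^sup>2 * (32 * b\<^sup>2 * t * V) / c)" by simp
    also have "\<dots> = u * sqrt (32 * b\<^sup>2 * t * V) / sqrt c" 
      using u(1) by (simp only: real_sqrt_divide real_sqrt_mult real_sqrt_abs)
    finally have s: "sqrt ((1 - 6 * b * t + w) * V) = u * sqrt (32 * b\<^sup>2 * t * V) / sqrt c" .
    have "mean_fun (a * r) (b * r\<^sup>2) = (w + 1 + 2 * b * t - 2 * (a\<^sup>2 * t)) / (w * sqrt ((1 - 6 * b * t + w) * V))"
      unfolding mean_fun_def Let_def R using w2(1) by (simp add: t_def V_def power_mult_distrib mult.assoc)
    also have "\<dots> = (w + 1 + (2 * b - 2 * a\<^sup>2) * t) * sqrt c / (w * sqrt (32 * b\<^sup>2 * t * V)) / u"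
      unfolding s by (simp add: algebra_simps)
    also have "\<dots> = G u / u" unfolding G_def w_def[symmetric] u(2) c_def V_def by simp
    finally show ?case by (simp add: u_def t_def)
  qed
  from sqrt_singularity_bigo_one[OF D this] show ?thesis unfolding G0 .
qed

text \<open>Here \<open>R\<close> itself degenerates: it equals
  \<open>(1 - t) * (1 - 4 * b^2 * t)\<close> with \<open>t = r^2\<close>, so
  \<open>sqrt R = u * W u\<close>. The bounds on \<open>b\<close> keep \<open>1 - 4 * b^2\<close>,
  \<open>1 + 2 * b\<close> and \<open>1 - 6 * b\<close> positive, so \<open>G\<close> is
  differentiable at 0.\<close>

lemma mean_fun_asymp_segment:
  fixes a b :: real
  assumes ab: "b = \<bar>a\<bar> - 1/2" and b: "-1/2 < b" "b < 1/6"
  shows "(\<lambda>r. mean_fun (a * r) (b * r\<^sup>2) - 1/2 * sqrt ((1 - 2 * b) / (1 - 6 * b)) * (1 / (1 - r\<^sup>2) powr (1/2)))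
    \<in> O[at_left 1](\<lambda>_. 1)"
proof -
  have "a\<^sup>2 = \<bar>a\<bar>\<^sup>2" by simp
  also have "\<bar>a\<bar> = b + 1/2" using ab by simp
  finally have a2: "4 * a\<^sup>2 = (1 + 2 * b)\<^sup>2" by (simp add: power2_eq_square field_simps)
  have b2: "4 * b\<^sup>2 < 1" 
  proof -
    have "\<bar>2 * b\<bar> < 1" using b by auto
    hence "(2 * b)\<^sup>2 < 1" by (simp only: abs_square_less_1)
    thus ?thesis by (simp add: power_mult_distrib)
  qed
  define W where "W = (\<lambda>u::real. sqrt (1 - 4 * b\<^sup>2 * (1 - u\<^sup>2)))"
  define G where "G = (\<lambda>u. (u * W u + 1 + (2 * b - 2 * a\<^sup>2) * (1 - u\<^sup>2))
     / (W u * sqrt ((1 - 6 * b * (1 - u\<^sup>2) + u * W u) * (1 + 2 * b * (1 - u\<^sup>2) + u * W u))))"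
  have W0: "W 0 = sqrt ((1 - 2 * b) * (1 + 2 * b))" by (simp add: W_def power2_eq_square algebra_simps)
  have W0': "W 0 > 0" unfolding W0 using b by simp
  have D1: "W differentiable at 0"
    unfolding W_def using b2 by (intro differentiable_sqrt derivative_intros differentiable_ident differentiable_const) auto
  have "G differentiable at 0"
    unfolding G_def using b W0' by (intro differentiable_sqrt derivative_intros D1) (auto simp: zero_less_mult_iff)
  then obtain D where D: "(G has_real_derivative D) (at 0)" by (auto simp: real_differentiable_def)
  have "G 0 = (1 + 2 * b - 2 * a\<^sup>2) / (sqrt ((1 - 2 * b) * (1 + 2 * b)) * sqrt ((1 - 6 * b) * (1 + 2 * b)))"
    by (simp add: G_def W0)
  also have "1 + 2 * b - 2 * a\<^sup>2 = (1 + 2 * b) * (1 - 2 * b) / 2"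
    using a2 by (simp add: power2_eq_square algebra_simps)
  also have "sqrt ((1 - 2 * b) * (1 + 2 * b)) * sqrt ((1 - 6 * b) * (1 + 2 * b)) = (1 + 2 * b) * (sqrt (1 - 2 * b) * sqrt (1 - 6 * b))"
    using b by (simp add: real_sqrt_mult)
  also have "(1 + 2 * b) * (1 - 2 * b) / 2 / \<dots> = 1/2 * ((1 - 2 * b) / sqrt (1 - 2 * b) / sqrt (1 - 6 * b))"
    using b by simp
  also have "\<dots> = 1/2 * sqrt ((1 - 2 * b) / (1 - 6 * b))"
    using b by (subst real_div_sqrt) (simp_all add: real_sqrt_divide)
  finally have G0: "G 0 = 1/2 * sqrt ((1 - 2 * b) / (1 - 6 * b))" .
  have "eventually (\<lambda>r::real. 1 - r\<^sup>2 > 0) (at_left 1)" by real_asymp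
  hence "eventually (\<lambda>r. mean_fun (a * r) (b * r\<^sup>2) = G (sqrt (1 - r\<^sup>2)) / sqrt (1 - r\<^sup>2)) (at_left 1)"
  proof eventually_elim
    case (elim r)
    define t u w where "t = r\<^sup>2" and "u = sqrt (1 - t)" and "w = W u"
    have u: "u > 0" "u\<^sup>2 = 1 - t" using elim by (simp_all add: u_def t_def)
    have "4 * b\<^sup>2 * t \<le> 4 * b\<^sup>2" using elim by (intro mult_left_le) (auto simp: t_def)
    hence w2: "w > 0" "w\<^sup>2 = 1 - 4 * b\<^sup>2 * t" using b2 unfolding w_def W_def u(2) by simp_all
    have R: "(1 + 2 * (b * r\<^sup>2))\<^sup>2 - 4 * (a * r)\<^sup>2 = (u * w)\<^sup>2"
    proof -
      have "(1 + 2 * (b * r\<^sup>2))\<^sup>2 - 4 * (a * r)\<^sup>2 = (1 + 2 * (b * t))\<^sup>2 - (4 * a\<^sup>2) * t"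
        by (simp add: power_mult_distrib t_def)
      thus ?thesis unfolding a2 power_mult_distrib u w2 by (simp add: power2_eq_square algebra_simps)
    qed
    have rt: "sqrt ((u * w)\<^sup>2) = u * w" using w2 u by simp
    have "mean_fun (a * r) (b * r\<^sup>2) = (u * w + 1 + 2 * b * t - 2 * (a\<^sup>2 * t)) / 
        (u * w * sqrt ((1 - 6 * b * t + u * w) * (1 + 2 * b * t + u * w)))"
      unfolding mean_fun_def Let_def R rt by (simp add: t_def power_mult_distrib mult.assoc)
    also have "\<dots> = G u / u" unfolding G_def w_def[symmetric] u(2) by (simp add: algebra_simps)
    finally show ?case by (simp add: u_def t_def)
  qed
  from sqrt_singularity_bigo_one[OF D this] show ?thesis unfolding G0 .
qed

text \<open>At \<open>(0, -1/2)\<close> the density \<open>1 - cos 2\<theta>\<close> has double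
  zeros at both 0 and pi. Each contributes what the single zero contributes on a segment, so the
  coefficient is twice the value of the segment formula at \<open>b = -1/2\<close>. Algebraically,
  \<open>sqrt R = 1 + 2 * B = 1 - r^2\<close>, and one such factor cancels between numerator and
  denominator.\<close>

lemma mean_fun_asymp_vertex:
  "(\<lambda>r. mean_fun 0 (- 1/2 * r\<^sup>2) - sqrt (1/2) * (1 / (1 - r\<^sup>2) powr (1/2))) \<in> O[at_left 1](\<lambda>_. 1)"
proof -
  define G where "G = (\<lambda>u::real. 1 / sqrt (2 - u\<^sup>2))"
  have "G differentiable at 0"
    unfolding G_def by (intro differentiable_sqrt derivative_intros) auto
  then obtain D where D: "(G has_real_derivative D) (at 0)" by (auto simp: real_differentiable_def)
  have G0: "G 0 = sqrt (1/2)" by (simp add: G_def real_sqrt_divide)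
  have "eventually (\<lambda>r::real. 1 - r\<^sup>2 > 0) (at_left 1)" by real_asymp
  hence "eventually (\<lambda>r. mean_fun 0 (- 1/2 * r\<^sup>2) = G (sqrt (1 - r\<^sup>2)) / sqrt (1 - r\<^sup>2)) (at_left 1)"
  proof eventually_elim
    case (elim r)
    define z where "z = sqrt (2 - (sqrt (1 - r\<^sup>2))\<^sup>2) * sqrt (1 - r\<^sup>2)"
    have s: "sqrt ((1 - r\<^sup>2)\<^sup>2) = 1 - r\<^sup>2" using elim by simp
    have "(1 + 3 * r\<^sup>2 + (1 - r\<^sup>2)) * (1 - r\<^sup>2 + (1 - r\<^sup>2)) = 2\<^sup>2 * ((2 - (1 - r\<^sup>2)) * (1 - r\<^sup>2))"
      by (simp add: algebra_simps power2_eq_square power4_eq_xxxx)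
    hence "sqrt ((1 + 3 * r\<^sup>2 + (1 - r\<^sup>2)) * (1 - r\<^sup>2 + (1 - r\<^sup>2))) = 2 * z"
      using elim by (simp only: real_sqrt_mult z_def) simp
    moreover have "mean_fun 0 (- 1/2 * r\<^sup>2) = (2 * (1 - r\<^sup>2)) / ((1 - r\<^sup>2) * sqrt ((1 + 3 * r\<^sup>2 + (1 - r\<^sup>2)) * (1 - r\<^sup>2 + (1 - r\<^sup>2))))"
      unfolding mean_fun_def Let_def using s by simp
    moreover have "2 * (1 - r\<^sup>2) / ((1 - r\<^sup>2) * (2 * z)) = 1 / z"
      using elim mult_divide_mult_cancel_left[of "2 * (1 - r\<^sup>2)" 1 z] by (simp add: mult_ac)
    ultimately have "mean_fun 0 (- 1/2 * r\<^sup>2) = 1 / z" by (simp only:)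
    thus ?case by (simp add: G_def z_def)
  qed
  from sqrt_singularity_bigo_one[OF D this] show ?thesis unfolding G0 .
qed

text \<open>Both degenerations meet: \<open>sqrt R = u * w\<close>, and also
  \<open>1 - t + u * w = u * (u + w)\<close> tends to 0. The denominator thus carries
  \<open>u * sqrt u = (1 - r^2) powr (3/4)\<close>, and the linear remainder of \<open>G\<close>
  leaves an error of order \<open>u / (u * sqrt u)\<close>.\<close>

lemma mean_fun_asymp_corner:
  fixes a :: real
  assumes a: "a\<^sup>2 = 4/9"
  shows "(\<lambda>r. mean_fun (a * r) (1/6 * r\<^sup>2) - 1 / 2 powr (5/4) * (1 / (1 - r\<^sup>2) powr (3/4)))
    \<in> O[at_left 1](\<lambda>r. 1 / (1 - r\<^sup>2) powr (1/4))"
proof -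
  define W where "W = (\<lambda>u::real. sqrt ((8 + u\<^sup>2) / 9))"
  define G where "G = (\<lambda>u. (u * W u + (4 + 5 * u\<^sup>2) / 9) / (W u * sqrt ((u + W u) * ((4 - u\<^sup>2) / 3 + u * W u))))"
  have D1: "W differentiable at 0"
    unfolding W_def by (intro differentiable_sqrt derivative_intros differentiable_ident differentiable_const) auto
  have W0: "W 0 > 0" by (simp add: W_def)
  have "G differentiable at 0"
    unfolding G_def using W0 by (intro differentiable_sqrt derivative_intros D1) (auto simp: zero_less_mult_iff)
  then obtain D where D: "(G has_real_derivative D) (at 0)" by (auto simp: real_differentiable_def)
  \<comment> \<open>\<open>G 0\<close> contains nested square roots; both sides are nonnegative and
    have the rational fourth power \<open>1/32\<close>.\<close>
  have G0: "G 0 = 1 / 2 powr (5/4)"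
  proof (rule power_eq_imp_eq_base)
    have s4: "sqrt x ^ 4 = x\<^sup>2" if "x \<ge> 0" for x
      using that by (simp add: power4_eq_xxxx power2_eq_square)
    have "G 0 ^ 4 = (4/9)^4 / (W 0 ^ 4 * (W 0 * (4/3))\<^sup>2)"
      unfolding G_def using W0 by (simp add: power_divide power_mult_distrib s4)
    also have "W 0 ^ 4 * (W 0 * (4/3))\<^sup>2 = (W 0)\<^sup>2 * (W 0)\<^sup>2 * (W 0)\<^sup>2 * (16/9)"
      by (simp add: power4_eq_xxxx power2_eq_square)
    also have "(W 0)\<^sup>2 = 8/9" by (simp add: W_def)
    finally have "G 0 ^ 4 = 1/32" by (simp add: power4_eq_xxxx)
    moreover have "(1 / 2 powr (5/4)) ^ 4 = (1/32 :: real)"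
    proof -
      have "((2::real) powr (5/4)) ^ 4 = 2 powr 5"
        by (subst powr_power) auto
      also have "\<dots> = 32" by (subst powr_numeral) auto
      finally show ?thesis by (simp add: power_divide)
    qed
    ultimately show "G 0 ^ 4 = (1 / 2 powr (5/4)) ^ 4" by simp
    show "G 0 \<ge> 0" using W0 by (simp add: G_def)
  qed auto
  have ev: "eventually (\<lambda>r::real. 1 - r\<^sup>2 > 0) (at_left 1)" by real_asymp
  hence eq: "eventually (\<lambda>r. mean_fun (a * r) (1/6 * r\<^sup>2) = G (sqrt (1 - r\<^sup>2)) / (1 - r\<^sup>2) powr (3/4)) (at_left 1)"
  proof eventually_elim
    case (elim r)
    define t u w where "t = r\<^sup>2" and "u = sqrt (1 - t)" and "w = W u"
    have u: "u > 0" "u\<^sup>2 = 1 - t" using elim by (simp_all add: u_def t_def)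
    have t0: "t \<ge> 0" "t = 1 - u\<^sup>2" using u by (simp_all add: t_def)
    have w2: "w > 0" "w\<^sup>2 = (9 - t) / 9" unfolding w_def W_def u(2) using elim by (simp_all add: t_def)
    have R: "(1 + 2 * (1/6 * r\<^sup>2))\<^sup>2 - 4 * (a * r)\<^sup>2 = (u * w)\<^sup>2"
    proof -
      have "(1 + 2 * (1/6 * r\<^sup>2))\<^sup>2 - 4 * (a * r)\<^sup>2 = (1 + t / 3)\<^sup>2 - 16/9 * t"
        by (simp add: power_mult_distrib t_def a)
      thus ?thesis unfolding power_mult_distrib u w2 by (simp add: power2_eq_square field_simps)
    qed
    have "(1 - t + u * w) * (1 + t / 3 + u * w) = u * ((u + w) * ((4 - u\<^sup>2) / 3 + u * w))"
      by (simp add: t0(2) power2_eq_square field_simps)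
    hence s: "sqrt ((1 - t + u * w) * (1 + t / 3 + u * w)) = sqrt u * sqrt ((u + w) * ((4 - u\<^sup>2) / 3 + u * w))"
      by (simp only: real_sqrt_mult)
    have "sqrt u = (1 - r\<^sup>2) powr (1/4)" 
      using elim by (simp add: u_def t_def powr_half_sqrt[symmetric] powr_powr)
    moreover have "u = (1 - r\<^sup>2) powr (1/2)" using elim by (simp add: u_def t_def powr_half_sqrt)
    ultimately have us: "u * sqrt u = (1 - r\<^sup>2) powr (3/4)"
      by (simp add: powr_add[symmetric])
    have rt: "sqrt ((u * w)\<^sup>2) = u * w" using w2 u by simp
    have "mean_fun (a * r) (1/6 * r\<^sup>2) = (u * w + 1 + t / 3 - 2 * (a\<^sup>2 * t)) / 
        (u * w * sqrt ((1 - t + u * w) * (1 + t / 3 + u * w)))"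
      unfolding mean_fun_def Let_def R rt by (simp add: t_def power_mult_distrib)
    also have "\<dots> = (u * w + (4 + 5 * u\<^sup>2) / 9) / (w * sqrt ((u + w) * ((4 - u\<^sup>2) / 3 + u * w))) / (u * sqrt u)"
    proof -
      have "u * w + 1 + t / 3 - 2 * (a\<^sup>2 * t) = u * w + (4 + 5 * u\<^sup>2) / 9"
        unfolding a by (simp add: t0(2) field_simps)
      thus ?thesis unfolding s by (simp add: mult_ac)
    qed
    also have "\<dots> = G u / (u * sqrt u)" unfolding G_def w_def[symmetric] by simp
    finally show ?case unfolding us by (simp add: u_def t_def)
  qed
  have "(\<lambda>r. (G (sqrt (1 - r\<^sup>2)) - G 0) / (1 - r\<^sup>2) powr (3/4)) \<in> O[at_left 1](\<lambda>r. sqrt (1 - r\<^sup>2) / (1 - r\<^sup>2) powr (3/4))"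
    by (intro landau_o.big.divide_right bigo_sqrt_one_minus_square[OF D]) (use ev in eventually_elim, simp)
  also have "(\<lambda>r::real. sqrt (1 - r\<^sup>2) / (1 - r\<^sup>2) powr (3/4)) \<in> \<Theta>[at_left 1](\<lambda>r. 1 / (1 - r\<^sup>2) powr (1/4))"
    by real_asymp
  finally show ?thesis
  proof (rule landau_o.big.in_cong[THEN iffD1, rotated])
    show "\<forall>\<^sub>F r in at_left 1. (G (sqrt (1 - r\<^sup>2)) - G 0) / (1 - r\<^sup>2) powr (3/4) = 
       mean_fun (a * r) (1/6 * r\<^sup>2) - 1 / 2 powr (5/4) * (1 / (1 - r\<^sup>2) powr (3/4))"
      using eq by eventually_elim (simp add: G0 diff_divide_distrib)
  qed
qed

lemma mean_fun_asymp_regular: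
  fixes a b :: real
  assumes pos: "\<And>x. \<bar>x\<bar> \<le> 1 \<Longrightarrow> 1 + 2 * a * x + 2 * b * (2 * x\<^sup>2 - 1) > 0"
  shows "(\<lambda>r. mean_fun (a * r) (b * r\<^sup>2) - mean_fun a b) \<in> O[at_left 1](\<lambda>r. 1 - r\<^sup>2)"
proof -
  define W where "W = (\<lambda>r. sqrt ((1 + 2 * (b * r\<^sup>2))\<^sup>2 - 4 * (a * r)\<^sup>2))"
  have "(1 + 2 * b)\<^sup>2 - 4 * a\<^sup>2 > 0" by (rule discriminant_pos[OF pos])
  hence W1: "W 1 > 0" "(1 + 2 * b)\<^sup>2 - 4 * a\<^sup>2 > 0" unfolding W_def by simp_all
  have "1 - 6 * b + W 1 > 0" using outer_factor_pos[OF pos] by (simp add: W_def)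
  moreover have "1 + 2 * b > 2 * \<bar>a\<bar>" by (rule sum_endpoints_pos[OF pos])
  ultimately have W2: "1 - 6 * b + W 1 > 0" "1 + 2 * b + W 1 > 0" using W1 by linarith+
  have D1: "W differentiable at 1"
    unfolding W_def using W1(2) by (intro differentiable_sqrt derivative_intros differentiable_ident differentiable_const) auto
  have "(\<lambda>r. (W r + 1 + 2 * (b * r\<^sup>2) - 2 * (a * r)\<^sup>2) / 
      (W r * sqrt ((1 - 6 * (b * r\<^sup>2) + W r) * (1 + 2 * (b * r\<^sup>2) + W r)))) differentiable at 1"
    using W1 W2 by (intro differentiable_sqrt derivative_intros D1) (auto simp: zero_less_mult_iff)
  then obtain D where "((\<lambda>r. mean_fun (a * r) (b * r\<^sup>2)) has_real_derivative D) (at 1)"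
    unfolding mean_fun_def Let_def W_def real_differentiable_def by blast
  from differentiable_imp_bigo[OF this]
  have "(\<lambda>r. mean_fun (a * r) (b * r\<^sup>2) - mean_fun a b) \<in> O[at 1](\<lambda>r. r - 1)" by simp
  hence "(\<lambda>r. mean_fun (a * r) (b * r\<^sup>2) - mean_fun a b) \<in> O[at_left 1](\<lambda>r. r - 1)"
    by (rule landau_o.big.filter_mono[rotated]) (simp add: at_le)
  also have "(\<lambda>r::real. r - 1) \<in> \<Theta>[at_left 1](\<lambda>r. 1 - r\<^sup>2)" by real_asymp
  finally show ?thesis .
qed

section \<open>Ratios of jointly Gaussian variables\<close>

lemma norm_iexp_minus_1_le: "norm (iexp x - 1) \<le> \<bar>x\<bar>"
  using iexp_approx1[of x 0] by simp

lemma norm_mult_iexp: "norm (z * iexp x) = norm z" for z :: complex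
  by (simp add: norm_mult)

lemma integrable_mult_iexp:
  fixes Z :: "'w \<Rightarrow> complex" and T :: "'w \<Rightarrow> real"
  assumes Z: "integrable M Z" and T[measurable]: "T \<in> borel_measurable M"
  shows "integrable M (\<lambda>\<omega>. Z \<omega> * iexp (T \<omega>))"
proof (rule Bochner_Integration.integrable_bound[OF Z])
  show "(\<lambda>\<omega>. Z \<omega> * iexp (T \<omega>)) \<in> borel_measurable M"
    using borel_measurable_integrable[OF Z] by measurable
qed (simp only: norm_mult_iexp order_refl AE_I2)

text \<open>Difference quotients along \<open>h n = 1 / (n + 1)\<close> are dominated by
  \<open>|Z * T|\<close> because of \<open>|exp (i x) - 1| \<le> |x|\<close>. Mixed moments thus
  become derivatives of characteristic functions, which also covers degenerate
  \<open>T\<close>.\<close>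

lemma integral_iexp_derivative:
  fixes Z :: "'w \<Rightarrow> complex" and T :: "'w \<Rightarrow> real"
  assumes Z: "integrable M Z" and ZT: "integrable M (\<lambda>\<omega>. Z \<omega> * T \<omega>)"
    and T[measurable]: "T \<in> borel_measurable M"
    and eq: "\<And>e. (\<integral>\<omega>. Z \<omega> * iexp (e * T \<omega>) \<partial>M) = of_real (G e)"
    and G: "(G has_real_derivative D) (at x)"
  shows "(\<integral>\<omega>. Z \<omega> * T \<omega> * iexp (x * T \<omega>) \<partial>M) = - \<i> * of_real D"
proof -
  note [measurable] = borel_measurable_integrable[OF Z]
  define h :: "nat \<Rightarrow> real" where "h n = 1 / real (Suc n)" for n
  have h0: "h n \<noteq> 0" for n by (simp add: h_def)
  have hlim: "h \<longlonglongrightarrow> 0" unfolding h_def by (rule LIMSEQ_Suc[OF lim_1_over_n])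
  have int: "integrable M (\<lambda>\<omega>. Z \<omega> * iexp (e * T \<omega>))" for e
    by (rule integrable_mult_iexp[OF Z]) measurable
  have "(\<lambda>n. \<integral>\<omega>. (Z \<omega> * iexp ((x + h n) * T \<omega>) - Z \<omega> * iexp (x * T \<omega>)) / of_real (h n) \<partial>M)
     \<longlonglongrightarrow> (\<integral>\<omega>. \<i> * (Z \<omega> * T \<omega> * iexp (x * T \<omega>)) \<partial>M)"
  proof (rule integral_dominated_convergence)
    show "integrable M (\<lambda>\<omega>. norm (Z \<omega> * T \<omega>))" using ZT by simp
    show "AE \<omega> in M. norm ((Z \<omega> * iexp ((x + h n) * T \<omega>) - Z \<omega> * iexp (x * T \<omega>)) / of_real (h n)) \<le> norm (Z \<omega> * T \<omega>)" for n
    proof (rule AE_I2)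
      fix \<omega>
      have "Z \<omega> * iexp ((x + h n) * T \<omega>) - Z \<omega> * iexp (x * T \<omega>) = Z \<omega> * (iexp (h n * T \<omega>) - 1) * iexp (x * T \<omega>)"
        by (simp add: algebra_simps exp_add)
      hence "norm (Z \<omega> * iexp ((x + h n) * T \<omega>) - Z \<omega> * iexp (x * T \<omega>)) = norm (Z \<omega>) * norm (iexp (h n * T \<omega>) - 1)"
        by (simp add: norm_mult)
      also have "\<dots> \<le> norm (Z \<omega>) * \<bar>h n * T \<omega>\<bar>"
        by (intro mult_left_mono norm_iexp_minus_1_le) auto
      finally show "norm ((Z \<omega> * iexp ((x + h n) * T \<omega>) - Z \<omega> * iexp (x * T \<omega>)) / of_real (h n)) \<le> norm (Z \<omega> * T \<omega>)"
        using h0[of n] by (simp add: norm_divide norm_mult abs_mult field_simps)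
    qed
    show "AE \<omega> in M. (\<lambda>n. (Z \<omega> * iexp ((x + h n) * T \<omega>) - Z \<omega> * iexp (x * T \<omega>)) / of_real (h n))
      \<longlonglongrightarrow> \<i> * (Z \<omega> * T \<omega> * iexp (x * T \<omega>))"
    proof (rule AE_I2)
      fix \<omega>
      have "((\<lambda>z. Z \<omega> * exp (\<i> * (z * of_real (T \<omega>)))) has_field_derivative \<i> * (Z \<omega> * T \<omega> * iexp (x * T \<omega>))) (at (of_real x))"
        by (auto intro!: derivative_eq_intros)
      hence "((\<lambda>k. (Z \<omega> * exp (\<i> * ((of_real x + k) * of_real (T \<omega>))) - Z \<omega> * exp (\<i> * (of_real x * of_real (T \<omega>)))) / k) \<longlongrightarrow> 
         \<i> * (Z \<omega> * T \<omega> * iexp (x * T \<omega>))) (at 0)" by (simp add: DERIV_def)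
      moreover have "filterlim (\<lambda>n. complex_of_real (h n)) (at 0) sequentially"
        unfolding filterlim_at using tendsto_of_real[OF hlim] h0 by (auto intro!: always_eventually)
      ultimately have "(\<lambda>n. (Z \<omega> * exp (\<i> * ((of_real x + of_real (h n)) * of_real (T \<omega>))) - Z \<omega> * exp (\<i> * (of_real x * of_real (T \<omega>)))) / of_real (h n))
         \<longlonglongrightarrow> \<i> * (Z \<omega> * T \<omega> * iexp (x * T \<omega>))" by (rule filterlim_compose)
      thus "(\<lambda>n. (Z \<omega> * iexp ((x + h n) * T \<omega>) - Z \<omega> * iexp (x * T \<omega>)) / of_real (h n))
        \<longlonglongrightarrow> \<i> * (Z \<omega> * T \<omega> * iexp (x * T \<omega>))" by simp
    qed
  qed measurable
  also have "(\<lambda>n. \<integral>\<omega>. (Z \<omega> * iexp ((x + h n) * T \<omega>) - Z \<omega> * iexp (x * T \<omega>)) / of_real (h n) \<partial>M)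
      = (\<lambda>n. of_real ((G (x + h n) - G x) / h n))"
    using int eq by (simp del: of_real_add of_real_mult)
  finally have lim1: "(\<lambda>n. complex_of_real ((G (x + h n) - G x) / h n)) \<longlonglongrightarrow> (\<integral>\<omega>. \<i> * (Z \<omega> * T \<omega> * iexp (x * T \<omega>)) \<partial>M)" .
  have "filterlim h (at 0) sequentially"
    unfolding filterlim_at using hlim h0 by (auto intro!: always_eventually)
  moreover have "((\<lambda>k. (G (x + k) - G x) / k) \<longlongrightarrow> D) (at 0)" using G by (simp add: DERIV_def)
  ultimately have "(\<lambda>n. (G (x + h n) - G x) / h n) \<longlonglongrightarrow> D" by (rule filterlim_compose[rotated])
  hence "(\<lambda>n. complex_of_real ((G (x + h n) - G x) / h n)) \<longlonglongrightarrow> of_real D" by (rule tendsto_of_real)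
  from LIMSEQ_unique[OF lim1 this] have "\<i> * (\<integral>\<omega>. Z \<omega> * T \<omega> * iexp (x * T \<omega>) \<partial>M) = of_real D" by simp
  thus ?thesis by (metis (no_types, lifting) complex_i_mult_minus mult.assoc mult_minus_left minus_minus)
qed

text \<open>\<open>exp (- T^2 / 2)\<close> is the characteristic function of the standard normal law
  at \<open>T\<close>, so it is the average of \<open>exp (i p T)\<close> over an auxiliary normal
  frequency \<open>p\<close>; Fubini exchanges the two averages.\<close>

lemma integral_gaussian_mixture:
  fixes Z :: "'w \<Rightarrow> complex" and T :: "'w \<Rightarrow> real"
  assumes "prob_space M" and Z: "integrable M Z" and T[measurable]: "T \<in> borel_measurable M"
  shows "(\<integral>\<omega>. Z \<omega> * exp (- ((T \<omega>)\<^sup>2 / 2)) \<partial>M) = (\<integral>p. (\<integral>\<omega>. Z \<omega> * iexp (p * T \<omega>) \<partial>M) \<partial>std_normal_distribution)"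
proof -
  interpret M: prob_space M by fact
  interpret N: real_distribution std_normal_distribution by (rule real_dist_normal_dist)
  interpret P: pair_sigma_finite M std_normal_distribution ..
  note [measurable] = borel_measurable_integrable[OF Z]
  have int: "integrable (M \<Otimes>\<^sub>M std_normal_distribution) (\<lambda>(\<omega>, p). Z \<omega> * iexp (p * T \<omega>))"
  proof (rule P.Fubini_integrable)
    show "integrable M (\<lambda>x. LINT y|std_normal_distribution. norm (case (x, y) of (\<omega>, p) \<Rightarrow> Z \<omega> * iexp (p * T \<omega>)))"
      using Z N.prob_space by (simp add: norm_mult_iexp del: of_real_mult)
    show "AE x in M. integrable std_normal_distribution (\<lambda>y. case (x, y) of (\<omega>, p) \<Rightarrow> Z \<omega> * iexp (p * T \<omega>))"
      by (intro AE_I2, simp, intro integrable_mult_right N.integrable_iexp) auto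
  qed measurable
  have "(\<integral>p. (\<integral>\<omega>. Z \<omega> * iexp (p * T \<omega>) \<partial>M) \<partial>std_normal_distribution) = (\<integral>\<omega>. (\<integral>p. Z \<omega> * iexp (p * T \<omega>) \<partial>std_normal_distribution) \<partial>M)"
    by (rule P.Fubini_integral[OF int])
  also have "\<dots> = (\<integral>\<omega>. Z \<omega> * exp (- ((T \<omega>)\<^sup>2 / 2)) \<partial>M)"
  proof (rule Bochner_Integration.integral_cong[OF refl])
    fix \<omega>
    have "(\<integral>p. iexp (T \<omega> * p) \<partial>std_normal_distribution) = exp (- ((T \<omega>)\<^sup>2 / 2))"
      using fun_cong[OF char_std_normal_distribution, of "T \<omega>"] unfolding char_def by simp
    thus "(\<integral>p. Z \<omega> * iexp (p * T \<omega>) \<partial>std_normal_distribution) = Z \<omega> * exp (- ((T \<omega>)\<^sup>2 / 2))"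
      by (simp add: mult.commute[of _ "T \<omega>"] del: of_real_exp)
  qed
  finally show ?thesis by simp
qed

lemma integral_std_normal_exp_square:
  fixes k :: real
  assumes "k \<ge> 0"
  shows "(\<integral>p. exp (- (k * p\<^sup>2 / 2)) \<partial>std_normal_distribution) = 1 / sqrt (1 + k)"
proof -
  define \<sigma> where "\<sigma> = 1 / sqrt (1 + k)"
  have \<sigma>: "\<sigma> > 0" "\<sigma>\<^sup>2 = 1 / (1 + k)" using assms by (simp_all add: \<sigma>_def power_divide)
  have "(\<integral>p. exp (- (k * p\<^sup>2 / 2)) \<partial>std_normal_distribution) = (\<integral>p. std_normal_density p * exp (- (k * p\<^sup>2 / 2)) \<partial>lborel)"
    by (subst integral_density) (auto simp: normal_density_nonneg)
  also have "\<dots> = (\<integral>p. \<sigma> * normal_density 0 \<sigma> p \<partial>lborel)"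
  proof (rule Bochner_Integration.integral_cong[OF refl])
    fix p :: real
    have "p\<^sup>2 / (2 * \<sigma>\<^sup>2) = p\<^sup>2 / 2 + k * p\<^sup>2 / 2" using assms unfolding \<sigma> by (simp add: field_simps)
    thus "std_normal_density p * exp (- (k * p\<^sup>2 / 2)) = \<sigma> * normal_density 0 \<sigma> p"
      using \<sigma>(1) by (simp add: normal_density_def real_sqrt_mult exp_add[symmetric] exp_diff[symmetric])
  qed
  also have "\<dots> = \<sigma>" using \<sigma> by simp
  finally show ?thesis by (simp add: \<sigma>_def)
qed

text \<open>A test function \<open>Z\<close> is only seen through its pairing with the characters of \<open>X\<close>; Gaussian weights
  \<open>exp (- s\<^sup>2 |X|\<^sup>2 / 2)\<close> are mixtures of characters.\<close>

lemma integral_gaussian_weight: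
  fixes Z X :: "'w \<Rightarrow> complex" and K v s :: real
  assumes M: "prob_space M" and Z: "integrable M Z" and X[measurable]: "X \<in> borel_measurable M" and v: "v \<ge> 0"
    and cf: "\<And>c. (\<integral>\<omega>. Z \<omega> * iexp (Re (c * X \<omega>)) \<partial>M) = of_real (K * exp (- ((norm c)\<^sup>2 * v / 4)))"
  shows "(\<integral>\<omega>. Z \<omega> * exp (- (s\<^sup>2 * (norm (X \<omega>))\<^sup>2 / 2)) \<partial>M) = of_real (K / (1 + s\<^sup>2 * v / 2))"
proof -
  note [measurable] = borel_measurable_integrable[OF Z]
  let ?N = std_normal_distribution
  define k where "k = s\<^sup>2 * v / 2"
  have k: "k \<ge> 0" using v by (simp add: k_def)
  \<comment> \<open>The weight of \<open>X\<close> is the product of the weights of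
    \<open>Re X\<close> and \<open>Im X\<close>. The first is absorbed into the test function while
    the second is expanded into characters; then the roles change.\<close>
  define Z' where "Z' = (\<lambda>\<omega>. Z \<omega> * exp (- ((s * Re (X \<omega>))\<^sup>2 / 2)))"
  have Z': "integrable M Z'" unfolding Z'_def
    by (rule Bochner_Integration.integrable_bound[OF Z]) (auto simp: norm_mult mult_left_le)
  have "(\<integral>\<omega>. Z \<omega> * exp (- (s\<^sup>2 * (norm (X \<omega>))\<^sup>2 / 2)) \<partial>M) = (\<integral>\<omega>. Z' \<omega> * exp (- ((s * Im (X \<omega>))\<^sup>2 / 2)) \<partial>M)"
    by (intro Bochner_Integration.integral_cong refl)
      (simp add: Z'_def mult.assoc exp_add[symmetric] cmod_power2 power_mult_distrib field_simps flip: of_real_mult of_real_exp)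
  also have "\<dots> = (\<integral>p. (\<integral>\<omega>. Z' \<omega> * iexp (p * (s * Im (X \<omega>))) \<partial>M) \<partial>?N)"
    by (rule integral_gaussian_mixture[OF M Z']) simp
  also have "\<dots> = (\<integral>p. (\<integral>q. of_real (K * (exp (- (k * p\<^sup>2 / 2)) * exp (- (k * q\<^sup>2 / 2)))) \<partial>?N) \<partial>?N)"
  proof (rule Bochner_Integration.integral_cong[OF refl])
    fix p :: real
    have "(\<integral>\<omega>. Z' \<omega> * iexp (p * (s * Im (X \<omega>))) \<partial>M) = (\<integral>\<omega>. (Z \<omega> * iexp (p * (s * Im (X \<omega>)))) * exp (- ((s * Re (X \<omega>))\<^sup>2 / 2)) \<partial>M)"
      by (intro Bochner_Integration.integral_cong refl) (simp add: Z'_def mult_ac)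
    also have "\<dots> = (\<integral>q. (\<integral>\<omega>. Z \<omega> * iexp (p * (s * Im (X \<omega>))) * iexp (q * (s * Re (X \<omega>))) \<partial>M) \<partial>?N)"
      by (rule integral_gaussian_mixture[OF M]) (auto intro!: integrable_mult_iexp[OF Z] simp del: of_real_mult)
    also have "\<dots> = (\<integral>q. of_real (K * (exp (- (k * p\<^sup>2 / 2)) * exp (- (k * q\<^sup>2 / 2)))) \<partial>?N)"
    proof (rule Bochner_Integration.integral_cong[OF refl])
      fix q :: real
      \<comment> \<open>The signs make \<open>Re (c * X)\<close> equal to
        \<open>q * s * Re X + p * s * Im X\<close>.\<close>
      define c where "c = Complex (q * s) (- (p * s))"
      have "(\<integral>\<omega>. Z \<omega> * iexp (p * (s * Im (X \<omega>))) * iexp (q * (s * Re (X \<omega>))) \<partial>M) = (\<integral>\<omega>. Z \<omega> * iexp (Re (c * X \<omega>)) \<partial>M)"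
        by (intro Bochner_Integration.integral_cong refl)
          (simp add: c_def mult.assoc exp_add[symmetric] algebra_simps)
      also have "\<dots> = of_real (K * exp (- ((norm c)\<^sup>2 * v / 4)))" by (rule cf)
      also have "(norm c)\<^sup>2 * v / 4 = k * p\<^sup>2 / 2 + k * q\<^sup>2 / 2"
        by (simp add: c_def k_def cmod_power2 power_mult_distrib field_simps)
      finally show "(\<integral>\<omega>. Z \<omega> * iexp (p * (s * Im (X \<omega>))) * iexp (q * (s * Re (X \<omega>))) \<partial>M) 
          = of_real (K * (exp (- (k * p\<^sup>2 / 2)) * exp (- (k * q\<^sup>2 / 2))))"
        by (simp add: exp_add[symmetric])
    qed
    finally show "(\<integral>\<omega>. Z' \<omega> * iexp (p * (s * Im (X \<omega>))) \<partial>M) 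
        = (\<integral>q. of_real (K * (exp (- (k * p\<^sup>2 / 2)) * exp (- (k * q\<^sup>2 / 2)))) \<partial>?N)" .
  qed
  also have "\<dots> = of_real (\<integral>p. (\<integral>q. (K * (exp (- (k * p\<^sup>2 / 2)) * exp (- (k * q\<^sup>2 / 2)))) \<partial>?N) \<partial>?N)"
    by (simp only: integral_complex_of_real)
  also have "(\<integral>p. (\<integral>q. (K * (exp (- (k * p\<^sup>2 / 2)) * exp (- (k * q\<^sup>2 / 2)))) \<partial>?N) \<partial>?N) = K * (1 / sqrt (1 + k) * (1 / sqrt (1 + k)))"
    by (simp add: integral_std_normal_exp_square[OF k] del: times_divide_eq_right)
  also have "\<dots> = K / (1 + s\<^sup>2 * v / 2)" using k by (simp add: k_def)
  finally show ?thesis .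
qed

section \<open>Inverse moments of a complex Gaussian variable\<close>

lemma borel_measurable_cnj [measurable (raw)]:
  "f \<in> borel_measurable M \<Longrightarrow> (\<lambda>x. cnj (f x)) \<in> borel_measurable M"
  by (rule borel_measurable_continuous_on[where f = cnj]) (auto intro!: continuous_intros)

text \<open>For \<open>x > 0\<close> this is \<open>sqrt (pi / 2) / x\<close>. It stands in for
  \<open>1 / x\<close> because it is built from Gaussian weights, and because it is infinite at 0,
  where \<open>1 / x\<close> has the default value 0; finiteness of its expectation therefore
  excludes zeros.\<close>

definition gaussian_tail :: "real \<Rightarrow> ennreal" where
  "gaussian_tail x = (\<integral>\<^sup>+s. ennreal (exp (- (s\<^sup>2 * x\<^sup>2 / 2))) * indicator {0..} s \<partial>lborel)"

lemma gaussian_tail_0: "gaussian_tail 0 = \<infinity>"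
proof -
  have "emeasure lborel {0::real..} \<ge> of_nat n" for n
  proof -
    have "emeasure lborel {0..real n} \<le> emeasure lborel {0::real..}" by (intro emeasure_mono) auto
    thus ?thesis by (simp add: ennreal_of_nat_eq_real_of_nat)
  qed
  hence "emeasure lborel {0::real..} = \<top>"
    by (metis ennreal_Ex_less_of_nat linorder_not_le top.not_eq_extremum)
  thus ?thesis by (simp add: gaussian_tail_def)
qed

text \<open>On \<open>s \<le> 1 / x\<close> the integrand is at least \<open>exp (-1/2)\<close>. At
  \<open>x = 0\<close> the left-hand side is 0 by the convention for division.\<close>

lemma inverse_le_gaussian_tail:
  assumes x: "x \<ge> 0"
  shows "ennreal (1 / x) \<le> ennreal (exp (1/2)) * gaussian_tail x"
proof (cases "x = 0")
  case False
  hence x0: "x > 0" using x by simp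
  have "ennreal (1 / x) = ennreal (exp (1/2)) * (ennreal (exp (-1/2)) * ennreal (1 / x))"
    by (simp add: mult.assoc[symmetric] ennreal_mult[symmetric] exp_add[symmetric])
  also have "ennreal (exp (-1/2)) * ennreal (1 / x) = (\<integral>\<^sup>+s. ennreal (exp (-1/2)) * indicator {0..1/x} s \<partial>lborel)"
    using x0 by (subst nn_integral_cmult) auto
  also have "\<dots> \<le> gaussian_tail x"
    unfolding gaussian_tail_def
  proof (intro nn_integral_mono)
    fix s :: real
    show "ennreal (exp (-1/2)) * indicator {0..1/x} s \<le> ennreal (exp (- (s\<^sup>2 * x\<^sup>2 / 2))) * indicator {0..} s"
    proof (cases "s \<in> {0..1/x}")
      case True
      hence "s * x \<le> 1" "0 \<le> s * x" using x0 by (auto simp: field_simps)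
      hence "(s * x)\<^sup>2 \<le> 1" by (simp add: abs_square_le_1)
      thus ?thesis using True by (simp add: power_mult_distrib)
    qed simp
  qed
  finally show ?thesis by (simp add: mult_left_mono)
qed simp

text \<open>Tonelli reduces the expectation to the integral of \<open>K / (1 + s^2 * v / 2)\<close>
  over the half-line, which is compared with the arctangent integral. The result is controlled by
  any lower bound on \<open>v\<close>, which later gives uniformity along a circle.\<close>

lemma nn_integral_gaussian_tail_le:
  fixes Z :: "'w \<Rightarrow> real" and X :: "'w \<Rightarrow> complex" and K v :: real
  assumes M: "prob_space M" and Z: "integrable M Z" and Z0: "\<And>\<omega>. Z \<omega> \<ge> 0"
    and X[measurable]: "X \<in> borel_measurable M" and v: "v > 0" and K: "K \<ge> 0"
    and cf: "\<And>c. (\<integral>\<omega>. of_real (Z \<omega>) * iexp (Re (c * X \<omega>)) \<partial>M) = of_real (K * exp (- ((norm c)\<^sup>2 * v / 4)))"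
  shows "(\<integral>\<^sup>+\<omega>. ennreal (Z \<omega>) * gaussian_tail (norm (X \<omega>)) \<partial>M) \<le> ennreal (K * (pi * (1 + 1 / v)))"
proof -
  interpret M: prob_space M by fact
  interpret P: pair_sigma_finite M lborel ..
  note [measurable] = borel_measurable_integrable[OF Z]
  have w: "(\<integral>\<^sup>+\<omega>. ennreal (Z \<omega> * exp (- (s\<^sup>2 * (norm (X \<omega>))\<^sup>2 / 2))) \<partial>M) = ennreal (K / (1 + s\<^sup>2 * v / 2))" for s
  proof -
    have int: "integrable M (\<lambda>\<omega>. Z \<omega> * exp (- (s\<^sup>2 * (norm (X \<omega>))\<^sup>2 / 2)))"
      by (rule Bochner_Integration.integrable_bound[OF Z]) (auto simp: abs_mult mult_left_le)
    have "complex_of_real (\<integral>\<omega>. Z \<omega> * exp (- (s\<^sup>2 * (norm (X \<omega>))\<^sup>2 / 2)) \<partial>M) = of_real (K / (1 + s\<^sup>2 * v / 2))"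
      using integral_gaussian_weight[OF M integrable_of_real[OF Z] X less_imp_le[OF v] cf, of s]
      by (simp add: integral_complex_of_real[symmetric] del: integral_complex_of_real of_real_exp)
    hence "(\<integral>\<omega>. Z \<omega> * exp (- (s\<^sup>2 * (norm (X \<omega>))\<^sup>2 / 2)) \<partial>M) = K / (1 + s\<^sup>2 * v / 2)"
      by (simp only: of_real_eq_iff)
    thus ?thesis using int Z0 by (subst nn_integral_eq_integral) auto
  qed
  have "(\<integral>\<^sup>+\<omega>. ennreal (Z \<omega>) * gaussian_tail (norm (X \<omega>)) \<partial>M)
      = (\<integral>\<^sup>+\<omega>. (\<integral>\<^sup>+s. ennreal (Z \<omega> * exp (- (s\<^sup>2 * (norm (X \<omega>))\<^sup>2 / 2))) * indicator {0..} s \<partial>lborel) \<partial>M)"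
    unfolding gaussian_tail_def using Z0
    by (intro nn_integral_cong, subst nn_integral_cmult[symmetric]) (auto simp: ennreal_mult mult_ac)
  also have "\<dots> = (\<integral>\<^sup>+s. (\<integral>\<^sup>+\<omega>. ennreal (Z \<omega> * exp (- (s\<^sup>2 * (norm (X \<omega>))\<^sup>2 / 2))) * indicator {0..} s \<partial>M) \<partial>lborel)"
    by (rule P.Fubini'[symmetric]) measurable
  also have "\<dots> = (\<integral>\<^sup>+s. ennreal (K / (1 + s\<^sup>2 * v / 2)) * indicator {0..} s \<partial>lborel)"
    by (intro nn_integral_cong, subst nn_integral_multc) (simp_all only: w, measurable)
  also have "\<dots> \<le> (\<integral>\<^sup>+s. ennreal (K * (2 * (1 + 1 / v))) * (ennreal (inverse (1 + s\<^sup>2)) * indicator {0..} s) \<partial>lborel)"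
  proof (intro nn_integral_mono)
    fix s :: real
    have p: "1 + s\<^sup>2 > 0" "1 + s\<^sup>2 * v / 2 > 0" using v by (simp_all add: add_pos_nonneg)
    have "1 + s\<^sup>2 \<le> 2 * (1 + 1 / v) * (1 + s\<^sup>2 * v / 2)"
      using v by (simp add: field_simps)
    hence "1 / (1 + s\<^sup>2 * v / 2) \<le> 2 * (1 + 1 / v) * inverse (1 + s\<^sup>2)"
      using p by (simp add: divide_simps mult_ac)
    from mult_left_mono[OF this K]
    have "K / (1 + s\<^sup>2 * v / 2) \<le> K * (2 * (1 + 1 / v)) * inverse (1 + s\<^sup>2)" by (simp add: mult_ac)
    thus "ennreal (K / (1 + s\<^sup>2 * v / 2)) * indicator {0..} s \<le> ennreal (K * (2 * (1 + 1 / v))) * (ennreal (inverse (1 + s\<^sup>2)) * indicator {0..} s)"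
      using K v p by (auto simp: indicator_def ennreal_mult[symmetric] intro!: ennreal_leI)
  qed
  also have "\<dots> = ennreal (K * (2 * (1 + 1 / v))) * (\<integral>\<^sup>+s. ennreal (inverse (1 + s\<^sup>2)) * indicator {0..} s \<partial>lborel)"
    by (rule nn_integral_cmult) measurable
  also have "(\<integral>\<^sup>+s. ennreal (inverse (1 + s\<^sup>2)) * indicator {0..} s \<partial>lborel) = ennreal (pi / 2 - arctan 0)"
    by (rule nn_integral_FTC_atLeast) (auto intro!: DERIV_arctan tendsto_arctan_at_top simp: power2_eq_square[symmetric])
  finally show ?thesis using K v by (simp add: ennreal_mult[symmetric] algebra_simps)
qed

lemma nn_integral_inverse_square_weight:
  fixes x :: real
  assumes "x > 0"
  shows "(\<integral>\<^sup>+s. ennreal (s * exp (- (s\<^sup>2 * x\<^sup>2 / 2))) * indicator {0..} s \<partial>lborel) = ennreal (1 / x\<^sup>2)"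
proof -
  have "(\<integral>\<^sup>+s. ennreal (s * exp (- (s\<^sup>2 * x\<^sup>2 / 2))) * indicator {0..} s \<partial>lborel)
      = ennreal (0 - (- exp (- (0\<^sup>2 * x\<^sup>2 / 2)) / x\<^sup>2))"
  proof (rule nn_integral_FTC_atLeast)
    show "((\<lambda>s. - exp (- (s\<^sup>2 * x\<^sup>2 / 2)) / x\<^sup>2) has_real_derivative s * exp (- (s\<^sup>2 * x\<^sup>2 / 2))) (at s)" for s
      using assms by (auto intro!: derivative_eq_intros simp: power2_eq_square)
    show "((\<lambda>s. - exp (- (s\<^sup>2 * x\<^sup>2 / 2)) / x\<^sup>2) \<longlongrightarrow> 0) at_top"
      using assms by real_asymp
  qed (use assms in auto)
  thus ?thesis by simp
qed

text \<open>The representation \<open>1 / X = cnj X * (\<integral>\<^sub>0\<^sup>\<infinity> s * exp (- s\<^sup>2 |X|\<^sup>2 / 2) ds)\<close> reduces the claim to Gaussian weights.\<close>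

lemma integral_divide_eq_0:
  fixes Z X :: "'w \<Rightarrow> complex"
  assumes M: "prob_space M" and Z: "integrable M (\<lambda>\<omega>. Z \<omega> * cnj (X \<omega>))"
    and [measurable]: "Z \<in> borel_measurable M" "X \<in> borel_measurable M" and X0: "AE \<omega> in M. X \<omega> \<noteq> 0"
    and int: "integrable M (\<lambda>\<omega>. Z \<omega> / X \<omega>)"
    and cf: "\<And>c. (\<integral>\<omega>. Z \<omega> * cnj (X \<omega>) * iexp (Re (c * X \<omega>)) \<partial>M) = 0"
  shows "(\<integral>\<omega>. Z \<omega> / X \<omega> \<partial>M) = 0"
proof -
  interpret M: prob_space M by fact
  interpret P: pair_sigma_finite M lborel ..
  define g :: "'w \<Rightarrow> real \<Rightarrow> real" where "g = (\<lambda>\<omega> s. s * exp (- (s\<^sup>2 * (norm (X \<omega>))\<^sup>2 / 2)) * indicator {0..} s)"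
  have g0: "g \<omega> s \<ge> 0" for \<omega> s by (auto simp: g_def indicator_def)
  have [measurable]: "(\<lambda>(\<omega>, s). g \<omega> s) \<in> borel_measurable (M \<Otimes>\<^sub>M lborel)" "g \<omega> \<in> borel_measurable borel" for \<omega>
    unfolding g_def by measurable
  have ng: "(\<integral>\<^sup>+s. ennreal (g \<omega> s) \<partial>lborel) = ennreal (1 / (norm (X \<omega>))\<^sup>2)" if "X \<omega> \<noteq> 0" for \<omega>
  proof -
    have "(\<integral>\<^sup>+s. ennreal (g \<omega> s) \<partial>lborel) = (\<integral>\<^sup>+s. ennreal (s * exp (- (s\<^sup>2 * (norm (X \<omega>))\<^sup>2 / 2))) * indicator {0..} s \<partial>lborel)"
      by (intro nn_integral_cong) (auto simp: g_def indicator_def)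
    thus ?thesis using nn_integral_inverse_square_weight[of "norm (X \<omega>)"] that by simp
  qed
  have gint: "integrable lborel (g \<omega>)" "(\<integral>s. g \<omega> s \<partial>lborel) = 1 / (norm (X \<omega>))\<^sup>2" if "X \<omega> \<noteq> 0" for \<omega>
  proof -
    show 1: "integrable lborel (g \<omega>)" using ng[OF that] g0 by (intro integrableI_nonneg) auto
    show "(\<integral>s. g \<omega> s \<partial>lborel) = 1 / (norm (X \<omega>))\<^sup>2"
      using ng[OF that] g0 by (subst integral_eq_nn_integral) auto
  qed
  have Zc: "norm (Z \<omega> * cnj (X \<omega>)) * (1 / (norm (X \<omega>))\<^sup>2) = norm (Z \<omega> / X \<omega>)" 
      "Z \<omega> * cnj (X \<omega>) * of_real (1 / (norm (X \<omega>))\<^sup>2) = Z \<omega> / X \<omega>" if "X \<omega> \<noteq> 0" for \<omega>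
    using that by (simp_all add: norm_mult norm_divide power2_eq_square) (simp add: complex_div_cnj[of _ "X \<omega>"] power2_eq_square)
  \<comment> \<open>The absolute integral over \<open>s\<close> is
    \<open>|Z * cnj X| / |X|^2 = |Z / X|\<close>, so Fubini applies exactly because the quotient is
    integrable.\<close>
  have pint: "integrable (M \<Otimes>\<^sub>M lborel) (\<lambda>(\<omega>, s). Z \<omega> * cnj (X \<omega>) * of_real (g \<omega> s))"
  proof (rule P.Fubini_integrable)
    have *: "integrable M (\<lambda>\<omega>. norm (Z \<omega> / X \<omega>))" using int by simp
    show "integrable M (\<lambda>\<omega>. \<integral>s. norm (case (\<omega>, s) of (\<omega>, s) \<Rightarrow> Z \<omega> * cnj (X \<omega>) * of_real (g \<omega> s)) \<partial>lborel)"
    proof (rule integrable_cong_AE_imp[OF *])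
      show "AE \<omega> in M. norm (Z \<omega> / X \<omega>) = (\<integral>s. norm (case (\<omega>, s) of (\<omega>, s) \<Rightarrow> Z \<omega> * cnj (X \<omega>) * of_real (g \<omega> s)) \<partial>lborel)"
        using X0
      proof eventually_elim
        case (elim \<omega>)
        have "(\<integral>s. norm (Z \<omega> * cnj (X \<omega>) * of_real (g \<omega> s)) \<partial>lborel) = (\<integral>s. norm (Z \<omega> * cnj (X \<omega>)) * g \<omega> s \<partial>lborel)"
          using g0 by (simp add: norm_mult)
        also have "\<dots> = norm (Z \<omega> / X \<omega>)" using gint[OF elim] Zc(1)[OF elim] by simp
        finally show ?case by simp
      qed
    qed measurable
    show "AE \<omega> in M. integrable lborel (\<lambda>s. case (\<omega>, s) of (\<omega>, s) \<Rightarrow> Z \<omega> * cnj (X \<omega>) * of_real (g \<omega> s))"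
      using X0 by eventually_elim (use gint in \<open>auto intro!: integrable_mult_right integrable_of_real\<close>)
  qed measurable
  have "(\<integral>\<omega>. Z \<omega> / X \<omega> \<partial>M) = (\<integral>\<omega>. (\<integral>s. Z \<omega> * cnj (X \<omega>) * of_real (g \<omega> s) \<partial>lborel) \<partial>M)"
  proof (rule integral_cong_AE)
    show "AE \<omega> in M. Z \<omega> / X \<omega> = (\<integral>s. Z \<omega> * cnj (X \<omega>) * of_real (g \<omega> s) \<partial>lborel)"
      using X0
    proof eventually_elim
      case (elim \<omega>)
      show ?case using gint[OF elim] Zc(2)[OF elim] by simp
    qed
  qed measurable
  also have "\<dots> = (\<integral>s. (\<integral>\<omega>. Z \<omega> * cnj (X \<omega>) * of_real (g \<omega> s) \<partial>M) \<partial>lborel)"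
    by (rule P.Fubini_integral[OF pint, symmetric])
  also have "\<dots> = integral\<^sup>L lborel (\<lambda>s::real. 0)"
  proof (rule Bochner_Integration.integral_cong[OF refl])
    fix s :: real
    have "(\<integral>\<omega>. Z \<omega> * cnj (X \<omega>) * of_real (g \<omega> s) \<partial>M) 
      = of_real (s * indicator {0..} s) * (\<integral>\<omega>. Z \<omega> * cnj (X \<omega>) * exp (- (s\<^sup>2 * (norm (X \<omega>))\<^sup>2 / 2)) \<partial>M)"
      by (subst integral_mult_right_zero[symmetric], intro Bochner_Integration.integral_cong refl) (simp add: g_def mult_ac)
    also have "(\<integral>\<omega>. Z \<omega> * cnj (X \<omega>) * exp (- (s\<^sup>2 * (norm (X \<omega>))\<^sup>2 / 2)) \<partial>M) = of_real (0 / (1 + s\<^sup>2 * 0 / 2))"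
      by (rule integral_gaussian_weight[OF M Z _ order_refl]) (measurable, simp only: cf mult_zero_left of_real_0)
    finally show "(\<integral>\<omega>. Z \<omega> * cnj (X \<omega>) * of_real (g \<omega> s) \<partial>M) = 0" by simp
  qed
  finally show ?thesis by simp
qed

section \<open>Regression of one Gaussian variable on another\<close>

lemma integrable_mult_square_integrable:
  fixes X Y :: "'w \<Rightarrow> complex"
  assumes [measurable]: "X \<in> borel_measurable M" "Y \<in> borel_measurable M"
    and X2: "integrable M (\<lambda>\<omega>. (norm (X \<omega>))\<^sup>2)" and Y2: "integrable M (\<lambda>\<omega>. (norm (Y \<omega>))\<^sup>2)"
  shows "integrable M (\<lambda>\<omega>. Y \<omega> * cnj (X \<omega>))" "integrable M (\<lambda>\<omega>. Y \<omega> * X \<omega>)"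
proof -
  have i: "integrable M (\<lambda>\<omega>. (norm (X \<omega>))\<^sup>2 + (norm (Y \<omega>))\<^sup>2)" using X2 Y2 by simp
  have "norm (Y \<omega>) * norm (X \<omega>) \<le> (norm (X \<omega>))\<^sup>2 + (norm (Y \<omega>))\<^sup>2" for \<omega>
  proof -
    have "2 * (norm (Y \<omega>) * norm (X \<omega>)) \<le> (norm (X \<omega>))\<^sup>2 + (norm (Y \<omega>))\<^sup>2"
      using sum_squares_bound[of "norm (X \<omega>)" "norm (Y \<omega>)"] by (simp add: mult_ac)
    moreover have "norm (Y \<omega>) * norm (X \<omega>) \<ge> 0" by simp
    ultimately show ?thesis by linarith
  qed
  thus "integrable M (\<lambda>\<omega>. Y \<omega> * cnj (X \<omega>))" "integrable M (\<lambda>\<omega>. Y \<omega> * X \<omega>)"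
    by (intro Bochner_Integration.integrable_bound[OF i]; auto simp: norm_mult)+
qed

text \<open>Joint circular Gaussianity is encoded by the characteristic function of all complex
  linear forms. The real part of a form carries half of its second moment, and the characteristic
  function halves it again, whence the 4. Only \<open>X\<close> has to be nondegenerate;
  \<open>Y\<close> may be a multiple of \<open>X\<close>.\<close>

locale gaussian_pair = prob_space M for M :: "'w measure" +
  fixes X Y :: "'w \<Rightarrow> complex"
  assumes meas[measurable]: "X \<in> borel_measurable M" "Y \<in> borel_measurable M"
    and X2: "integrable M (\<lambda>\<omega>. (norm (X \<omega>))\<^sup>2)" and Y2: "integrable M (\<lambda>\<omega>. (norm (Y \<omega>))\<^sup>2)"
    and cf: "\<And>c d. (\<integral>\<omega>. iexp (Re (c * X \<omega> + d * Y \<omega>)) \<partial>M)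
               = of_real (exp (- ((\<integral>\<omega>. (norm (c * X \<omega> + d * Y \<omega>))\<^sup>2 \<partial>M) / 4)))"
    and X_pos: "(\<integral>\<omega>. (norm (X \<omega>))\<^sup>2 \<partial>M) > 0"
begin

text \<open>\<open>\<kappa>\<close> is the regression coefficient of \<open>Y\<close> on \<open>X\<close> and \<open>\<eta>\<close> the residual, which is independent of \<open>X\<close>.\<close>

definition v :: real where "v = (\<integral>\<omega>. (norm (X \<omega>))\<^sup>2 \<partial>M)"
definition \<kappa> :: complex where "\<kappa> = (\<integral>\<omega>. Y \<omega> * cnj (X \<omega>) \<partial>M) / of_real v"
definition \<eta> :: "'w \<Rightarrow> complex" where "\<eta> \<omega> = Y \<omega> - \<kappa> * X \<omega>"
definition \<tau> :: real where "\<tau> = (\<integral>\<omega>. (norm (\<eta> \<omega>))\<^sup>2 \<partial>M)"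

lemma v_pos: "v > 0" using X_pos by (simp add: v_def)

lemma eta_meas [measurable]: "\<eta> \<in> borel_measurable M" unfolding \<eta>_def by measurable

lemma int_XX: "integrable M (\<lambda>\<omega>. X \<omega> * cnj (X \<omega>))"
  by (rule integrable_mult_square_integrable) (use X2 in auto)

lemma int_YX: "integrable M (\<lambda>\<omega>. Y \<omega> * cnj (X \<omega>))"
  by (rule integrable_mult_square_integrable) (use X2 Y2 in auto)

lemma int_eta2: "integrable M (\<lambda>\<omega>. (norm (\<eta> \<omega>))\<^sup>2)"
proof (rule Bochner_Integration.integrable_bound)
  show "integrable M (\<lambda>\<omega>. 2 * (norm (Y \<omega>))\<^sup>2 + 2 * ((norm \<kappa>)\<^sup>2 * (norm (X \<omega>))\<^sup>2))" using X2 Y2 by simp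
  show "AE \<omega> in M. norm ((norm (\<eta> \<omega>))\<^sup>2) \<le> norm (2 * (norm (Y \<omega>))\<^sup>2 + 2 * ((norm \<kappa>)\<^sup>2 * (norm (X \<omega>))\<^sup>2))"
  proof (rule AE_I2)
    fix \<omega>
    have "norm (\<eta> \<omega>) \<le> norm (Y \<omega>) + norm \<kappa> * norm (X \<omega>)"
      unfolding \<eta>_def by (metis norm_mult norm_triangle_ineq4)
    hence "(norm (\<eta> \<omega>))\<^sup>2 \<le> (norm (Y \<omega>) + norm \<kappa> * norm (X \<omega>))\<^sup>2" by (intro power_mono) auto
    also have "\<dots> \<le> 2 * (norm (Y \<omega>))\<^sup>2 + 2 * (norm \<kappa> * norm (X \<omega>))\<^sup>2"
      using sum_squares_bound[of "norm (Y \<omega>)" "norm \<kappa> * norm (X \<omega>)"] by (simp add: power2_sum)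
    finally show "norm ((norm (\<eta> \<omega>))\<^sup>2) \<le> norm (2 * (norm (Y \<omega>))\<^sup>2 + 2 * ((norm \<kappa>)\<^sup>2 * (norm (X \<omega>))\<^sup>2))"
      by (simp add: power_mult_distrib)
  qed
qed measurable

lemma int_eta_X: "integrable M (\<lambda>\<omega>. \<eta> \<omega> * cnj (X \<omega>))"
  by (rule integrable_mult_square_integrable) (use X2 int_eta2 in auto)

lemma square_int_imp_int: 
  assumes "f \<in> borel_measurable M" "integrable M (\<lambda>\<omega>. (norm (f \<omega> :: complex))\<^sup>2)"
  shows "integrable M f"
  using integrable_mult_square_integrable(2)[of "\<lambda>_. 1" M f] assms by simp

lemma int_eta: "integrable M \<eta>"
  by (rule square_int_imp_int) (use int_eta2 in auto)

lemma int_norm_eq: "(\<integral>\<omega>. X \<omega> * cnj (X \<omega>) \<partial>M) = of_real v"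
  unfolding v_def by (simp add: complex_norm_square[symmetric] flip: of_real_power integral_complex_of_real)

lemma eta_orth: "(\<integral>\<omega>. \<eta> \<omega> * cnj (X \<omega>) \<partial>M) = 0"
proof -
  have "(\<integral>\<omega>. \<eta> \<omega> * cnj (X \<omega>) \<partial>M) = (\<integral>\<omega>. Y \<omega> * cnj (X \<omega>) - \<kappa> * (X \<omega> * cnj (X \<omega>)) \<partial>M)"
    by (simp add: \<eta>_def algebra_simps)
  also have "\<dots> = (\<integral>\<omega>. Y \<omega> * cnj (X \<omega>) \<partial>M) - \<kappa> * (\<integral>\<omega>. X \<omega> * cnj (X \<omega>) \<partial>M)"
    using int_YX int_XX by simp
  also have "\<dots> = 0" unfolding int_norm_eq \<kappa>_def using v_pos by simp
  finally show ?thesis .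
qed

lemma second_moment: "(\<integral>\<omega>. (norm (c * X \<omega> + d * \<eta> \<omega>))\<^sup>2 \<partial>M) = (norm c)\<^sup>2 * v + (norm d)\<^sup>2 * \<tau>"
proof -
  define R where "R = (\<lambda>\<omega>. Re (cnj c * d * (\<eta> \<omega> * cnj (X \<omega>))))"
  have eq: "(norm (c * X \<omega> + d * \<eta> \<omega>))\<^sup>2 = (norm c)\<^sup>2 * (norm (X \<omega>))\<^sup>2 + (norm d)\<^sup>2 * (norm (\<eta> \<omega>))\<^sup>2
      + 2 * R \<omega>" for \<omega>
    unfolding cmod_power2 R_def by (simp add: power2_eq_square algebra_simps)
  have i0: "integrable M (\<lambda>\<omega>. cnj c * d * (\<eta> \<omega> * cnj (X \<omega>)))"
    using int_eta_X by (intro integrable_mult_right)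
  have i: "integrable M R" unfolding R_def by (rule integrable_Re[OF i0])
  have "(\<integral>\<omega>. R \<omega> \<partial>M) = Re (\<integral>\<omega>. cnj c * d * (\<eta> \<omega> * cnj (X \<omega>)) \<partial>M)"
    unfolding R_def by (rule integral_Re[OF i0])
  also have "\<dots> = 0" using eta_orth by simp
  finally have z: "(\<integral>\<omega>. R \<omega> \<partial>M) = 0" .
  have "(\<integral>\<omega>. (norm (c * X \<omega> + d * \<eta> \<omega>))\<^sup>2 \<partial>M) = (norm c)\<^sup>2 * v + (norm d)\<^sup>2 * \<tau> + 2 * (\<integral>\<omega>. R \<omega> \<partial>M)"
    unfolding eq v_def \<tau>_def using X2 int_eta2 i by simp
  thus ?thesis unfolding z by simp
qed

text \<open>Orthogonality makes the second moment in the exponent split into a sum, so the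
  characteristic function factorizes: this is the independence of \<open>\<eta>\<close> and
  \<open>X\<close>.\<close>

lemma cf_eta: "(\<integral>\<omega>. iexp (Re (c * X \<omega> + d * \<eta> \<omega>)) \<partial>M) = of_real (exp (- (((norm c)\<^sup>2 * v + (norm d)\<^sup>2 * \<tau>) / 4)))"
proof -
  have "c * X \<omega> + d * \<eta> \<omega> = (c - d * \<kappa>) * X \<omega> + d * Y \<omega>" for \<omega> by (simp add: \<eta>_def algebra_simps)
  thus ?thesis using cf[of "c - d * \<kappa>" d] unfolding second_moment[of c d, symmetric] by simp
qed

lemma tau_le: "\<tau> \<le> (\<integral>\<omega>. (norm (Y \<omega>))\<^sup>2 \<partial>M)"
proof -
  have "(\<integral>\<omega>. (norm (Y \<omega>))\<^sup>2 \<partial>M) = (norm \<kappa>)\<^sup>2 * v + \<tau>"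
    using second_moment[of \<kappa> 1] by (simp add: \<eta>_def)
  thus ?thesis using v_pos by simp
qed

lemma tau_nonneg: "\<tau> \<ge> 0" unfolding \<tau>_def by (rule Bochner_Integration.integral_nonneg) auto

text \<open>Pythagoras gives \<open>|\<kappa>|^2 * v \<le> E |Y|^2\<close>. The crude shape of the
  bound matches the one for \<open>\<eta> / X\<close>, so that the two can simply be added.\<close>

lemma norm_kappa_le: "norm \<kappa> \<le> (1 + 1 / v) * (1 + (\<integral>\<omega>. (norm (Y \<omega>))\<^sup>2 \<partial>M))"
proof -
  define E where "E = (\<integral>\<omega>. (norm (Y \<omega>))\<^sup>2 \<partial>M)"
  have E0: "E \<ge> 0" unfolding E_def by (rule Bochner_Integration.integral_nonneg) auto
  have "E = (norm \<kappa>)\<^sup>2 * v + \<tau>"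
    unfolding E_def using second_moment[of \<kappa> 1] by (simp add: \<eta>_def)
  hence "(norm \<kappa>)\<^sup>2 * v \<le> E" using tau_nonneg by simp
  hence "(norm \<kappa>)\<^sup>2 \<le> E / v" using v_pos by (simp add: field_simps)
  moreover have "norm \<kappa> \<le> 1 + (norm \<kappa>)\<^sup>2"
  proof -
    have "2 * norm \<kappa> \<le> 1 + (norm \<kappa>)\<^sup>2" using sum_squares_bound[of 1 "norm \<kappa>"] by simp
    thus ?thesis using norm_ge_zero[of \<kappa>] by linarith
  qed
  ultimately have "norm \<kappa> \<le> 1 + E / v" by simp
  also have "\<dots> \<le> (1 + 1 / v) * (1 + E)" using v_pos E0 by (simp add: field_simps)
  finally show ?thesis unfolding E_def .
qed

lemma cf_scaled: "(\<integral>\<omega>. iexp (Re (c * X \<omega>)) * iexp (e * Re (d * \<eta> \<omega>)) \<partial>M)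
   = of_real (exp (- ((norm c)\<^sup>2 * v / 4)) * exp (- (e\<^sup>2 * ((norm d)\<^sup>2 * \<tau>) / 4)))"
proof -
  have "(\<integral>\<omega>. iexp (Re (c * X \<omega>)) * iexp (e * Re (d * \<eta> \<omega>)) \<partial>M) = (\<integral>\<omega>. iexp (Re (c * X \<omega> + (of_real e * d) * \<eta> \<omega>)) \<partial>M)"
    by (intro Bochner_Integration.integral_cong refl) (simp add: exp_add[symmetric] algebra_simps)
  also have "\<dots> = of_real (exp (- ((norm c)\<^sup>2 * v / 4)) * exp (- (e\<^sup>2 * ((norm d)\<^sup>2 * \<tau>) / 4)))"
    unfolding cf_eta by (simp add: exp_add[symmetric] norm_mult power_mult_distrib field_simps flip: of_real_mult)
  finally show ?thesis .
qed

lemma int_iexp: "integrable M (\<lambda>\<omega>. iexp (Re (c * X \<omega>)))"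
  by (rule integrable_iexp) auto

text \<open>Both follow from \<open>cf_scaled\<close> by differentiating in \<open>e\<close>, once
  and twice. The first derivative is computed at every \<open>x\<close>, because as a function of
  \<open>x\<close> it is the input of the second differentiation, with test function
  \<open>- \<i> * Z * T\<close>.\<close>

lemma eta_moments:
  shows "(\<integral>\<omega>. iexp (Re (c * X \<omega>)) * Re (d * \<eta> \<omega>) \<partial>M) = 0"
    and "(\<integral>\<omega>. iexp (Re (c * X \<omega>)) * of_real ((Re (d * \<eta> \<omega>))\<^sup>2) \<partial>M) = of_real ((norm d)\<^sup>2 * \<tau> / 2 * exp (- ((norm c)\<^sup>2 * v / 4)))"
proof -
  define k where "k = exp (- ((norm c)\<^sup>2 * v / 4))"
  define l where "l = (norm d)\<^sup>2 * \<tau>"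
  define Z where "Z = (\<lambda>\<omega>. iexp (Re (c * X \<omega>)))"
  define T where "T = (\<lambda>\<omega>. Re (d * \<eta> \<omega>))"
  have T[measurable]: "T \<in> borel_measurable M" unfolding T_def by measurable
  have Z: "integrable M Z" unfolding Z_def by (rule int_iexp)
  note [measurable] = borel_measurable_integrable[OF Z]
  have nZ: "norm (Z \<omega>) = 1" for \<omega> by (simp add: Z_def)
  have Tle: "\<bar>T \<omega>\<bar> \<le> norm d * norm (\<eta> \<omega>)" for \<omega>
    unfolding T_def by (metis abs_Re_le_cmod norm_mult)
  have ZT: "integrable M (\<lambda>\<omega>. Z \<omega> * T \<omega>)"
    by (rule Bochner_Integration.integrable_bound[of _ "\<lambda>\<omega>. norm d * norm (\<eta> \<omega>)"])
      (use int_eta Tle in \<open>auto simp: norm_mult nZ\<close>)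
  have T2: "(T \<omega>)\<^sup>2 \<le> (norm d)\<^sup>2 * (norm (\<eta> \<omega>))\<^sup>2" for \<omega>
    using power_mono[OF Tle[of \<omega>], of 2] by (simp add: power_mult_distrib)
  have ZTT: "integrable M (\<lambda>\<omega>. Z \<omega> * T \<omega> * T \<omega>)"
    by (rule Bochner_Integration.integrable_bound[of _ "\<lambda>\<omega>. (norm d)\<^sup>2 * (norm (\<eta> \<omega>))\<^sup>2"])
      (use int_eta2 T2 in \<open>auto simp: norm_mult nZ power2_eq_square mult.assoc abs_mult[symmetric]\<close>)
  have d1: "(\<integral>\<omega>. Z \<omega> * T \<omega> * iexp (x * T \<omega>) \<partial>M) = - \<i> * of_real (- (k * (x * l / 2) * exp (- (x\<^sup>2 * l / 4))))" for x
  proof (rule integral_iexp_derivative[OF Z ZT T])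
    show "(\<integral>\<omega>. Z \<omega> * iexp (e * T \<omega>) \<partial>M) = of_real (k * exp (- (e\<^sup>2 * l / 4)))" for e
      unfolding Z_def T_def k_def l_def by (rule cf_scaled)
    show "((\<lambda>e. k * exp (- (e\<^sup>2 * l / 4))) has_real_derivative - (k * (x * l / 2) * exp (- (x\<^sup>2 * l / 4)))) (at x)"
      by (auto intro!: derivative_eq_intros)
  qed
  from d1[of 0] show "(\<integral>\<omega>. iexp (Re (c * X \<omega>)) * Re (d * \<eta> \<omega>) \<partial>M) = 0"
    by (simp add: Z_def T_def)
  have "(\<integral>\<omega>. (- \<i> * (Z \<omega> * T \<omega>)) * T \<omega> * iexp (0 * T \<omega>) \<partial>M) = - \<i> * of_real (k * l / 2)"
  proof (rule integral_iexp_derivative[OF _ _ T])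
    show "(\<integral>\<omega>. - \<i> * (Z \<omega> * T \<omega>) * iexp (e * T \<omega>) \<partial>M) = of_real (k * (e * l / 2) * exp (- (e\<^sup>2 * l / 4)))" for e
    proof -
      have "(\<integral>\<omega>. - \<i> * (Z \<omega> * T \<omega>) * iexp (e * T \<omega>) \<partial>M) = - \<i> * (\<integral>\<omega>. Z \<omega> * T \<omega> * iexp (e * T \<omega>) \<partial>M)"
        by (subst integral_mult_right_zero[symmetric]) (simp add: mult.assoc)
      thus ?thesis unfolding d1 by (simp add: mult.assoc[symmetric])
    qed
    show "((\<lambda>e. k * (e * l / 2) * exp (- (e\<^sup>2 * l / 4))) has_real_derivative k * l / 2) (at 0)"
      by (auto intro!: derivative_eq_intros)
  qed (use ZT ZTT in \<open>auto simp: mult.assoc\<close>)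
  hence "- \<i> * (\<integral>\<omega>. Z \<omega> * of_real ((T \<omega>)\<^sup>2) \<partial>M) = - \<i> * of_real (k * l / 2)"
    by (subst integral_mult_right_zero[symmetric]) (simp add: power2_eq_square mult.assoc)
  hence "(\<integral>\<omega>. Z \<omega> * of_real ((T \<omega>)\<^sup>2) \<partial>M) = of_real (k * l / 2)" by (simp only: mult_cancel_left) simp
  thus "(\<integral>\<omega>. iexp (Re (c * X \<omega>)) * of_real ((Re (d * \<eta> \<omega>))\<^sup>2) \<partial>M) = of_real ((norm d)\<^sup>2 * \<tau> / 2 * exp (- ((norm c)\<^sup>2 * v / 4)))"
    unfolding Z_def T_def k_def l_def by (simp only: mult_ac times_divide_eq_right times_divide_eq_left)
qed

lemma eta_iexp: "(\<integral>\<omega>. \<eta> \<omega> * iexp (Re (c * X \<omega>)) \<partial>M) = 0"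
proof -
  have i: "integrable M (\<lambda>\<omega>. iexp (Re (c * X \<omega>)) * Re (d * \<eta> \<omega>))" for d
  proof (rule Bochner_Integration.integrable_bound[of _ "\<lambda>\<omega>. norm d * norm (\<eta> \<omega>)"])
    show "AE \<omega> in M. norm (iexp (Re (c * X \<omega>)) * Re (d * \<eta> \<omega>)) \<le> norm (norm d * norm (\<eta> \<omega>))"
    proof (rule AE_I2)
      fix \<omega>
      have "\<bar>Re (d * \<eta> \<omega>)\<bar> \<le> norm d * norm (\<eta> \<omega>)" by (metis abs_Re_le_cmod norm_mult)
      thus "norm (iexp (Re (c * X \<omega>)) * Re (d * \<eta> \<omega>)) \<le> norm (norm d * norm (\<eta> \<omega>))"
        by (simp only: norm_mult norm_exp_i_times norm_of_real) simp
    qed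
  qed (use int_eta in auto)
  have "\<eta> \<omega> * iexp (Re (c * X \<omega>)) = iexp (Re (c * X \<omega>)) * Re (1 * \<eta> \<omega>) + \<i> * (iexp (Re (c * X \<omega>)) * Re (- \<i> * \<eta> \<omega>))" for \<omega>
    by (subst complex_eq[of "\<eta> \<omega>"]) (simp add: algebra_simps)
  hence "(\<integral>\<omega>. \<eta> \<omega> * iexp (Re (c * X \<omega>)) \<partial>M) = 
     (\<integral>\<omega>. iexp (Re (c * X \<omega>)) * Re (1 * \<eta> \<omega>) \<partial>M) + \<i> * (\<integral>\<omega>. iexp (Re (c * X \<omega>)) * Re (- \<i> * \<eta> \<omega>) \<partial>M)"
    using i[of 1] i[of "-\<i>"] by (simp only: Bochner_Integration.integral_add integrable_mult_right integral_mult_right_zero)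
  thus ?thesis unfolding eta_moments by simp
qed

text \<open>The pairing of \<open>\<eta>\<close> with characters vanishes for every
  \<open>c\<close>, hence so do its derivatives in \<open>c\<close>; the direction \<open>e\<close>
  brings down the factor \<open>Re (e * X)\<close>. The directions \<open>1\<close> and
  \<open>- \<i>\<close> recombine to \<open>cnj X\<close>. This is the hypothesis under which
  \<open>\<eta> / X\<close> has mean 0.\<close>

lemma eta_X_iexp: "(\<integral>\<omega>. \<eta> \<omega> * cnj (X \<omega>) * iexp (Re (c * X \<omega>)) \<partial>M) = 0"
proof -
  have i: "integrable M (\<lambda>\<omega>. \<eta> \<omega> * iexp (Re (c * X \<omega>)) * Re (e * X \<omega>))" for e
  proof (rule Bochner_Integration.integrable_bound[of _ "\<lambda>\<omega>. norm e * norm (\<eta> \<omega> * cnj (X \<omega>))"])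
    show "AE \<omega> in M. norm (\<eta> \<omega> * iexp (Re (c * X \<omega>)) * Re (e * X \<omega>)) \<le> norm (norm e * norm (\<eta> \<omega> * cnj (X \<omega>)))"
    proof (rule AE_I2)
      fix \<omega>
      have "norm (\<eta> \<omega> * iexp (Re (c * X \<omega>)) * Re (e * X \<omega>)) = norm (\<eta> \<omega>) * \<bar>Re (e * X \<omega>)\<bar>"
        by (simp only: norm_mult norm_exp_i_times norm_of_real mult_1_right)
      also have "\<dots> \<le> norm (\<eta> \<omega>) * (norm e * norm (X \<omega>))"
        by (intro mult_left_mono) (metis abs_Re_le_cmod norm_mult, simp)
      finally show "norm (\<eta> \<omega> * iexp (Re (c * X \<omega>)) * Re (e * X \<omega>)) \<le> norm (norm e * norm (\<eta> \<omega> * cnj (X \<omega>)))"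
        by (simp add: norm_mult mult_ac)
    qed
  qed (use int_eta_X in auto)
  have 0: "(\<integral>\<omega>. \<eta> \<omega> * iexp (Re (c * X \<omega>)) * Re (e * X \<omega>) \<partial>M) = 0" for e
  proof -
    have "(\<integral>\<omega>. \<eta> \<omega> * iexp (Re (c * X \<omega>)) * Re (e * X \<omega>) * iexp (0 * Re (e * X \<omega>)) \<partial>M) = - \<i> * of_real 0"
    proof (rule integral_iexp_derivative[OF integrable_mult_iexp[OF int_eta] i, where G = "\<lambda>_. 0"])
      show "(\<integral>\<omega>. \<eta> \<omega> * iexp (Re (c * X \<omega>)) * iexp (t * Re (e * X \<omega>)) \<partial>M) = of_real 0" for t
      proof -
        have "(\<integral>\<omega>. \<eta> \<omega> * iexp (Re (c * X \<omega>)) * iexp (t * Re (e * X \<omega>)) \<partial>M) = (\<integral>\<omega>. \<eta> \<omega> * iexp (Re ((c + of_real t * e) * X \<omega>)) \<partial>M)"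
          by (intro Bochner_Integration.integral_cong refl) (simp add: mult.assoc exp_add[symmetric] algebra_simps)
        thus ?thesis unfolding eta_iexp by simp
      qed
    qed auto
    thus ?thesis by simp
  qed
  have "\<eta> \<omega> * cnj (X \<omega>) * iexp (Re (c * X \<omega>)) = \<eta> \<omega> * iexp (Re (c * X \<omega>)) * Re (1 * X \<omega>) 
       + (- \<i>) * (\<eta> \<omega> * iexp (Re (c * X \<omega>)) * Re (- \<i> * X \<omega>))" for \<omega>
  proof -
    have "cnj (X \<omega>) = of_real (Re (X \<omega>)) - \<i> * of_real (Im (X \<omega>))" by (simp add: complex_eq_iff)
    show ?thesis unfolding \<open>cnj (X \<omega>) = _\<close> by (simp add: algebra_simps)
  qed
  hence "(\<integral>\<omega>. \<eta> \<omega> * cnj (X \<omega>) * iexp (Re (c * X \<omega>)) \<partial>M) = 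
     (\<integral>\<omega>. \<eta> \<omega> * iexp (Re (c * X \<omega>)) * Re (1 * X \<omega>) \<partial>M) + (- \<i>) * (\<integral>\<omega>. \<eta> \<omega> * iexp (Re (c * X \<omega>)) * Re (- \<i> * X \<omega>) \<partial>M)"
    using i[of 1] i[of "-\<i>"] by (simp only: Bochner_Integration.integral_add integrable_mult_right integral_mult_right_zero)
  thus ?thesis unfolding 0 by simp
qed

text \<open>The weight \<open>1 + |\<eta>|^2\<close> is positive and dominates
  \<open>|\<eta>|\<close>, and being quadratic it has pairings with characters that are computable
  from \<open>eta_moments\<close>.\<close>

lemma weight_cf: "(\<integral>\<omega>. of_real (1 + (norm (\<eta> \<omega>))\<^sup>2) * iexp (Re (c * X \<omega>)) \<partial>M) = of_real ((1 + \<tau>) * exp (- ((norm c)\<^sup>2 * v / 4)))"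
proof -
  have i: "integrable M (\<lambda>\<omega>. iexp (Re (c * X \<omega>)) * of_real ((Re (d * \<eta> \<omega>))\<^sup>2))" for d
  proof (rule Bochner_Integration.integrable_bound[of _ "\<lambda>\<omega>. (norm d)\<^sup>2 * (norm (\<eta> \<omega>))\<^sup>2"])
    show "AE \<omega> in M. norm (iexp (Re (c * X \<omega>)) * of_real ((Re (d * \<eta> \<omega>))\<^sup>2)) \<le> norm ((norm d)\<^sup>2 * (norm (\<eta> \<omega>))\<^sup>2)"
    proof (rule AE_I2)
      fix \<omega>
      have "\<bar>Re (d * \<eta> \<omega>)\<bar> \<le> norm d * norm (\<eta> \<omega>)" by (metis abs_Re_le_cmod norm_mult)
      from power_mono[OF this, of 2]
      have "(Re (d * \<eta> \<omega>))\<^sup>2 \<le> (norm d)\<^sup>2 * (norm (\<eta> \<omega>))\<^sup>2" by (simp only: power_mult_distrib power2_abs abs_ge_zero)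
      thus "norm (iexp (Re (c * X \<omega>)) * of_real ((Re (d * \<eta> \<omega>))\<^sup>2)) \<le> norm ((norm d)\<^sup>2 * (norm (\<eta> \<omega>))\<^sup>2)"
        by (simp only: norm_mult norm_exp_i_times norm_of_real) simp
    qed
  qed (use int_eta2 in auto)
  have "of_real (1 + (norm (\<eta> \<omega>))\<^sup>2) * iexp (Re (c * X \<omega>)) = iexp (Re (c * X \<omega>)) + 
     (iexp (Re (c * X \<omega>)) * of_real ((Re (1 * \<eta> \<omega>))\<^sup>2) + iexp (Re (c * X \<omega>)) * of_real ((Re (- \<i> * \<eta> \<omega>))\<^sup>2))" for \<omega>
    unfolding cmod_power2 by (simp add: algebra_simps)
  hence "(\<integral>\<omega>. of_real (1 + (norm (\<eta> \<omega>))\<^sup>2) * iexp (Re (c * X \<omega>)) \<partial>M) = 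
     (\<integral>\<omega>. iexp (Re (c * X \<omega>)) \<partial>M) + ((\<integral>\<omega>. iexp (Re (c * X \<omega>)) * of_real ((Re (1 * \<eta> \<omega>))\<^sup>2) \<partial>M)
      + (\<integral>\<omega>. iexp (Re (c * X \<omega>)) * of_real ((Re (- \<i> * \<eta> \<omega>))\<^sup>2) \<partial>M))"
    using i[of 1] i[of "-\<i>"] int_iexp[of c] by (simp only: Bochner_Integration.integral_add Bochner_Integration.integrable_add)
  also have "(\<integral>\<omega>. iexp (Re (c * X \<omega>)) \<partial>M) = of_real (exp (- ((norm c)\<^sup>2 * v / 4)))"
    using cf_eta[of c 0] by simp
  finally show ?thesis unfolding eta_moments by (simp add: algebra_simps flip: of_real_mult)
qed

lemma gaussian_tail_bound:
  "(\<integral>\<^sup>+\<omega>. ennreal (1 + (norm (\<eta> \<omega>))\<^sup>2) * gaussian_tail (norm (X \<omega>)) \<partial>M) \<le> ennreal ((1 + \<tau>) * (pi * (1 + 1 / v)))"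
proof (rule nn_integral_gaussian_tail_le)
  show "prob_space M" by (rule prob_space_axioms)
  show "integrable M (\<lambda>\<omega>. 1 + (norm (\<eta> \<omega>))\<^sup>2)" using int_eta2 by simp
qed (use v_pos tau_nonneg weight_cf in auto)

text \<open>The expectation of a positive weight times \<open>gaussian_tail (norm X)\<close> is
  finite, while \<open>gaussian_tail 0\<close> is infinite.\<close>

lemma AE_X_nonzero: "AE \<omega> in M. X \<omega> \<noteq> 0"
proof -
  have [measurable]: "(\<lambda>\<omega>. gaussian_tail (norm (X \<omega>))) \<in> borel_measurable M"
    unfolding gaussian_tail_def by measurable
  have "AE \<omega> in M. ennreal (1 + (norm (\<eta> \<omega>))\<^sup>2) * gaussian_tail (norm (X \<omega>)) \<noteq> \<infinity>"
    by (rule nn_integral_noteq_infinite) (use gaussian_tail_bound in \<open>auto simp: top_unique\<close>)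
  thus ?thesis
  proof eventually_elim
    case (elim \<omega>)
    have "1 + (norm (\<eta> \<omega>))\<^sup>2 > 0" by (simp add: add_pos_nonneg)
    thus ?case using elim gaussian_tail_0 by (auto simp: ennreal_mult_top)
  qed
qed

lemma nn_integral_eta_X: "(\<integral>\<^sup>+\<omega>. ennreal (norm (\<eta> \<omega> / X \<omega>)) \<partial>M) \<le> ennreal (exp (1/2) * ((1 + \<tau>) * (pi * (1 + 1 / v))))"
proof -
  have "(\<integral>\<^sup>+\<omega>. ennreal (norm (\<eta> \<omega> / X \<omega>)) \<partial>M) \<le> (\<integral>\<^sup>+\<omega>. ennreal (exp (1/2)) * (ennreal (1 + (norm (\<eta> \<omega>))\<^sup>2) * gaussian_tail (norm (X \<omega>))) \<partial>M)"
  proof (intro nn_integral_mono)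
    fix \<omega>
    have "2 * norm (\<eta> \<omega>) \<le> 1 + (norm (\<eta> \<omega>))\<^sup>2" using sum_squares_bound[of 1 "norm (\<eta> \<omega>)"] by simp
    hence "norm (\<eta> \<omega>) \<le> 1 + (norm (\<eta> \<omega>))\<^sup>2" using norm_ge_zero[of "\<eta> \<omega>"] by linarith
    hence "ennreal (norm (\<eta> \<omega> / X \<omega>)) \<le> ennreal ((1 + (norm (\<eta> \<omega>))\<^sup>2) * (1 / norm (X \<omega>)))"
      by (intro ennreal_leI) (simp add: norm_divide divide_right_mono)
    also have "\<dots> = ennreal (1 + (norm (\<eta> \<omega>))\<^sup>2) * ennreal (1 / norm (X \<omega>))"
      by (rule ennreal_mult) auto
    also have "\<dots> \<le> ennreal (1 + (norm (\<eta> \<omega>))\<^sup>2) * (ennreal (exp (1/2)) * gaussian_tail (norm (X \<omega>)))"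
      by (intro mult_left_mono inverse_le_gaussian_tail) auto
    finally show "ennreal (norm (\<eta> \<omega> / X \<omega>)) \<le> ennreal (exp (1/2)) * (ennreal (1 + (norm (\<eta> \<omega>))\<^sup>2) * gaussian_tail (norm (X \<omega>)))"
      by (simp only: mult_ac)
  qed
  also have "\<dots> = ennreal (exp (1/2)) * (\<integral>\<^sup>+\<omega>. (ennreal (1 + (norm (\<eta> \<omega>))\<^sup>2) * gaussian_tail (norm (X \<omega>))) \<partial>M)"
    by (rule nn_integral_cmult) (unfold gaussian_tail_def, measurable)
  also have "\<dots> \<le> ennreal (exp (1/2)) * ennreal ((1 + \<tau>) * (pi * (1 + 1 / v)))"
    by (intro mult_left_mono gaussian_tail_bound) auto
  finally show ?thesis using tau_nonneg v_pos by (subst ennreal_mult) auto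
qed

lemma integrable_eta_X: "integrable M (\<lambda>\<omega>. \<eta> \<omega> / X \<omega>)"
  by (rule integrableI_bounded) (use nn_integral_eta_X in \<open>auto intro: le_less_trans ennreal_less_top\<close>)

lemma Y_div_X: "AE \<omega> in M. Y \<omega> / X \<omega> = \<kappa> + \<eta> \<omega> / X \<omega>"
  using AE_X_nonzero by eventually_elim (simp add: \<eta>_def field_simps)

lemma integrable_ratio: "integrable M (\<lambda>\<omega>. Y \<omega> / X \<omega>)"
  by (rule integrable_cong_AE_imp[of _ "\<lambda>\<omega>. \<kappa> + \<eta> \<omega> / X \<omega>"]) (use integrable_eta_X Y_div_X in auto)

lemma integral_ratio: "(\<integral>\<omega>. Y \<omega> / X \<omega> \<partial>M) = (\<integral>\<omega>. Y \<omega> * cnj (X \<omega>) \<partial>M) / of_real (\<integral>\<omega>. (norm (X \<omega>))\<^sup>2 \<partial>M)"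
proof -
  have "(\<integral>\<omega>. Y \<omega> / X \<omega> \<partial>M) = (\<integral>\<omega>. \<kappa> + \<eta> \<omega> / X \<omega> \<partial>M)"
    by (rule integral_cong_AE) (use Y_div_X in auto)
  also have "\<dots> = \<kappa> + (\<integral>\<omega>. \<eta> \<omega> / X \<omega> \<partial>M)" using integrable_eta_X by (simp add: prob_space)
  also have "(\<integral>\<omega>. \<eta> \<omega> / X \<omega> \<partial>M) = 0"
    by (rule integral_divide_eq_0[OF prob_space_axioms int_eta_X _ _ AE_X_nonzero integrable_eta_X eta_X_iexp]) measurable
  finally show ?thesis by (simp add: \<kappa>_def v_def)
qed

text \<open>Depending only on the second moments of \<open>X\<close> and \<open>Y\<close>, the bound
  becomes uniform over a circle, which justifies exchanging expectation and circle mean.\<close>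

lemma integral_norm_ratio_le:
  "(\<integral>\<omega>. norm (Y \<omega> / X \<omega>) \<partial>M) \<le> (1 + exp (1/2) * pi) * ((1 + 1 / (\<integral>\<omega>. (norm (X \<omega>))\<^sup>2 \<partial>M)) * (1 + (\<integral>\<omega>. (norm (Y \<omega>))\<^sup>2 \<partial>M)))"
proof -
  define E where "E = (\<integral>\<omega>. (norm (Y \<omega>))\<^sup>2 \<partial>M)"
  have "(\<integral>\<omega>. norm (\<eta> \<omega> / X \<omega>) \<partial>M) \<le> exp (1/2) * ((1 + \<tau>) * (pi * (1 + 1 / v)))"
    using nn_integral_eta_X v_pos tau_nonneg integrable_eta_X
    by (subst (asm) nn_integral_eq_integral) (auto simp: ennreal_le_iff)
  also have "\<dots> \<le> exp (1/2) * ((1 + E) * (pi * (1 + 1 / v)))"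
    using tau_le v_pos unfolding E_def by (intro mult_left_mono mult_right_mono) auto
  finally have 1: "(\<integral>\<omega>. norm (\<eta> \<omega> / X \<omega>) \<partial>M) \<le> exp (1/2) * ((1 + E) * (pi * (1 + 1 / v)))" .
  have "(\<integral>\<omega>. norm (Y \<omega> / X \<omega>) \<partial>M) \<le> (\<integral>\<omega>. norm \<kappa> + norm (\<eta> \<omega> / X \<omega>) \<partial>M)"
  proof (rule integral_mono_AE)
    show "AE \<omega> in M. norm (Y \<omega> / X \<omega>) \<le> norm \<kappa> + norm (\<eta> \<omega> / X \<omega>)"
      using Y_div_X by eventually_elim (simp add: norm_triangle_ineq)
  qed (use integrable_eta_X integrable_ratio in auto)
  also have "\<dots> = norm \<kappa> + (\<integral>\<omega>. norm (\<eta> \<omega> / X \<omega>) \<partial>M)" using integrable_eta_X by (simp add: prob_space)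
  also have "\<dots> \<le> (1 + 1 / v) * (1 + E) + exp (1/2) * ((1 + E) * (pi * (1 + 1 / v)))"
    using norm_kappa_le 1 unfolding E_def by (rule add_mono)
  also have "\<dots> = (1 + exp (1/2) * pi) * ((1 + 1 / v) * (1 + E))"
    by (simp add: distrib_right mult_ac)
  finally show ?thesis unfolding v_def E_def .
qed

end

section \<open>Linear functionals of the process\<close>

locale circular_process =
  fixes M :: "'w measure" and \<xi> :: "int \<Rightarrow> 'w \<Rightarrow> complex" and \<gamma> :: "int \<Rightarrow> real"
  assumes sg: "stationary_gaussian M \<xi> \<gamma>" and \<gamma>0: "\<gamma> 0 = 1"

sublocale circular_process \<subseteq> prob_space M
  using sg by (simp add: stationary_gaussian_def)

context circular_process
begin

section \<open>Moments and characteristic functions of finite linear forms\<close>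

lemma xi_meas [measurable]: "\<xi> k \<in> borel_measurable M"
  using sg by (simp add: stationary_gaussian_def complex_gaussian_process_def)

lemma integral_xi_xi: "(\<integral>\<omega>. \<xi> k \<omega> * cnj (\<xi> l \<omega>) \<partial>M) = of_real (\<gamma> (l - k))"
  using sg by (simp add: stationary_gaussian_def has_covariance_def)

lemma xi_norm2: "integrable M (\<lambda>\<omega>. (norm (\<xi> k \<omega>))\<^sup>2)" "(\<integral>\<omega>. (norm (\<xi> k \<omega>))\<^sup>2 \<partial>M) = 1"
proof -
  have eq: "\<xi> k \<omega> * cnj (\<xi> k \<omega>) = of_real ((norm (\<xi> k \<omega>))\<^sup>2)" for \<omega>
    by (simp only: complex_norm_square)
  have 1: "(\<integral>\<omega>. of_real ((norm (\<xi> k \<omega>))\<^sup>2) \<partial>M) = (1 :: complex)"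
    using integral_xi_xi[of k k] \<gamma>0 unfolding eq by simp
  \<comment> \<open>A non-integrable function has integral 0 by default, so the value 1 forces
    integrability.\<close>
  hence "integrable M (\<lambda>\<omega>. complex_of_real ((norm (\<xi> k \<omega>))\<^sup>2))"
    using not_integrable_integral_eq by fastforce
  thus "integrable M (\<lambda>\<omega>. (norm (\<xi> k \<omega>))\<^sup>2)" by (simp only: complex_of_real_integrable_eq)
  show "(\<integral>\<omega>. (norm (\<xi> k \<omega>))\<^sup>2 \<partial>M) = 1"
    using 1 by (simp only: integral_complex_of_real of_real_eq_1_iff)
qed

lemma integrable_xi_xi: "integrable M (\<lambda>\<omega>. \<xi> k \<omega> * cnj (\<xi> l \<omega>))"
  by (rule integrable_mult_square_integrable) (use xi_norm2 in auto)

lemma integrable_xi: "integrable M (\<xi> k)"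
  using integrable_mult_square_integrable(2)[of "\<lambda>_. 1" M "\<xi> k"] xi_norm2 by simp

lemma integral_xi: "(\<integral>\<omega>. \<xi> k \<omega> \<partial>M) = 0"
  using sg by (simp add: stationary_gaussian_def centered_def)

lemma nn_integral_xi_xi: "(\<integral>\<^sup>+\<omega>. ennreal (norm (\<xi> k \<omega>)) * ennreal (norm (\<xi> l \<omega>)) \<partial>M) \<le> 1"
proof -
  have "(\<integral>\<^sup>+\<omega>. ennreal (norm (\<xi> k \<omega>)) * ennreal (norm (\<xi> l \<omega>)) \<partial>M) \<le> (\<integral>\<^sup>+\<omega>. ennreal (((norm (\<xi> k \<omega>))\<^sup>2 + (norm (\<xi> l \<omega>))\<^sup>2) / 2) \<partial>M)"
    using sum_squares_bound[of "norm (\<xi> k \<omega>)" "norm (\<xi> l \<omega>)" for \<omega>]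
    by (intro nn_integral_mono) (auto simp: ennreal_mult[symmetric] intro!: ennreal_leI simp: field_simps)
  also have "\<dots> = ennreal (\<integral>\<omega>. ((norm (\<xi> k \<omega>))\<^sup>2 + (norm (\<xi> l \<omega>))\<^sup>2) / 2 \<partial>M)"
    by (intro nn_integral_eq_integral) (use xi_norm2 in auto)
  also have "\<dots> = 1" using xi_norm2 by simp
  finally show ?thesis .
qed

lemma nn_integral_xi: "(\<integral>\<^sup>+\<omega>. ennreal (norm (\<xi> k \<omega>)) \<partial>M) \<le> 1"
proof -
  have "(\<integral>\<^sup>+\<omega>. ennreal (norm (\<xi> k \<omega>)) \<partial>M) \<le> (\<integral>\<^sup>+\<omega>. ennreal (((norm (\<xi> k \<omega>))\<^sup>2 + 1) / 2) \<partial>M)"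
    using sum_squares_bound[of "norm (\<xi> k \<omega>)" 1 for \<omega>]
    by (intro nn_integral_mono) (auto intro!: ennreal_leI simp: field_simps)
  also have "\<dots> = ennreal (\<integral>\<omega>. ((norm (\<xi> k \<omega>))\<^sup>2 + 1) / 2 \<partial>M)"
    by (intro nn_integral_eq_integral) (use xi_norm2 in auto)
  also have "\<dots> = 1" using xi_norm2 by (simp add: prob_space)
  finally show ?thesis .
qed

text \<open>Rotating the process by \<open>cis (pi/2)\<close> multiplies a linear form by
  \<open>\<i>\<close> and preserves the law, so the real and imaginary parts have the same second
  moment.\<close>

lemma circular_second_moment:
  assumes J: "finite J"
  shows "(\<integral>\<omega>. (Re (\<Sum>k\<in>J. c k * \<xi> k \<omega>))\<^sup>2 \<partial>M) = (\<integral>\<omega>. (norm (\<Sum>k\<in>J. c k * \<xi> k \<omega>))\<^sup>2 \<partial>M) / 2"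
proof -
  define S where "S = (\<lambda>\<omega>. \<Sum>k\<in>J. c k * \<xi> k \<omega>)"
  have [measurable]: "S \<in> borel_measurable M" unfolding S_def by measurable
  let ?P = "PiM (UNIV :: int set) (\<lambda>_. borel :: complex measure)"
  have m1[measurable]: "(\<lambda>\<omega> k. \<xi> k \<omega>) \<in> M \<rightarrow>\<^sub>M ?P" "(\<lambda>\<omega> k. cis (pi/2) * \<xi> k \<omega>) \<in> M \<rightarrow>\<^sub>M ?P"
    by (rule measurable_PiM_single'; auto simp del: cis_pi_half)+
  have g[measurable]: "(\<lambda>x. (Re (\<Sum>k\<in>J. c k * x k))\<^sup>2) \<in> borel_measurable ?P"
    by measurable
  have "distr M ?P (\<lambda>\<omega> k. cis (pi/2) * \<xi> k \<omega>) = distr M ?P (\<lambda>\<omega> k. \<xi> k \<omega>)"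
    using sg by (simp add: stationary_gaussian_def circularly_symmetric_def process_law_def del: cis_pi_half)
  hence "(\<integral>x. (Re (\<Sum>k\<in>J. c k * x k))\<^sup>2 \<partial>distr M ?P (\<lambda>\<omega> k. cis (pi/2) * \<xi> k \<omega>)) 
      = (\<integral>x. (Re (\<Sum>k\<in>J. c k * x k))\<^sup>2 \<partial>distr M ?P (\<lambda>\<omega> k. \<xi> k \<omega>))" by simp
  hence "(\<integral>\<omega>. (Re (\<Sum>k\<in>J. c k * (cis (pi/2) * \<xi> k \<omega>)))\<^sup>2 \<partial>M) = (\<integral>\<omega>. (Re (S \<omega>))\<^sup>2 \<partial>M)"
    unfolding integral_distr[OF m1(1) g] integral_distr[OF m1(2) g] S_def .
  also have "(\<lambda>\<omega>. (Re (\<Sum>k\<in>J. c k * (cis (pi/2) * \<xi> k \<omega>)))\<^sup>2) = (\<lambda>\<omega>. (Im (S \<omega>))\<^sup>2)"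
  proof
    fix \<omega>
    have "(\<Sum>k\<in>J. c k * (cis (pi/2) * \<xi> k \<omega>)) = \<i> * S \<omega>"
      unfolding S_def sum_distrib_left by (intro sum.cong) (simp_all add: mult_ac)
    thus "(Re (\<Sum>k\<in>J. c k * (cis (pi/2) * \<xi> k \<omega>)))\<^sup>2 = (Im (S \<omega>))\<^sup>2" by simp
  qed
  finally have ReIm: "(\<integral>\<omega>. (Im (S \<omega>))\<^sup>2 \<partial>M) = (\<integral>\<omega>. (Re (S \<omega>))\<^sup>2 \<partial>M)" .
  have S2: "integrable M (\<lambda>\<omega>. (norm (S \<omega>))\<^sup>2)"
  proof -
    have "S \<omega> * cnj (S \<omega>) = (\<Sum>k\<in>J. \<Sum>l\<in>J. c k * cnj (c l) * (\<xi> k \<omega> * cnj (\<xi> l \<omega>)))" for \<omega>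
      unfolding S_def cnj_sum sum_product by (intro sum.cong refl) (simp add: mult_ac)
    hence "integrable M (\<lambda>\<omega>. S \<omega> * cnj (S \<omega>))"
      using integrable_xi_xi by simp
    thus ?thesis by (simp only: complex_norm_square[symmetric] complex_of_real_integrable_eq of_real_power[symmetric])
  qed
  have i: "integrable M (\<lambda>\<omega>. (Re (S \<omega>))\<^sup>2)" "integrable M (\<lambda>\<omega>. (Im (S \<omega>))\<^sup>2)"
    by (rule Bochner_Integration.integrable_bound[OF S2]; auto simp: cmod_power2)+
  have "(\<integral>\<omega>. (norm (S \<omega>))\<^sup>2 \<partial>M) = (\<integral>\<omega>. (Re (S \<omega>))\<^sup>2 \<partial>M) + (\<integral>\<omega>. (Im (S \<omega>))\<^sup>2 \<partial>M)"
    unfolding cmod_power2 using i by simp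
  thus ?thesis using ReIm unfolding S_def by simp
qed

lemma gaussian_char:
  assumes X: "gaussian_rv M X" and X1: "integrable M X" "(\<integral>\<omega>. X \<omega> \<partial>M) = 0"
  shows "(\<integral>\<omega>. iexp (X \<omega>) \<partial>M) = of_real (exp (- ((\<integral>\<omega>. (X \<omega>)\<^sup>2 \<partial>M) / 2)))"
proof -
  have [measurable]: "X \<in> borel_measurable M" using X by (simp add: gaussian_rv_def)
  obtain \<mu> where "(AE \<omega> in M. X \<omega> = \<mu>) \<or> (\<exists>\<sigma>>0. distributed M lborel X (normal_density \<mu> \<sigma>))"
    using X by (auto simp: gaussian_rv_def)
  thus ?thesis
  proof
    assume ae: "AE \<omega> in M. X \<omega> = \<mu>"
    have "(\<integral>\<omega>. X \<omega> \<partial>M) = (\<integral>\<omega>. \<mu> \<partial>M)" by (rule integral_cong_AE) (use ae in auto)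
    hence "\<mu> = 0" using X1 by (simp add: prob_space)
    hence ae: "AE \<omega> in M. X \<omega> = 0" using ae by simp
    have "(\<integral>\<omega>. iexp (X \<omega>) \<partial>M) = (\<integral>\<omega>. 1 \<partial>M)" by (rule integral_cong_AE) (use ae in auto)
    moreover have "(\<integral>\<omega>. (X \<omega>)\<^sup>2 \<partial>M) = (\<integral>\<omega>. 0 \<partial>M)" by (rule integral_cong_AE) (use ae in auto)
    ultimately show ?thesis by (simp add: prob_space)
  next
    assume "\<exists>\<sigma>>0. distributed M lborel X (normal_density \<mu> \<sigma>)"
    then obtain \<sigma> where \<sigma>: "\<sigma> > 0" and d: "distributed M lborel X (normal_density \<mu> \<sigma>)" by auto
    have "expectation X = \<mu>" by (rule normal_distributed_expectation[OF \<sigma> d])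
    hence \<mu>: "\<mu> = 0" using X1 by simp
    have "variance X = \<sigma>\<^sup>2" by (rule normal_distributed_variance[OF \<sigma> d])
    hence v: "(\<integral>\<omega>. (X \<omega>)\<^sup>2 \<partial>M) = \<sigma>\<^sup>2" using X1 by simp
    define Y where "Y = (\<lambda>\<omega>. X \<omega> / \<sigma>)"
    have [measurable]: "Y \<in> borel_measurable M" unfolding Y_def by measurable
    have "distributed M lborel Y std_normal_density"
      using normal_standard_normal_convert[OF \<sigma>, of X \<mu>] d \<mu> by (simp add: Y_def)
    hence dY: "distr M lborel Y = std_normal_distribution"
      by (rule distributed_distr_eq_density)
    have "(\<integral>\<omega>. iexp (X \<omega>) \<partial>M) = (\<integral>\<omega>. iexp (\<sigma> * Y \<omega>) \<partial>M)" using \<sigma> by (simp add: Y_def)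
    also have "\<dots> = (\<integral>y. iexp (\<sigma> * y) \<partial>distr M lborel Y)" by (subst integral_distr) auto
    also have "\<dots> = char std_normal_distribution \<sigma>" unfolding dY char_def ..
    also have "\<dots> = of_real (exp (- ((\<integral>\<omega>. (X \<omega>)\<^sup>2 \<partial>M) / 2)))"
      unfolding v by (simp add: char_std_normal_distribution)
    finally show ?thesis .
  qed
qed

lemma finite_cf:
  assumes J: "finite J"
  shows "(\<integral>\<omega>. iexp (Re (\<Sum>k\<in>J. c k * \<xi> k \<omega>)) \<partial>M) = of_real (exp (- ((\<integral>\<omega>. (norm (\<Sum>k\<in>J. c k * \<xi> k \<omega>))\<^sup>2 \<partial>M) / 4)))"
proof -
  have i: "integrable M (\<lambda>\<omega>. \<Sum>k\<in>J. c k * \<xi> k \<omega>)" using integrable_xi by simp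
  have "(\<integral>\<omega>. Re (\<Sum>k\<in>J. c k * \<xi> k \<omega>) \<partial>M) = Re (\<integral>\<omega>. (\<Sum>k\<in>J. c k * \<xi> k \<omega>) \<partial>M)"
    by (rule integral_Re[OF i])
  also have "\<dots> = 0" using integrable_xi integral_xi by (subst Bochner_Integration.integral_sum) auto
  finally have z: "(\<integral>\<omega>. Re (\<Sum>k\<in>J. c k * \<xi> k \<omega>) \<partial>M) = 0" .
  have "gaussian_rv M (\<lambda>\<omega>. Re (\<Sum>k\<in>J. c k * \<xi> k \<omega>))"
    using sg J by (auto simp: stationary_gaussian_def complex_gaussian_process_def)
  from gaussian_char[OF this integrable_Re[OF i] z] show ?thesis
    unfolding circular_second_moment[OF J] by simp
qed

text \<open>General coefficients treat \<open>f z\<close> (\<open>u k = z ^ k\<close>), its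
  derivative and all combinations of the two at once.\<close>

definition series :: "(nat \<Rightarrow> complex) \<Rightarrow> 'w \<Rightarrow> complex" where
  "series u \<omega> = (\<Sum>k. u k * \<xi> (int k) \<omega>)"

definition majorant :: "(nat \<Rightarrow> complex) \<Rightarrow> 'w \<Rightarrow> real" where
  "majorant u \<omega> = (\<Sum>k. norm (u k * \<xi> (int k) \<omega>))"

lemma series_meas [measurable]: "series u \<in> borel_measurable M"
  unfolding series_def by measurable

lemma majorant_meas [measurable]: "majorant u \<in> borel_measurable M"
  unfolding majorant_def by measurable

lemma AE_summable:
  assumes u: "summable (\<lambda>k. norm (u k))"
  shows "AE \<omega> in M. summable (\<lambda>k. norm (u k * \<xi> (int k) \<omega>))"
proof -
  have "(\<integral>\<^sup>+\<omega>. (\<Sum>k. ennreal (norm (u k * \<xi> (int k) \<omega>))) \<partial>M) = (\<Sum>k. \<integral>\<^sup>+\<omega>. ennreal (norm (u k * \<xi> (int k) \<omega>)) \<partial>M)"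
    by (rule nn_integral_suminf) measurable
  also have "\<dots> \<le> (\<Sum>k. ennreal (norm (u k)))"
  proof (intro suminf_le allI)
    fix k
    have "(\<integral>\<^sup>+\<omega>. ennreal (norm (u k * \<xi> (int k) \<omega>)) \<partial>M) = ennreal (norm (u k)) * (\<integral>\<^sup>+\<omega>. ennreal (norm (\<xi> (int k) \<omega>)) \<partial>M)"
      by (subst nn_integral_cmult[symmetric]) (auto simp: norm_mult ennreal_mult)
    also have "\<dots> \<le> ennreal (norm (u k)) * 1" by (intro mult_left_mono nn_integral_xi) auto
    finally show "(\<integral>\<^sup>+\<omega>. ennreal (norm (u k * \<xi> (int k) \<omega>)) \<partial>M) \<le> ennreal (norm (u k))" by simp
  qed auto
  also have "\<dots> < \<infinity>" using u by (simp add: suminf_ennreal2 less_top[symmetric])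
  finally have "AE \<omega> in M. (\<Sum>k. ennreal (norm (u k * \<xi> (int k) \<omega>))) \<noteq> \<infinity>"
    by (intro nn_integral_noteq_infinite) auto
  thus ?thesis by eventually_elim (auto intro: summable_suminf_not_top)
qed

text \<open>The square is expanded into a double series of nonnegative terms, each with expectation
  at most \<open>|u k| * |u l|\<close>. The resulting square-integrable majorant dominates all
  partial sums simultaneously.\<close>

lemma nn_integral_majorant:
  assumes u: "summable (\<lambda>k. norm (u k))"
  shows "(\<integral>\<^sup>+\<omega>. ennreal ((majorant u \<omega>)\<^sup>2) \<partial>M) \<le> ennreal ((\<Sum>k. norm (u k))\<^sup>2)"
proof -
  define f where "f = (\<lambda>k \<omega>. ennreal (norm (u k * \<xi> (int k) \<omega>)))"
  have [measurable]: "f k \<in> borel_measurable M" for k unfolding f_def by measurable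
  have "AE \<omega> in M. ennreal ((majorant u \<omega>)\<^sup>2) = (\<Sum>k. \<Sum>l. f k \<omega> * f l \<omega>)"
    using AE_summable[OF u]
  proof eventually_elim
    case (elim \<omega>)
    have "ennreal (majorant u \<omega>) = (\<Sum>k. f k \<omega>)"
      unfolding majorant_def f_def using elim by (intro suminf_ennreal2[symmetric]) auto
    moreover have "majorant u \<omega> \<ge> 0" unfolding majorant_def using elim by (intro suminf_nonneg) auto
    ultimately have "ennreal ((majorant u \<omega>)\<^sup>2) = (\<Sum>k. f k \<omega>) * (\<Sum>l. f l \<omega>)"
      by (simp add: power2_eq_square ennreal_mult)
    also have "\<dots> = (\<Sum>k. f k \<omega> * (\<Sum>l. f l \<omega>))" by (rule ennreal_suminf_multc[symmetric])
    also have "\<dots> = (\<Sum>k. \<Sum>l. f k \<omega> * f l \<omega>)" by simp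
    finally show ?case .
  qed
  hence "(\<integral>\<^sup>+\<omega>. ennreal ((majorant u \<omega>)\<^sup>2) \<partial>M) = (\<integral>\<^sup>+\<omega>. (\<Sum>k. \<Sum>l. f k \<omega> * f l \<omega>) \<partial>M)"
    by (rule nn_integral_cong_AE)
  also have "\<dots> = (\<Sum>k. \<Sum>l. \<integral>\<^sup>+\<omega>. f k \<omega> * f l \<omega> \<partial>M)"
    by (subst nn_integral_suminf; measurable; subst nn_integral_suminf; measurable)
  also have "\<dots> \<le> (\<Sum>k. \<Sum>l. ennreal (norm (u k)) * ennreal (norm (u l)))"
  proof (intro suminf_le allI)
    fix k l
    have "(\<integral>\<^sup>+\<omega>. f k \<omega> * f l \<omega> \<partial>M) = (\<integral>\<^sup>+\<omega>. ennreal (norm (u k)) * ennreal (norm (u l)) * (ennreal (norm (\<xi> (int k) \<omega>)) * ennreal (norm (\<xi> (int l) \<omega>))) \<partial>M)"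
      by (intro nn_integral_cong) (simp add: f_def norm_mult ennreal_mult mult_ac)
    also have "\<dots> = ennreal (norm (u k)) * ennreal (norm (u l)) * (\<integral>\<^sup>+\<omega>. (ennreal (norm (\<xi> (int k) \<omega>)) * ennreal (norm (\<xi> (int l) \<omega>))) \<partial>M)"
      by (rule nn_integral_cmult) measurable
    also have "\<dots> \<le> ennreal (norm (u k)) * ennreal (norm (u l)) * 1"
      by (intro mult_left_mono nn_integral_xi_xi) auto
    finally show "(\<integral>\<^sup>+\<omega>. f k \<omega> * f l \<omega> \<partial>M) \<le> ennreal (norm (u k)) * ennreal (norm (u l))" by simp
  qed auto
  also have "\<dots> = (\<Sum>k. ennreal (norm (u k))) * (\<Sum>k. ennreal (norm (u k)))" by simp
  also have "\<dots> = ennreal ((\<Sum>k. norm (u k))\<^sup>2)"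
    using u by (simp add: suminf_ennreal2 ennreal_mult[symmetric] suminf_nonneg power2_eq_square)
  finally show ?thesis .
qed

lemma majorant2_integrable:
  assumes u: "summable (\<lambda>k. norm (u k))"
  shows "integrable M (\<lambda>\<omega>. (majorant u \<omega>)\<^sup>2)"
proof (rule integrableI_bounded)
  have "(\<integral>\<^sup>+\<omega>. ennreal (norm ((majorant u \<omega>)\<^sup>2)) \<partial>M) \<le> ennreal ((\<Sum>k. norm (u k))\<^sup>2)"
    using nn_integral_majorant[OF u] by simp
  thus "(\<integral>\<^sup>+\<omega>. ennreal (norm ((majorant u \<omega>)\<^sup>2)) \<partial>M) < \<infinity>" by (rule le_less_trans) simp
qed measurable

lemma series_le_majorant:
  assumes "summable (\<lambda>k. norm (u k * \<xi> (int k) \<omega>))"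
  shows "norm (series u \<omega>) \<le> majorant u \<omega>" "norm (\<Sum>k<n. u k * \<xi> (int k) \<omega>) \<le> majorant u \<omega>"
    "(\<lambda>n. \<Sum>k<n. u k * \<xi> (int k) \<omega>) \<longlonglongrightarrow> series u \<omega>"
proof -
  show "norm (series u \<omega>) \<le> majorant u \<omega>" unfolding series_def majorant_def by (rule summable_norm[OF assms])
  have "norm (\<Sum>k<n. u k * \<xi> (int k) \<omega>) \<le> (\<Sum>k<n. norm (u k * \<xi> (int k) \<omega>))" by (rule norm_sum)
  also have "\<dots> \<le> majorant u \<omega>" unfolding majorant_def by (rule sum_le_suminf[OF assms]) auto
  finally show "norm (\<Sum>k<n. u k * \<xi> (int k) \<omega>) \<le> majorant u \<omega>" .
  show "(\<lambda>n. \<Sum>k<n. u k * \<xi> (int k) \<omega>) \<longlonglongrightarrow> series u \<omega>"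
    unfolding series_def by (rule summable_LIMSEQ[OF summable_norm_cancel[OF assms]])
qed

lemma series2_integrable:
  assumes u: "summable (\<lambda>k. norm (u k))"
  shows "integrable M (\<lambda>\<omega>. (norm (series u \<omega>))\<^sup>2)" and "(\<integral>\<omega>. (norm (series u \<omega>))\<^sup>2 \<partial>M) \<le> (\<Sum>k. norm (u k))\<^sup>2"
proof -
  have ae: "AE \<omega> in M. norm ((norm (series u \<omega>))\<^sup>2) \<le> norm ((majorant u \<omega>)\<^sup>2)"
    using AE_summable[OF u]
    by eventually_elim (use series_le_majorant(1) in \<open>auto intro!: power_mono\<close>)
  show int: "integrable M (\<lambda>\<omega>. (norm (series u \<omega>))\<^sup>2)"
    by (rule Bochner_Integration.integrable_bound[OF majorant2_integrable[OF u] _ ae]) measurable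
  have "(\<integral>\<omega>. (norm (series u \<omega>))\<^sup>2 \<partial>M) \<le> (\<integral>\<omega>. (majorant u \<omega>)\<^sup>2 \<partial>M)"
    by (rule integral_mono_AE[OF int majorant2_integrable[OF u]]) (use ae in auto)
  also have "\<dots> \<le> (\<Sum>k. norm (u k))\<^sup>2"
    using nn_integral_majorant[OF u] 
    by (subst (asm) nn_integral_eq_integral[OF majorant2_integrable[OF u]]) (auto simp: ennreal_le_iff)
  finally show "(\<integral>\<omega>. (norm (series u \<omega>))\<^sup>2 \<partial>M) \<le> (\<Sum>k. norm (u k))\<^sup>2" .
qed

text \<open>The identity for finite linear forms passes to the limit: on the left the integrands are
  bounded by 1, and the second moments converge by domination with the squared majorant.\<close>

lemma series_cf:
  assumes u: "summable (\<lambda>k. norm (u k))"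
  shows "(\<integral>\<omega>. iexp (Re (series u \<omega>)) \<partial>M) = of_real (exp (- ((\<integral>\<omega>. (norm (series u \<omega>))\<^sup>2 \<partial>M) / 4)))"
proof -
  define S where "S = (\<lambda>n \<omega>. \<Sum>k<n. u k * \<xi> (int k) \<omega>)"
  have [measurable]: "S n \<in> borel_measurable M" for n unfolding S_def by measurable
  have S: "AE \<omega> in M. (\<lambda>n. S n \<omega>) \<longlonglongrightarrow> series u \<omega>" "\<And>n. AE \<omega> in M. norm (S n \<omega>) \<le> majorant u \<omega>"
  proof -
    show "AE \<omega> in M. (\<lambda>n. S n \<omega>) \<longlonglongrightarrow> series u \<omega>"
      unfolding S_def using AE_summable[OF u] by eventually_elim (rule series_le_majorant)
    show "AE \<omega> in M. norm (S n \<omega>) \<le> majorant u \<omega>" for n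
      unfolding S_def using AE_summable[OF u] by eventually_elim (rule series_le_majorant)
  qed
  have "(\<lambda>n. \<integral>\<omega>. iexp (Re (S n \<omega>)) \<partial>M) \<longlonglongrightarrow> (\<integral>\<omega>. iexp (Re (series u \<omega>)) \<partial>M)"
  proof (rule integral_dominated_convergence[where w = "\<lambda>_. 1"])
    show "AE \<omega> in M. (\<lambda>n. iexp (Re (S n \<omega>))) \<longlonglongrightarrow> iexp (Re (series u \<omega>))"
      using S(1) by eventually_elim (auto intro!: tendsto_intros)
  qed auto
  moreover have "(\<integral>\<omega>. iexp (Re (S n \<omega>)) \<partial>M) = of_real (exp (- ((\<integral>\<omega>. (norm (S n \<omega>))\<^sup>2 \<partial>M) / 4)))" for n
  proof -
    have "S n = (\<lambda>\<omega>. \<Sum>k\<in>int ` {..<n}. u (nat k) * \<xi> k \<omega>)"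
      unfolding S_def by (subst sum.reindex) auto
    thus ?thesis using finite_cf[of "int ` {..<n}" "\<lambda>k. u (nat k)"] by simp
  qed
  moreover have "(\<lambda>n. (\<integral>\<omega>. (norm (S n \<omega>))\<^sup>2 \<partial>M)) \<longlonglongrightarrow> (\<integral>\<omega>. (norm (series u \<omega>))\<^sup>2 \<partial>M)"
  proof (rule integral_dominated_convergence[OF _ _ majorant2_integrable[OF u]])
    show "AE \<omega> in M. (\<lambda>n. (norm (S n \<omega>))\<^sup>2) \<longlonglongrightarrow> (norm (series u \<omega>))\<^sup>2"
      using S(1) by eventually_elim (auto intro!: tendsto_intros)
    show "AE \<omega> in M. norm ((norm (S n \<omega>))\<^sup>2) \<le> (majorant u \<omega>)\<^sup>2" for n
      using S(2)[of n] by eventually_elim (auto intro!: power_mono)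
  qed auto
  ultimately show ?thesis
    by (intro LIMSEQ_unique[of "\<lambda>n. \<integral>\<omega>. iexp (Re (S n \<omega>)) \<partial>M"]) (auto intro!: tendsto_intros)
qed

lemma series_linear:
  assumes "summable (\<lambda>k. norm (u k))" "summable (\<lambda>k. norm (v k))"
  shows "AE \<omega> in M. series (\<lambda>k. c * u k + d * v k) \<omega> = c * series u \<omega> + d * series v \<omega>"
  using AE_summable[OF assms(1)] AE_summable[OF assms(2)]
proof eventually_elim
  case (elim \<omega>)
  note s = this[THEN summable_norm_cancel]
  have "series (\<lambda>k. c * u k + d * v k) \<omega> = (\<Sum>k. c * (u k * \<xi> (int k) \<omega>) + d * (v k * \<xi> (int k) \<omega>))"
    unfolding series_def by (simp add: algebra_simps)
  also have "\<dots> = c * series u \<omega> + d * series v \<omega>"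
    unfolding series_def using s by (simp add: suminf_add[symmetric] suminf_mult summable_mult)
  finally show ?case .
qed

text \<open>A linear combination of two series is almost surely again a series, with combined
  coefficients, so the joint characteristic function is an instance of
  \<open>series_cf\<close>.\<close>

lemma gaussian_pair_series:
  assumes u: "summable (\<lambda>k. norm (u k))" and v: "summable (\<lambda>k. norm (v k))"
    and pos: "(\<integral>\<omega>. (norm (series u \<omega>))\<^sup>2 \<partial>M) > 0"
  shows "gaussian_pair M (series u) (series v)"
proof
  fix c d
  have w: "summable (\<lambda>k. norm (c * u k + d * v k))"
  proof (rule summable_comparison_test')
    show "summable (\<lambda>k. norm c * norm (u k) + norm d * norm (v k))" using u v by (intro summable_add summable_mult)
    show "norm (norm (c * u k + d * v k)) \<le> norm c * norm (u k) + norm d * norm (v k)" for k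
      using norm_triangle_ineq[of "c * u k" "d * v k"] by (simp add: norm_mult)
  qed
  note ae = series_linear[OF u v, of c d]
  have "(\<integral>\<omega>. iexp (Re (c * series u \<omega> + d * series v \<omega>)) \<partial>M) = (\<integral>\<omega>. iexp (Re (series (\<lambda>k. c * u k + d * v k) \<omega>)) \<partial>M)"
    by (rule integral_cong_AE) (use ae in auto)
  moreover have "(\<integral>\<omega>. (norm (c * series u \<omega> + d * series v \<omega>))\<^sup>2 \<partial>M) = (\<integral>\<omega>. (norm (series (\<lambda>k. c * u k + d * v k) \<omega>))\<^sup>2 \<partial>M)"
    by (rule integral_cong_AE) (use ae in auto)
  ultimately show "(\<integral>\<omega>. iexp (Re (c * series u \<omega> + d * series v \<omega>)) \<partial>M)
               = of_real (exp (- ((\<integral>\<omega>. (norm (c * series u \<omega> + d * series v \<omega>))\<^sup>2 \<partial>M) / 4)))"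
    using series_cf[OF w] by simp
qed (use series2_integrable[OF u] series2_integrable[OF v] pos in auto)

lemma integral_series_xi:
  assumes u: "summable (\<lambda>k. norm (u k))"
  shows "(\<lambda>k. u k * of_real (\<gamma> (int l - int k))) sums (\<integral>\<omega>. series u \<omega> * cnj (\<xi> (int l) \<omega>) \<partial>M)"
proof -
  let ?f = "\<lambda>k \<omega>. u k * \<xi> (int k) \<omega> * cnj (\<xi> (int l) \<omega>)"
  have int: "integrable M (?f k)" for k
    using integrable_mult_right[OF integrable_xi_xi[of "int k" "int l"], of "u k"] by (simp add: mult.assoc)
  have "(\<lambda>k. \<integral>\<omega>. ?f k \<omega> \<partial>M) sums (\<integral>\<omega>. (\<Sum>k. ?f k \<omega>) \<partial>M)"
  proof (rule sums_integral[OF int])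
    show "AE \<omega> in M. summable (\<lambda>k. norm (?f k \<omega>))"
      using AE_summable[OF u] by eventually_elim (simp add: norm_mult summable_mult2)
    show "summable (\<lambda>k. \<integral>\<omega>. norm (?f k \<omega>) \<partial>M)"
    proof (rule summable_comparison_test'[OF u])
      fix k
      have "ennreal (\<integral>\<omega>. norm (?f k \<omega>) \<partial>M) = (\<integral>\<^sup>+\<omega>. norm (?f k \<omega>) \<partial>M)"
        by (rule nn_integral_eq_integral[symmetric]) (use int in auto)
      also have "\<dots> = (\<integral>\<^sup>+\<omega>. ennreal (norm (u k)) * (ennreal (norm (\<xi> (int k) \<omega>)) * ennreal (norm (\<xi> (int l) \<omega>))) \<partial>M)"
        by (intro nn_integral_cong) (simp add: norm_mult ennreal_mult mult_ac)
      also have "\<dots> \<le> ennreal (norm (u k)) * 1"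
        by (subst nn_integral_cmult) (auto intro!: mult_left_mono nn_integral_xi_xi simp del: mult_1_right)
      finally have "(\<integral>\<omega>. norm (?f k \<omega>) \<partial>M) \<le> norm (u k)" by simp
      moreover have "(\<integral>\<omega>. norm (?f k \<omega>) \<partial>M) \<ge> 0" by (rule Bochner_Integration.integral_nonneg) simp
      ultimately show "norm (\<integral>\<omega>. norm (?f k \<omega>) \<partial>M) \<le> norm (u k)" by simp
    qed
  qed
  moreover have "(\<integral>\<omega>. ?f k \<omega> \<partial>M) = u k * of_real (\<gamma> (int l - int k))" for k
    using integral_xi_xi[of "int k" "int l"] by (simp add: mult.assoc)
  moreover have "(\<integral>\<omega>. (\<Sum>k. ?f k \<omega>) \<partial>M) = (\<integral>\<omega>. series u \<omega> * cnj (\<xi> (int l) \<omega>) \<partial>M)"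
  proof (rule integral_cong_AE)
    show "AE \<omega> in M. (\<Sum>k. ?f k \<omega>) = series u \<omega> * cnj (\<xi> (int l) \<omega>)"
      using AE_summable[OF u]
      by eventually_elim (simp add: series_def suminf_mult2[symmetric] summable_norm_cancel)
  qed auto
  ultimately show ?thesis by simp
qed

lemma integral_series_series:
  assumes u: "summable (\<lambda>k. norm (u k))" and v: "summable (\<lambda>k. norm (v k))"
  shows "(\<lambda>l. cnj (v l) * (\<integral>\<omega>. series u \<omega> * cnj (\<xi> (int l) \<omega>) \<partial>M)) sums (\<integral>\<omega>. series u \<omega> * cnj (series v \<omega>) \<partial>M)"
proof -
  let ?f = "\<lambda>l \<omega>. cnj (v l) * (series u \<omega> * cnj (\<xi> (int l) \<omega>))"
  have int1: "integrable M (\<lambda>\<omega>. series u \<omega> * cnj (\<xi> (int l) \<omega>))" for l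
    by (rule integrable_mult_square_integrable) (use series2_integrable[OF u] xi_norm2 in auto)
  hence int: "integrable M (?f l)" for l by simp
  define C where "C = (\<integral>\<omega>. (norm (series u \<omega>))\<^sup>2 \<partial>M) + 1"
  have le: "(\<integral>\<omega>. norm (series u \<omega> * cnj (\<xi> (int l) \<omega>)) \<partial>M) \<le> C" for l
  proof -
    have "(\<integral>\<omega>. norm (series u \<omega> * cnj (\<xi> (int l) \<omega>)) \<partial>M) \<le> (\<integral>\<omega>. (norm (series u \<omega>))\<^sup>2 + (norm (\<xi> (int l) \<omega>))\<^sup>2 \<partial>M)"
    proof (rule integral_mono)
      fix \<omega>
      have "2 * (norm (series u \<omega>) * norm (\<xi> (int l) \<omega>)) \<le> (norm (series u \<omega>))\<^sup>2 + (norm (\<xi> (int l) \<omega>))\<^sup>2"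
        using sum_squares_bound[of "norm (series u \<omega>)" "norm (\<xi> (int l) \<omega>)"] by (simp add: mult_ac)
      moreover have "norm (series u \<omega>) * norm (\<xi> (int l) \<omega>) \<ge> 0" by simp
      ultimately have "norm (series u \<omega>) * norm (\<xi> (int l) \<omega>) \<le> (norm (series u \<omega>))\<^sup>2 + (norm (\<xi> (int l) \<omega>))\<^sup>2"
        by linarith
      thus "norm (series u \<omega> * cnj (\<xi> (int l) \<omega>)) \<le> (norm (series u \<omega>))\<^sup>2 + (norm (\<xi> (int l) \<omega>))\<^sup>2"
        by (simp add: norm_mult)
    qed (use int1 series2_integrable[OF u] xi_norm2 in auto)
    also have "\<dots> = C" unfolding C_def using series2_integrable[OF u] xi_norm2 by simp
    finally show ?thesis .
  qed
  have "(\<lambda>l. \<integral>\<omega>. ?f l \<omega> \<partial>M) sums (\<integral>\<omega>. (\<Sum>l. ?f l \<omega>) \<partial>M)"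
  proof (rule sums_integral[OF int])
    show "AE \<omega> in M. summable (\<lambda>l. norm (?f l \<omega>))"
      using AE_summable[OF v]
    proof eventually_elim
      case (elim \<omega>)
      from summable_mult[OF this, of "norm (series u \<omega>)"] show ?case by (simp add: norm_mult mult_ac)
    qed
    show "summable (\<lambda>l. \<integral>\<omega>. norm (?f l \<omega>) \<partial>M)"
    proof (rule summable_comparison_test'[OF summable_mult2[OF v, of C]])
      fix l
      have "(\<integral>\<omega>. norm (?f l \<omega>) \<partial>M) = norm (v l) * (\<integral>\<omega>. norm (series u \<omega> * cnj (\<xi> (int l) \<omega>)) \<partial>M)"
        by (simp add: norm_mult)
      also have "\<dots> \<le> norm (v l) * C" by (intro mult_left_mono le) auto
      finally have "(\<integral>\<omega>. norm (?f l \<omega>) \<partial>M) \<le> norm (v l) * C" .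
      moreover have "(\<integral>\<omega>. norm (?f l \<omega>) \<partial>M) \<ge> 0" by (rule Bochner_Integration.integral_nonneg) simp
      ultimately show "norm (\<integral>\<omega>. norm (?f l \<omega>) \<partial>M) \<le> norm (v l) * C" by simp
    qed
  qed
  moreover have "(\<integral>\<omega>. (\<Sum>l. ?f l \<omega>) \<partial>M) = (\<integral>\<omega>. series u \<omega> * cnj (series v \<omega>) \<partial>M)"
  proof (rule integral_cong_AE)
    show "AE \<omega> in M. (\<Sum>l. ?f l \<omega>) = series u \<omega> * cnj (series v \<omega>)"
      using AE_summable[OF v]
    proof eventually_elim
      case (elim \<omega>)
      have "(\<lambda>l. v l * \<xi> (int l) \<omega>) sums series v \<omega>"
        unfolding series_def by (rule summable_sums[OF summable_norm_cancel[OF elim]])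
      hence "(\<lambda>l. series u \<omega> * cnj (v l * \<xi> (int l) \<omega>)) sums (series u \<omega> * cnj (series v \<omega>))"
        by (intro sums_mult) (simp only: sums_cnj)
      thus ?case by (simp add: sums_iff mult_ac)
    qed
  qed auto
  ultimately show ?thesis by simp
qed

end

section \<open>Covariances of the random series and its derivative\<close>

lemma sums_power_deriv:
  fixes z :: "'a :: {real_normed_field, banach}"
  assumes "norm z < 1"
  shows "(\<lambda>k. of_nat k * z ^ (k - 1)) sums (1 / (1 - z)\<^sup>2)"
proof -
  have "(\<lambda>n. of_nat (Suc n) * z ^ (Suc n - 1)) sums (1 / (1 - z)\<^sup>2)"
    using geometric_deriv_sums[OF assms] by simp
  from sums_Suc[OF this] show ?thesis by simp
qed

locale moving_average = circular_process M \<xi> "cov_fun a b"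
  for M :: "'w measure" and \<xi> a b +
  assumes ab: "(a, b) \<in> region_P"
begin

text \<open>Of the covariance only lags up to two survive. The conditions remove terms of negative
  index, which the one-sided series does not have; truncated subtraction would otherwise read them
  as \<open>u 0\<close>.\<close>

lemma covariance_xi:
  assumes u: "summable (\<lambda>k. norm (u k))"
  shows "(\<integral>\<omega>. series u \<omega> * cnj (\<xi> (int l) \<omega>) \<partial>M) = u l + of_real a * (u (l + 1) + (if 1 \<le> l then u (l - 1) else 0))
           + of_real b * (u (l + 2) + (if 2 \<le> l then u (l - 2) else 0))"
proof -
  define s where "s = (\<lambda>j k. if k = j then u k else 0)"
  define t where "t = (\<lambda>j k. if k = l - j then (if j \<le> l then u k else 0) else 0)"
  have "s j sums u j" for j unfolding s_def using sums_single[of j u] by simp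
  moreover have "t j sums (if j \<le> l then u (l - j) else 0)" for j
    unfolding t_def using sums_single[of "l - j" "\<lambda>k. if j \<le> l then u k else 0"] by simp
  ultimately have "(\<lambda>k. s l k + of_real a * (s (l + 1) k + t 1 k) + of_real b * (s (l + 2) k + t 2 k)) sums
      (u l + of_real a * (u (l + 1) + (if 1 \<le> l then u (l - 1) else 0)) + of_real b * (u (l + 2) + (if 2 \<le> l then u (l - 2) else 0)))"
    by (intro sums_add sums_mult)
  moreover have "s l k + of_real a * (s (l + 1) k + t 1 k) + of_real b * (s (l + 2) k + t 2 k) = u k * of_real (cov_fun a b (int l - int k))" for k
  proof -
    consider "k = l" | "k = l + 1" | "k = l + 2" | "l = k + 1" | "l = k + 2" | "\<bar>int l - int k\<bar> > 2" by linarith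
    thus ?thesis by cases (auto simp: s_def t_def cov_fun_def)
  qed
  ultimately show ?thesis using sums_unique2[OF integral_series_xi[OF u, of l]] by simp
qed

text \<open>Against the geometric sequence a downward shift of the coefficients is multiplication by
  a power of \<open>cnj z\<close>, so three sums determine the whole covariance.\<close>

lemma covariance_geometric:
  assumes u: "summable (\<lambda>k. norm (u k))" and z: "norm z < 1"
    and S0: "(\<lambda>k. u k * cnj z ^ k) sums S0" and S1: "(\<lambda>k. u (k + 1) * cnj z ^ k) sums S1" and S2: "(\<lambda>k. u (k + 2) * cnj z ^ k) sums S2"
  shows "(\<integral>\<omega>. series u \<omega> * cnj (series (\<lambda>k. z ^ k) \<omega>) \<partial>M) = S0 + of_real a * (S1 + cnj z * S0) + of_real b * (S2 + (cnj z)\<^sup>2 * S0)"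
proof -
  have v: "summable (\<lambda>k. norm (z ^ k))" using z by (simp add: norm_power summable_geometric)
  have sh: "(\<lambda>l. (if j \<le> l then u (l - j) else 0) * cnj z ^ l) sums (cnj z ^ j * S0)" for j
  proof (subst sums_zero_iff_shift[of j, symmetric])
    show "(\<lambda>i. (if j \<le> i + j then u (i + j - j) else 0) * cnj z ^ (i + j)) sums (cnj z ^ j * S0)"
      using sums_mult[OF S0, of "cnj z ^ j"] by (simp add: power_add mult_ac)
  qed auto
  have "(\<lambda>l. u l * cnj z ^ l + of_real a * (u (l + 1) * cnj z ^ l + (if 1 \<le> l then u (l - 1) else 0) * cnj z ^ l)
           + of_real b * (u (l + 2) * cnj z ^ l + (if 2 \<le> l then u (l - 2) else 0) * cnj z ^ l)) sums
     (S0 + of_real a * (S1 + cnj z ^ 1 * S0) + of_real b * (S2 + (cnj z)\<^sup>2 * S0))"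
    by (intro sums_add sums_mult S0 S1 S2 sh)
  moreover have "(\<lambda>l. u l * cnj z ^ l + of_real a * (u (l + 1) * cnj z ^ l + (if 1 \<le> l then u (l - 1) else 0) * cnj z ^ l)
           + of_real b * (u (l + 2) * cnj z ^ l + (if 2 \<le> l then u (l - 2) else 0) * cnj z ^ l)) =
      (\<lambda>l. cnj (z ^ l) * (\<integral>\<omega>. series u \<omega> * cnj (\<xi> (int l) \<omega>) \<partial>M))"
    unfolding covariance_xi[OF u] by (simp add: algebra_simps)
  ultimately show ?thesis using sums_unique2[OF integral_series_series[OF u v]] by simp
qed

abbreviation Fs :: "complex \<Rightarrow> 'w \<Rightarrow> complex" where "Fs z \<equiv> series (\<lambda>k. z ^ k)"
abbreviation Fs' :: "complex \<Rightarrow> 'w \<Rightarrow> complex" where "Fs' z \<equiv> series (\<lambda>k. of_nat k * z ^ (k - 1))"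

text \<open>The harmonic extension of the spectral density to the disc.\<close>

definition cov_symbol :: "complex \<Rightarrow> complex" where "cov_symbol z = 1 + of_real a * (z + cnj z) + of_real b * (z\<^sup>2 + (cnj z)\<^sup>2)"

lemma summable_powers:
  assumes "norm (z :: complex) < 1"
  shows "summable (\<lambda>k. norm (z ^ k))" "summable (\<lambda>k. norm (of_nat k * z ^ (k - 1)))"
    "(\<Sum>k. norm (of_nat k * z ^ (k - 1))) = 1 / (1 - norm z)\<^sup>2"
proof -
  show "summable (\<lambda>k. norm (z ^ k))" using assms by (simp add: norm_power summable_geometric)
  have "(\<lambda>k. norm (of_nat k * z ^ (k - 1))) sums (1 / (1 - norm z)\<^sup>2)"
    using sums_power_deriv[of "norm z"] assms by (simp add: norm_mult norm_power)
  thus "summable (\<lambda>k. norm (of_nat k * z ^ (k - 1)))" "(\<Sum>k. norm (of_nat k * z ^ (k - 1))) = 1 / (1 - norm z)\<^sup>2"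
    by (simp_all add: sums_iff)
qed

text \<open>Both come from geometric sums. The second expression is the derivative in
  \<open>z\<close>, with \<open>cnj z\<close> held fixed, of the first, so their quotient is the
  logarithmic derivative of \<open>E |f|^2\<close> in \<open>z\<close>.\<close>

lemma
  assumes z: "norm z < 1"
  shows covariance_self: "(\<integral>\<omega>. Fs z \<omega> * cnj (Fs z \<omega>) \<partial>M) = cov_symbol z / (1 - z * cnj z)"
    and covariance_deriv: "(\<integral>\<omega>. Fs' z \<omega> * cnj (Fs z \<omega>) \<partial>M) = cnj z * cov_symbol z / (1 - z * cnj z)\<^sup>2
          + (of_real a + 2 * of_real b * z) / (1 - z * cnj z)"
proof -
  have "norm (z * cnj z) = (norm z)\<^sup>2" by (simp add: norm_mult power2_eq_square)
  hence zz: "norm (z * cnj z) < 1" using z by (simp add: abs_square_less_1)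
  define q where "q = z * cnj z"
  have G0: "(\<lambda>k. z ^ k * cnj z ^ k) sums (1 / (1 - q))"
    using geometric_sums[OF zz] by (simp add: power_mult_distrib q_def)
  have G1: "(\<lambda>k. z ^ (k + j) * cnj z ^ k) sums (z ^ j * (1 / (1 - q)))" for j
    using sums_mult[OF G0, of "z ^ j"] by (simp add: power_add mult_ac)
  have "(\<integral>\<omega>. Fs z \<omega> * cnj (Fs z \<omega>) \<partial>M) = 1 / (1 - q) + of_real a * (z ^ 1 * (1 / (1 - q)) + cnj z * (1 / (1 - q)))
      + of_real b * (z ^ 2 * (1 / (1 - q)) + (cnj z)\<^sup>2 * (1 / (1 - q)))"
    by (rule covariance_geometric[OF summable_powers(1)[OF z] z G0 G1 G1])
  also have "\<dots> = cov_symbol z * (1 / (1 - q))" unfolding cov_symbol_def by (simp add: algebra_simps)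
  finally show "(\<integral>\<omega>. Fs z \<omega> * cnj (Fs z \<omega>) \<partial>M) = cov_symbol z / (1 - z * cnj z)"
    unfolding q_def by simp
  have D0: "(\<lambda>k. of_nat k * z ^ (k - 1) * cnj z ^ k) sums (cnj z * (1 / (1 - q)\<^sup>2))"
  proof -
    have "of_nat k * z ^ (k - 1) * cnj z ^ k = cnj z * (of_nat k * q ^ (k - 1))" for k
      by (cases k) (simp_all add: q_def power_mult_distrib mult_ac)
    thus ?thesis using sums_mult[OF sums_power_deriv[OF zz[folded q_def]], of "cnj z"]
      by (simp only: times_divide_eq_right mult_1_right)
  qed
  have D1: "(\<lambda>k. of_nat (k + 1) * z ^ (k + 1 - 1) * cnj z ^ k) sums (z * (cnj z * (1 / (1 - q)\<^sup>2)) + 1 / (1 - q))"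
  proof -
    have "of_nat (k + 1) * z ^ (k + 1 - 1) * cnj z ^ k = z * (of_nat k * z ^ (k - 1) * cnj z ^ k) + z ^ k * cnj z ^ k" for k
      by (cases k) (simp_all add: algebra_simps)
    thus ?thesis using sums_add[OF sums_mult[OF D0, of z] G0] by simp
  qed
  have D2: "(\<lambda>k. of_nat (k + 2) * z ^ (k + 2 - 1) * cnj z ^ k) sums (z\<^sup>2 * (cnj z * (1 / (1 - q)\<^sup>2)) + 2 * (z ^ 1 * (1 / (1 - q))))"
  proof -
    have "of_nat (k + 2) * z ^ (k + 2 - 1) * cnj z ^ k = z\<^sup>2 * (of_nat k * z ^ (k - 1) * cnj z ^ k) + 2 * (z ^ (k + 1) * cnj z ^ k)" for k
      by (cases k) (simp_all add: algebra_simps power2_eq_square)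
    thus ?thesis using sums_add[OF sums_mult[OF D0, of "z\<^sup>2"] sums_mult[OF G1[of 1], of 2]] by simp
  qed
  have "(\<integral>\<omega>. Fs' z \<omega> * cnj (Fs z \<omega>) \<partial>M) = cnj z * (1 / (1 - q)\<^sup>2) + of_real a * (z * (cnj z * (1 / (1 - q)\<^sup>2)) + 1 / (1 - q) + cnj z * (cnj z * (1 / (1 - q)\<^sup>2)))
      + of_real b * (z\<^sup>2 * (cnj z * (1 / (1 - q)\<^sup>2)) + 2 * (z ^ 1 * (1 / (1 - q))) + (cnj z)\<^sup>2 * (cnj z * (1 / (1 - q)\<^sup>2)))"
    by (rule covariance_geometric[OF summable_powers(2)[OF z] z D0 D1 D2])
  also have "\<dots> = cnj z * cov_symbol z * (1 / (1 - q)\<^sup>2) + (of_real a + 2 * of_real b * z) * (1 / (1 - q))"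
    unfolding cov_symbol_def by (simp add: algebra_simps)
  finally show "(\<integral>\<omega>. Fs' z \<omega> * cnj (Fs z \<omega>) \<partial>M) = cnj z * cov_symbol z / (1 - z * cnj z)\<^sup>2
          + (of_real a + 2 * of_real b * z) / (1 - z * cnj z)"
    unfolding q_def by simp
qed

definition cov_symbol_polar :: "real \<Rightarrow> real \<Rightarrow> real" where
  "cov_symbol_polar r \<theta> = 1 + 2 * (a * r) * cos \<theta> + 2 * (b * r\<^sup>2) * cos (2 * \<theta>)"

lemma cov_symbol_polar_ge: "0 \<le> r \<Longrightarrow> r < 1 \<Longrightarrow> cov_symbol_polar r \<theta> \<ge> (1 - r)\<^sup>2"
  using region_P_spectral_dilated_pos[OF ab, of "cos \<theta>" r] by (simp add: cov_symbol_polar_def cos_double_cos)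

lemma cov_symbol_eq: "cov_symbol (of_real r * cis \<theta>) = of_real (cov_symbol_polar r \<theta>)"
  unfolding cov_symbol_def cov_symbol_polar_def cos_double by (simp add: complex_eq_iff power2_eq_square algebra_simps)

lemma second_moment_F:
  assumes r: "0 \<le> r" "r < 1"
  shows "(\<integral>\<omega>. (norm (Fs (of_real r * cis \<theta>) \<omega>))\<^sup>2 \<partial>M) = cov_symbol_polar r \<theta> / (1 - r\<^sup>2)"
proof -
  define z where "z = of_real r * cis \<theta>"
  have z: "norm z < 1" using r by (simp add: z_def norm_mult)
  have zz: "z * cnj z = of_real (r\<^sup>2)" unfolding complex_norm_square[symmetric] using r by (simp add: z_def norm_mult)
  have "complex_of_real (\<integral>\<omega>. (norm (Fs z \<omega>))\<^sup>2 \<partial>M) = (\<integral>\<omega>. Fs z \<omega> * cnj (Fs z \<omega>) \<partial>M)"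
    unfolding complex_norm_square[symmetric] integral_complex_of_real ..
  also have "\<dots> = of_real (cov_symbol_polar r \<theta> / (1 - r\<^sup>2))"
    unfolding covariance_self[OF z] zz cov_symbol_eq[of r \<theta>, folded z_def] by simp
  finally show ?thesis unfolding z_def of_real_eq_iff .
qed

text \<open>The middle claim is \<open>z * \<kappa>\<close> evaluated from the two covariances. The
  last bound is independent of \<open>\<theta>\<close>: \<open>E |f|^2 \<ge> (1 - r)^2\<close> by
  the lower bound on the spectral density, and \<open>E |f'|^2 \<le> 1 / (1 - r)^4\<close> by
  absolute summation.\<close>

lemma log_derivative:
  assumes r: "0 \<le> r" "r < 1"
  defines "z \<equiv> \<lambda>\<theta>. of_real r * cis \<theta>"
  shows "gaussian_pair M (Fs (z \<theta>)) (Fs' (z \<theta>))"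
    and "z \<theta> * (\<integral>\<omega>. Fs' (z \<theta>) \<omega> / Fs (z \<theta>) \<omega> \<partial>M) = of_real (r\<^sup>2 / (1 - r\<^sup>2)) + 
            (of_real a * z \<theta> + 2 * of_real b * (z \<theta>)\<^sup>2) / of_real (cov_symbol_polar r \<theta>)"
    and "(\<integral>\<omega>. norm (Fs' (z \<theta>) \<omega> / Fs (z \<theta>) \<omega>) \<partial>M) \<le> (1 + exp (1/2) * pi) * ((1 + 1 / (1 - r)\<^sup>2) * (1 + 1 / (1 - r)^4))"
proof -
  have z: "norm (z \<theta>) < 1" "norm (z \<theta>) = r" using r by (simp_all add: z_def norm_mult)
  have r2: "r\<^sup>2 < 1" using r by (simp add: abs_square_less_1)
  have zz: "z \<theta> * cnj (z \<theta>) = of_real (r\<^sup>2)" unfolding complex_norm_square[symmetric] z(2) by simp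
  have sym_z: "cov_symbol (z \<theta>) = of_real (cov_symbol_polar r \<theta>)" unfolding z_def by (rule cov_symbol_eq)
  have D0: "cov_symbol_polar r \<theta> > 0" using cov_symbol_polar_ge[OF r, of \<theta>] r by (smt (verit) zero_less_power)
  have m: "(\<integral>\<omega>. (norm (Fs (z \<theta>) \<omega>))\<^sup>2 \<partial>M) = cov_symbol_polar r \<theta> / (1 - r\<^sup>2)"
    unfolding z_def by (rule second_moment_F[OF r])
  show gp: "gaussian_pair M (Fs (z \<theta>)) (Fs' (z \<theta>))"
    by (rule gaussian_pair_series[OF summable_powers(1,2)[OF z(1)]]) (use m D0 r2 in simp)
  interpret gp: gaussian_pair M "Fs (z \<theta>)" "Fs' (z \<theta>)" by (rule gp)
  have "z \<theta> * (\<integral>\<omega>. Fs' (z \<theta>) \<omega> / Fs (z \<theta>) \<omega> \<partial>M) =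
      z \<theta> * ((cnj (z \<theta>) * of_real (cov_symbol_polar r \<theta>) / (of_real (1 - r\<^sup>2))\<^sup>2 + (of_real a + 2 * of_real b * z \<theta>) / of_real (1 - r\<^sup>2)) / (of_real (cov_symbol_polar r \<theta>) / of_real (1 - r\<^sup>2)))"
    unfolding gp.integral_ratio m covariance_deriv[OF z(1)] zz sym_z by simp
  also have "\<dots> = (z \<theta> * cnj (z \<theta>)) / of_real (1 - r\<^sup>2) + z \<theta> * (of_real a + 2 * of_real b * z \<theta>) / of_real (cov_symbol_polar r \<theta>)"
  proof -
    have "w * ((c * d / e\<^sup>2 + g / e) / (d / e)) = (w * c) / e + w * g / d" if "d \<noteq> 0" "e \<noteq> 0" for w c d e g :: complex
      using that by (simp add: field_simps power2_eq_square)
    moreover have "complex_of_real (1 - r\<^sup>2) \<noteq> 0" "complex_of_real (cov_symbol_polar r \<theta>) \<noteq> 0" using D0 r2 by (simp_all only: of_real_eq_0_iff)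
    ultimately show ?thesis by blast
  qed
  finally show "z \<theta> * (\<integral>\<omega>. Fs' (z \<theta>) \<omega> / Fs (z \<theta>) \<omega> \<partial>M) = of_real (r\<^sup>2 / (1 - r\<^sup>2)) + 
            (of_real a * z \<theta> + 2 * of_real b * (z \<theta>)\<^sup>2) / of_real (cov_symbol_polar r \<theta>)"
    unfolding zz by (simp add: algebra_simps power2_eq_square)
  have "(1 - r)\<^sup>2 \<le> cov_symbol_polar r \<theta>" by (rule cov_symbol_polar_ge[OF r])
  also have "cov_symbol_polar r \<theta> \<le> cov_symbol_polar r \<theta> / (1 - r\<^sup>2)" using D0 r2 by (simp add: field_simps)
  finally have b1: "1 / (cov_symbol_polar r \<theta> / (1 - r\<^sup>2)) \<le> 1 / (1 - r)\<^sup>2" using r D0 r2 by (intro divide_left_mono mult_pos_pos divide_pos_pos) auto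
  have b2: "(\<integral>\<omega>. (norm (Fs' (z \<theta>) \<omega>))\<^sup>2 \<partial>M) \<le> 1 / (1 - r)^4"
    using series2_integrable(2)[OF summable_powers(2)[OF z(1)]] unfolding summable_powers(3)[OF z(1)] z(2)
    by (simp add: power_divide flip: power_mult)
  have "(\<integral>\<omega>. norm (Fs' (z \<theta>) \<omega> / Fs (z \<theta>) \<omega>) \<partial>M) \<le> (1 + exp (1/2) * pi) * ((1 + 1 / (cov_symbol_polar r \<theta> / (1 - r\<^sup>2))) * (1 + (\<integral>\<omega>. (norm (Fs' (z \<theta>) \<omega>))\<^sup>2 \<partial>M)))"
    using gp.integral_norm_ratio_le unfolding m .
  also have "\<dots> \<le> (1 + exp (1/2) * pi) * ((1 + 1 / (1 - r)\<^sup>2) * (1 + 1 / (1 - r)^4))"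
    using b1 b2 r by (intro mult_left_mono mult_mono) (auto intro!: add_nonneg_nonneg)
  finally show "(\<integral>\<omega>. norm (Fs' (z \<theta>) \<omega> / Fs (z \<theta>) \<omega>) \<partial>M) \<le> (1 + exp (1/2) * pi) * ((1 + 1 / (1 - r)\<^sup>2) * (1 + 1 / (1 - r)^4))" .
qed

end

section \<open>Zeros and the logarithmic derivative\<close>

lemma ln_sum_squares_derivative:
  fixes f g :: "real \<Rightarrow> real"
  assumes "(f has_real_derivative f') (at x within S)" "(g has_real_derivative g') (at x within S)"
    and "(f x)\<^sup>2 + (g x)\<^sup>2 > 0"
  shows "((\<lambda>t. ln ((f t)\<^sup>2 + (g t)\<^sup>2) / 2) has_real_derivative (f' * f x + g' * g x) / ((f x)\<^sup>2 + (g x)\<^sup>2)) (at x within S)"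
proof -
  have "((\<lambda>t. (f t)\<^sup>2 + (g t)\<^sup>2) has_real_derivative 2 * (f' * f x + g' * g x)) (at x within S)"
    by (auto intro!: derivative_eq_intros assms simp: algebra_simps)
  note * = DERIV_cdivide[OF DERIV_chain2[OF DERIV_ln_divide[OF assms(3)] this], of 2]
  have "1 / q * (2 * m) / 2 = m / q" for q m :: real by simp
  with * show ?thesis by (simp only:)
qed

text \<open>Along a zero-free stretch \<open>ln |h|\<close> changes by at most the integral of \<open>|h'/h|\<close>, so \<open>h\<close> cannot come down to \<open>0\<close>.\<close>

lemma nonzero_of_log_derivative_integrable:
  fixes h h' :: "real \<Rightarrow> complex"
  assumes deriv: "\<And>t. t \<in> {0..1} \<Longrightarrow> (h has_vector_derivative h' t) (at t within {0..1})"
    and int: "set_integrable lborel {0..1} (\<lambda>t. norm (h' t / h t))" and h0: "h 0 \<noteq> 0" and t: "t \<in> {0..1}"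
  shows "h t \<noteq> 0"
proof
  assume "h t = 0"
  define Z where "Z = {t\<in>{0..1}. h t = 0}"
  have cont: "continuous_on {0..1} h"
    unfolding continuous_on_eq_continuous_within using deriv has_vector_derivative_continuous by blast
  have "Z = {0..1} \<inter> h -` {0}" by (auto simp: Z_def)
  hence "closed Z" using continuous_closed_preimage[OF cont, of "{0}"] by simp
  moreover have "Z \<noteq> {}" using \<open>h t = 0\<close> t by (auto simp: Z_def)
  moreover have bdd: "bdd_below Z" by (rule bdd_belowI[of _ 0]) (auto simp: Z_def)
  ultimately have "Inf Z \<in> Z" by (intro closed_contains_Inf)
  define c where "c = Inf Z"
  have c: "c \<in> {0..1}" "h c = 0" using \<open>Inf Z \<in> Z\<close> by (auto simp: Z_def c_def)
  have c0: "c > 0" using c h0 by (cases "c = 0") auto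
  have nz: "h s \<noteq> 0" if "0 \<le> s" "s < c" for s
    using cInf_lower[OF _ bdd, of s] that c by (auto simp: Z_def c_def)
  define C where "C = integral {0..1} (\<lambda>t. norm (h' t / h t))"
  have io: "(\<lambda>t. norm (h' t / h t)) integrable_on {0..1}" by (rule set_borel_integral_eq_integral[OF int])
  have lower: "norm (h s) \<ge> norm (h 0) * exp (- C)" if s: "0 < s" "s < c" for s
  proof -
    have sub: "{0..s} \<subseteq> {0..1}" using s c by auto
    have ftc: "((\<lambda>t. Re (h' t / h t)) has_integral (ln (norm (h s)) - ln (norm (h 0)))) {0..s}"
    proof (rule fundamental_theorem_of_calculus)
      fix x assume x: "x \<in> {0..s}"
      hence hx: "h x \<noteq> 0" using nz s by auto
      have d: "(h has_vector_derivative h' x) (at x within {0..s})"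
        by (rule has_vector_derivative_within_subset[OF deriv sub]) (use x sub in auto)
      have re: "((\<lambda>t. Re (h t)) has_real_derivative Re (h' x)) (at x within {0..s})"
        "((\<lambda>t. Im (h t)) has_real_derivative Im (h' x)) (at x within {0..s})"
        using d by (auto simp: has_vector_derivative_complex_iff)
      have p: "(Re (h x))\<^sup>2 + (Im (h x))\<^sup>2 > 0" using hx by (metis complex_neq_0)
      have ln: "ln ((Re (h t))\<^sup>2 + (Im (h t))\<^sup>2) / 2 = ln (norm (h t))" if "t \<in> {0..s}" for t
        using nz[of t] s that by (simp add: cmod_power2[symmetric] ln_realpow)
      have "((\<lambda>t. ln (norm (h t))) has_real_derivative 
          (Re (h' x) * Re (h x) + Im (h' x) * Im (h x)) / ((Re (h x))\<^sup>2 + (Im (h x))\<^sup>2)) (at x within {0..s})"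
        by (rule has_field_derivative_transform_within[OF ln_sum_squares_derivative[OF re p], of 1]) (use x ln in auto)
      thus "((\<lambda>t. ln (norm (h t))) has_vector_derivative Re (h' x / h x)) (at x within {0..s})"
        by (simp add: Re_divide has_real_derivative_iff_has_vector_derivative)
    qed (use s in simp)
    have "(ln (norm (h 0)) - ln (norm (h s))) \<le> norm (integral {0..s} (\<lambda>t. Re (h' t / h t)))"
      using integral_unique[OF ftc] by simp
    also have "\<dots> \<le> integral {0..s} (\<lambda>t. norm (h' t / h t))"
    proof (rule integral_norm_bound_integral)
      show "(\<lambda>t. Re (h' t / h t)) integrable_on {0..s}" using ftc by blast
      show "(\<lambda>t. norm (h' t / h t)) integrable_on {0..s}" by (rule integrable_on_subinterval[OF io sub])
      show "norm (Re (h' t / h t)) \<le> norm (h' t / h t)" for t by (simp only: real_norm_def abs_Re_le_cmod)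
    qed
    also have "\<dots> \<le> C" unfolding C_def
      by (rule integral_subset_le[OF sub integrable_on_subinterval[OF io sub] io]) simp
    finally have "ln (norm (h 0)) - C \<le> ln (norm (h s))" by simp
    hence "exp (ln (norm (h 0)) - C) \<le> exp (ln (norm (h s)))" by simp
    thus ?thesis using h0 nz[of s] s by (simp add: exp_diff exp_minus field_simps)
  qed
  have "(h \<longlongrightarrow> h c) (at c within {0..1})" using cont c(1) unfolding continuous_on_def by blast
  hence "(h \<longlongrightarrow> h c) (at c within {0<..<c})" by (rule tendsto_within_subset) (use c in auto)
  hence "((\<lambda>s. norm (h s)) \<longlongrightarrow> norm (h c)) (at c within {0<..<c})" by (rule tendsto_norm)
  moreover have "at c within {0<..<c} = at_left c"
    using c0 by (intro at_within_nhd[of _ "{0<..}"]) auto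
  ultimately have "norm (h 0) * exp (- C) \<le> norm (h c)"
    using c0 by (intro tendsto_lowerbound[of "\<lambda>s. norm (h s)" _ "at_left c"])
      (auto simp: eventually_at_left intro!: exI[of _ 0] lower)
  thus False using h0 c by (simp add: mult_le_0_iff)
qed

lemma zero_count_argument_principle:
  fixes f :: "complex \<Rightarrow> complex"
  assumes f: "f holomorphic_on ball 0 R" and r: "0 < r" "r < R"
    and nz: "\<And>z. norm z = r \<Longrightarrow> f z \<noteq> 0"
  shows "zero_count f r = ennreal (Re (integral {0..1} (\<lambda>t. (let z = of_real r * cis (2 * pi * t) in z * deriv f z / f z))))"
    and "Re (integral {0..1} (\<lambda>t. (let z = of_real r * cis (2 * pi * t) in z * deriv f z / f z))) \<ge> 0"
proof -
  \<comment> \<open>Zeros could accumulate at the boundary of \<open>ball 0 R\<close>; the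
    intermediate radius leaves only finitely many, as the argument principle requires.\<close>
  define r' where "r' = (r + R) / 2"
  have r': "r < r'" "r' < R" using r by (simp_all add: r'_def)
  define S where "S = ball (0::complex) r'"
  define pz where "pz = {w\<in>S. f w = 0}"
  have hol: "f holomorphic_on S" unfolding S_def by (rule holomorphic_on_subset[OF f]) (use r' in auto)
  have nconst: "finite pz"
  proof (cases "f constant_on ball 0 R")
    case True
    hence "f w = f (of_real r)" if "w \<in> S" for w
      using that r r' unfolding S_def constant_on_def by (metis abs_of_pos dist_0_norm less_trans mem_ball norm_of_real)
    moreover have "f (of_real r) \<noteq> 0" using nz[of "of_real r"] r by simp
    ultimately have "pz = {}" by (auto simp: pz_def)
    thus ?thesis by simp
  next
    case False
    have "finite {z \<in> cball 0 r'. f z = 0}"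
      by (rule holomorphic_compact_finite_zeros[OF f _ _ _ _ False]) (use r' in auto)
    thus ?thesis by (rule rev_finite_subset) (auto simp: pz_def S_def)
  qed
  have path: "path_image (circlepath 0 r) = sphere 0 r" using r by simp
  have ap: "contour_integral (circlepath 0 r) (\<lambda>x. deriv f x * 1 / f x) = 
     2 * pi * \<i> * (\<Sum>p\<in>{w\<in>S. f w = 0 \<or> w \<in> {}}. winding_number (circlepath 0 r) p * 1 * zorder f p)"
  proof (rule argument_principle)
    show "path_image (circlepath 0 r) \<subseteq> S - {w \<in> S. f w = 0 \<or> w \<in> {}}"
      unfolding path using nz r' by (auto simp: S_def)
    show "\<forall>z. z \<notin> S \<longrightarrow> winding_number (circlepath 0 r) z = 0"
    proof (intro allI impI)
      fix z assume "z \<notin> S"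
      thus "winding_number (circlepath 0 r) z = 0"
        by (intro winding_number_zero_outside[of _ "cball 0 r"]) (use r r' in \<open>auto simp: S_def\<close>)
    qed
  qed (use hol nconst in \<open>auto simp: S_def pz_def\<close>)
  define P where "P = {z. norm z < r \<and> f z = 0}"
  have P: "P \<subseteq> pz" using r' by (auto simp: P_def pz_def S_def)
  hence finP: "finite P" using nconst finite_subset by blast
  have zo: "zorder f p \<ge> 0" if "p \<in> pz" for p
  proof (rule zorder_ge_0)
    have pS: "p \<in> S" "open S" using that by (auto simp: pz_def S_def)
    show "f analytic_on {p}" using hol pS analytic_at by blast
    have "eventually (\<lambda>w. w \<in> S - (pz - {p})) (nhds p)"
      using pS nconst by (intro eventually_nhds_in_open open_Diff finite_imp_closed) auto
    hence "eventually (\<lambda>w. f w \<noteq> 0) (at p)"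
      unfolding eventually_at_filter by eventually_elim (auto simp: pz_def)
    thus "frequently (\<lambda>w. f w \<noteq> 0) (at p)" by (rule eventually_frequently[rotated]) simp
  qed
  have wn: "winding_number (circlepath 0 r) p = (if p \<in> P then 1 else 0)" if "p \<in> pz" for p
  proof (cases "norm p < r")
    case True
    thus ?thesis using that winding_number_circlepath[of p 0 r] by (auto simp: P_def pz_def)
  next
    case False
    hence "norm p > r" using nz[of p] that by (cases "norm p = r") (auto simp: pz_def)
    hence "winding_number (circlepath 0 r) p = 0"
      by (intro winding_number_zero_outside[of _ "cball 0 r"]) (use r in auto)
    thus ?thesis using False by (simp add: P_def)
  qed
  have "(\<Sum>p\<in>{w\<in>S. f w = 0 \<or> w \<in> {}}. winding_number (circlepath 0 r) p * 1 * zorder f p) = (\<Sum>p\<in>pz. if p \<in> P then of_int (zorder f p) else 0)"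
  proof (rule sum.cong)
    show "{w\<in>S. f w = 0 \<or> w \<in> {}} = pz" by (simp add: pz_def)
  qed (simp add: wn)
  also have "\<dots> = (\<Sum>p\<in>P. of_int (zorder f p))"
  proof -
    have "{p \<in> pz. p \<in> P} = P" using P by auto
    thus ?thesis using nconst by (simp add: sum.inter_filter[symmetric])
  qed
  finally have ap2: "contour_integral (circlepath 0 r) (\<lambda>x. deriv f x * 1 / f x) = 2 * pi * \<i> * of_int (\<Sum>p\<in>P. zorder f p)"
    using ap by simp
  have "contour_integral (circlepath 0 r) (\<lambda>x. deriv f x * 1 / f x) = 
     integral {0..1} (\<lambda>t. (2 * pi * \<i>) * (let z = of_real r * cis (2 * pi * t) in z * deriv f z / f z))"
    unfolding contour_integral_integral
    by (intro integral_cong, simp only: vector_derivative_circlepath)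
      (simp add: circlepath cis_conv_exp Let_def mult_ac)
  also have "\<dots> = (2 * pi * \<i>) * integral {0..1} (\<lambda>t. (let z = of_real r * cis (2 * pi * t) in z * deriv f z / f z))"
    by simp
  finally have I: "integral {0..1} (\<lambda>t. (let z = of_real r * cis (2 * pi * t) in z * deriv f z / f z)) = of_int (\<Sum>p\<in>P. zorder f p)"
    unfolding ap2 by simp
  have "zero_count f r = (\<Sum>p\<in>P. ennreal (of_int (zorder f p)))"
    unfolding zero_count_def P_def[symmetric] using finP by simp
  also have "\<dots> = ennreal (of_int (\<Sum>p\<in>P. zorder f p))"
    using zo P by (subst sum_ennreal) auto
  finally show "zero_count f r = ennreal (Re (integral {0..1} (\<lambda>t. (let z = of_real r * cis (2 * pi * t) in z * deriv f z / f z))))"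
    unfolding I by simp
  show "Re (integral {0..1} (\<lambda>t. (let z = of_real r * cis (2 * pi * t) in z * deriv f z / f z))) \<ge> 0"
    unfolding I using zo P by (auto intro!: sum_nonneg simp del: of_int_sum)
qed

text \<open>Absolute convergence at the single point \<open>R\<close> provides one exceptional null
  set for all \<open>|z| < R\<close> at once, as is necessary for statements about whole
  circles.\<close>

lemma AE_xi_series:
  assumes "circular_process M \<xi> \<gamma>" and R: "0 < R" "R < 1"
  shows "AE \<omega> in M. random_series \<xi> \<omega> holomorphic_on ball 0 R \<and>
    (\<forall>z\<in>ball 0 R. circular_process.series \<xi> (\<lambda>k. z ^ k) \<omega> = random_series \<xi> \<omega> z \<and>
       circular_process.series \<xi> (\<lambda>k. of_nat k * z ^ (k - 1)) \<omega> = deriv (random_series \<xi> \<omega>) z)"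
proof -
  interpret circular_process M \<xi> \<gamma> by fact
  have "summable (\<lambda>k. norm (complex_of_real R ^ k))" using R by (simp add: norm_power summable_geometric)
  from AE_summable[OF this] show ?thesis
  proof eventually_elim
    case (elim \<omega>)
    define f where "f = random_series \<xi> \<omega>"
    define c where "c = (\<lambda>k. \<xi> (int k) \<omega>)"
    have sR: "summable (\<lambda>k. c k * of_real R ^ k)"
      using summable_norm_cancel[OF elim] by (simp add: c_def mult.commute)
    have sums: "(\<lambda>k. c k * z ^ k) sums f z" if "norm z < R" for z
    proof -
      have "summable (\<lambda>k. c k * z ^ k)" by (rule powser_inside[OF sR]) (use that R in auto)
      thus ?thesis unfolding f_def random_series_def c_def by (rule summable_sums)
    qed
    have hol: "f holomorphic_on ball 0 R"
      by (rule power_series_holomorphic[of 0 R c]) (use sums in auto)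
    have "series (\<lambda>k. z ^ k) \<omega> = f z \<and> series (\<lambda>k. of_nat k * z ^ (k - 1)) \<omega> = deriv f z" if z: "z \<in> ball 0 R" for z
    proof
      have "norm z < R" using z by simp
      from sums[OF this] show "series (\<lambda>k. z ^ k) \<omega> = f z" by (simp add: series_def sums_iff c_def mult.commute)
      have "(f has_field_derivative deriv f z) (at z)" by (rule holomorphic_derivI[OF hol _ z]) simp
      from termdiffs_sums_strong[OF sums this] have "(\<lambda>n. diffs c n * z ^ n) sums deriv f z" using z by simp
      hence "(\<lambda>n. of_nat (Suc n) * z ^ (Suc n - 1) * c (Suc n)) sums deriv f z"
        by (simp add: diffs_def mult_ac)
      from sums_Suc[OF this] show "series (\<lambda>k. of_nat k * z ^ (k - 1)) \<omega> = deriv f z"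
        by (simp add: series_def sums_iff c_def)
    qed
    with hol show ?case unfolding f_def by blast
  qed
qed

section \<open>The expected number of zeros in closed form\<close>

context moving_average
begin

abbreviation circ :: "real \<Rightarrow> real \<Rightarrow> complex" where "circ r t \<equiv> of_real r * cis (2 * pi * t)"

definition ratio :: "real \<Rightarrow> real \<Rightarrow> 'w \<Rightarrow> complex" where
  "ratio r t \<omega> = circ r t * (Fs' (circ r t) \<omega> / Fs (circ r t) \<omega>)"

lemma cis_measurable [measurable]: "cis \<in> borel_measurable borel"
  by (intro borel_measurable_continuous_onI continuous_intros)

lemma ratio_measurable: "(\<lambda>(t, \<omega>). ratio r t \<omega>) \<in> borel_measurable (borel \<Otimes>\<^sub>M M)"
  unfolding ratio_def series_def by measurable

text \<open>The almost sure integrability of the logarithmic derivative over the circle excludes zeros there, which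
  makes the argument principle applicable.\<close>

lemma expected_zeros_eq:
  assumes r: "0 < r" "r < 1"
  shows "expected_zeros M \<xi> r = r\<^sup>2 / (1 - r\<^sup>2) + 1 - mean_fun (a * r) (b * r\<^sup>2)"
proof -
  define N where "N = restrict_space lborel {0..1::real}"
  have emN: "emeasure N (space N) = 1" by (simp add: N_def emeasure_restrict_space)
  interpret N: prob_space N by standard (rule emN)
  interpret P: pair_sigma_finite N M ..
  have intN: "integrable N g \<longleftrightarrow> set_integrable lborel {0..1} g" for g :: "real \<Rightarrow> complex"
    unfolding N_def set_integrable_def by (rule integrable_restrict_space) simp
  have idN: "(\<lambda>x. x) \<in> N \<rightarrow>\<^sub>M borel" unfolding N_def by (rule measurable_restrict_space1) simp
  have meas[measurable]: "(\<lambda>(t, \<omega>). ratio r t \<omega>) \<in> borel_measurable (N \<Otimes>\<^sub>M M)"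
  proof -
    have "(\<lambda>x. (fst x, snd x)) \<in> N \<Otimes>\<^sub>M M \<rightarrow>\<^sub>M borel \<Otimes>\<^sub>M M"
      using idN by (intro measurable_Pair) (auto intro: measurable_compose[OF measurable_fst])
    from measurable_compose[OF this ratio_measurable] show ?thesis by (simp add: case_prod_beta')
  qed
  have circ: "norm (circ r t) = r" for t using r by (simp add: norm_mult)
  have r0: "0 \<le> r" using r by simp
  note LD = log_derivative[OF r0 r(2)]
  have int_t: "integrable M (ratio r t)" for t
  proof -
    interpret gp: gaussian_pair M "Fs (circ r t)" "Fs' (circ r t)" by (rule LD)
    show ?thesis unfolding ratio_def by (rule integrable_mult_right[OF gp.integrable_ratio])
  qed
  define C where "C = (1 + exp (1/2) * pi) * ((1 + 1 / (1 - r)\<^sup>2) * (1 + 1 / (1 - r)^4))"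
  have bound: "(\<integral>\<omega>. norm (ratio r t \<omega>) \<partial>M) \<le> r * C" for t
  proof -
    have "(\<integral>\<omega>. norm (ratio r t \<omega>) \<partial>M) = r * (\<integral>\<omega>. norm (Fs' (circ r t) \<omega> / Fs (circ r t) \<omega>) \<partial>M)"
      unfolding ratio_def norm_mult[of "circ r t"] circ by simp
    also have "\<dots> \<le> r * C" unfolding C_def by (intro mult_left_mono LD r0)
    finally show ?thesis .
  qed
  have pint: "integrable (N \<Otimes>\<^sub>M M) (\<lambda>(t, \<omega>). ratio r t \<omega>)"
  proof (rule P.Fubini_integrable)
    show "integrable N (\<lambda>t. \<integral>\<omega>. norm (case (t, \<omega>) of (t, \<omega>) \<Rightarrow> ratio r t \<omega>) \<partial>M)"
    proof (rule N.integrable_const_bound[where B = "r * C"])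
      show "AE t in N. norm (\<integral>\<omega>. norm (case (t, \<omega>) of (t, \<omega>) \<Rightarrow> ratio r t \<omega>) \<partial>M) \<le> r * C"
        using bound by (intro AE_I2) simp
    qed measurable
    show "AE t in N. integrable M (\<lambda>\<omega>. case (t, \<omega>) of (t, \<omega>) \<Rightarrow> ratio r t \<omega>)" using int_t by simp
  qed measurable
  define R where "R = (1 + r) / 2"
  have R: "0 < R" "r < R" "R < 1" using r by (simp_all add: R_def)
  have ae1: "AE \<omega> in M. integrable N (\<lambda>t. ratio r t \<omega>)" by (rule P.AE_integrable_snd[OF pint])
  \<comment> \<open>Almost surely \<open>f\<close> does not vanish at the one point
    \<open>circ r 0\<close>; integrability of the logarithmic derivative extends this to the entire
    circle.\<close>
  interpret gp0: gaussian_pair M "Fs (circ r 0)" "Fs' (circ r 0)" by (rule LD)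
  have ae: "AE \<omega> in M. zero_count (random_series \<xi> \<omega>) r = ennreal (Re (\<integral>t. ratio r t \<omega> \<partial>N)) \<and> Re (\<integral>t. ratio r t \<omega> \<partial>N) \<ge> 0"
    using ae1 gp0.AE_X_nonzero AE_xi_series[OF circular_process_axioms R(1,3)]
  proof eventually_elim
    case (elim \<omega>)
    define f where "f = random_series \<xi> \<omega>"
    have hol: "f holomorphic_on ball 0 R" using elim(3) by (simp add: f_def)
    have F: "Fs z \<omega> = f z" "Fs' z \<omega> = deriv f z" if "norm z < R" for z using elim(3) that by (auto simp: f_def)
    have ratio: "ratio r t \<omega> = circ r t * deriv f (circ r t) / f (circ r t)" for t
      unfolding ratio_def using F[of "circ r t"] circ R by simp
    have h: "f (circ r t) \<noteq> 0" if "t \<in> {0..1}" for t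
    proof (rule nonzero_of_log_derivative_integrable[OF _ _ _ that])
      show "((\<lambda>t. f (circ r t)) has_vector_derivative 2 * pi * \<i> * (circ r t * deriv f (circ r t))) (at t within {0..1})" for t
      proof -
        have "(f has_field_derivative deriv f (circ r t)) (at (circ r t))"
          by (rule holomorphic_derivI[OF hol]) (use circ[of t] R in auto)
        moreover have "((\<lambda>t. circ r t) has_vector_derivative 2 * pi * \<i> * circ r t) (at t within {0..1})"
          using has_vector_derivative_circlepath[of 0 r t "{0..1}"] unfolding circlepath cis_conv_exp by (simp add: mult_ac)
        ultimately have "(f \<circ> (\<lambda>t. circ r t) has_vector_derivative (2 * pi * \<i> * circ r t) * deriv f (circ r t)) (at t within {0..1})"
          by (intro field_vector_diff_chain_within) (auto intro: has_field_derivative_at_within)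
        thus ?thesis by (simp add: o_def mult_ac)
      qed
      have "set_integrable lborel {0..1} (\<lambda>t. norm (2 * pi * \<i> * ratio r t \<omega>))"
        using elim(1) unfolding intN by (intro set_integrable_norm set_integrable_mult_right) auto
      thus "set_integrable lborel {0..1} (\<lambda>t. norm (2 * pi * \<i> * (circ r t * deriv f (circ r t)) / f (circ r t)))"
        unfolding ratio by (simp add: mult_ac)
      show "f (circ r 0) \<noteq> 0" using elim(2) F[of "circ r 0"] circ[of 0] R by simp
    qed
    have nz: "f z \<noteq> 0" if "norm z = r" for z
    proof -
      have "z \<in> path_image (circlepath 0 r)" using that r by simp
      then obtain t where "t \<in> {0..1}" "z = circlepath 0 r t" unfolding path_image_def by auto
      thus ?thesis using h[of t] by (simp add: circlepath cis_conv_exp mult_ac)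
    qed
    have "(\<integral>t. ratio r t \<omega> \<partial>N) = (LINT t:{0..1}|lborel. ratio r t \<omega>)"
      unfolding N_def set_lebesgue_integral_def by (rule integral_restrict_space) simp
    also have "\<dots> = integral {0..1} (\<lambda>t. ratio r t \<omega>)"
      by (rule set_borel_integral_eq_integral) (use elim(1) intN in auto)
    also have "\<dots> = integral {0..1} (\<lambda>t. let z = circ r t in z * deriv f z / f z)"
      unfolding ratio Let_def ..
    finally show ?case using zero_count_argument_principle[OF hol r(1) R(2) nz] by (simp only: f_def)
  qed
  define I where "I = (\<integral>\<omega>. (\<integral>t. ratio r t \<omega> \<partial>N) \<partial>M)"
  have int_I: "integrable M (\<lambda>\<omega>. \<integral>t. ratio r t \<omega> \<partial>N)" by (rule P.integrable_snd[OF pint])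
  have "(\<integral>\<^sup>+\<omega>. zero_count (random_series \<xi> \<omega>) r \<partial>M) = (\<integral>\<^sup>+\<omega>. ennreal (Re (\<integral>t. ratio r t \<omega> \<partial>N)) \<partial>M)"
    by (rule nn_integral_cong_AE) (use ae in auto)
  also have "\<dots> = ennreal (\<integral>\<omega>. Re (\<integral>t. ratio r t \<omega> \<partial>N) \<partial>M)"
    by (rule nn_integral_eq_integral[OF integrable_Re[OF int_I]]) (use ae in auto)
  also have "(\<integral>\<omega>. Re (\<integral>t. ratio r t \<omega> \<partial>N) \<partial>M) = Re I" unfolding I_def by (rule integral_Re[OF int_I])
  finally have nn: "(\<integral>\<^sup>+\<omega>. zero_count (random_series \<xi> \<omega>) r \<partial>M) = ennreal (Re I)" .
  have "0 \<le> (\<integral>\<omega>. Re (\<integral>t. ratio r t \<omega> \<partial>N) \<partial>M)" by (rule integral_nonneg_AE) (use ae in auto)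
  also have "\<dots> = Re I" unfolding I_def by (rule integral_Re[OF int_I])
  finally have I0: "Re I \<ge> 0" .
  have E: "expected_zeros M \<xi> r = Re I" unfolding expected_zeros_def nn using I0 by simp
  define g where "g = (\<lambda>t. (1 + (a * r) * cos (2 * pi * t)) / (1 + 2 * (a * r) * cos (2 * pi * t) + 2 * (b * r\<^sup>2) * cos (2 * (2 * pi * t))))"
  have Rek: "Re (\<integral>\<omega>. ratio r t \<omega> \<partial>M) = r\<^sup>2 / (1 - r\<^sup>2) + 1 - g t" for t
  proof -
    have D0: "cov_symbol_polar r (2 * pi * t) > 0" using cov_symbol_polar_ge[OF r0 r(2), of "2 * pi * t"] r by (smt (verit) zero_less_power)
    have "(\<integral>\<omega>. ratio r t \<omega> \<partial>M) = of_real (r\<^sup>2 / (1 - r\<^sup>2)) + 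
            (of_real a * circ r t + 2 * of_real b * (circ r t)\<^sup>2) / of_real (cov_symbol_polar r (2 * pi * t))"
      unfolding ratio_def LD(2)[symmetric] by (rule integral_mult_right_zero)
    hence "Re (\<integral>\<omega>. ratio r t \<omega> \<partial>M) = r\<^sup>2 / (1 - r\<^sup>2) + (a * r * cos (2 * pi * t) + 2 * (b * r\<^sup>2) * cos (2 * (2 * pi * t))) / cov_symbol_polar r (2 * pi * t)"
      by (simp only: plus_complex.sel Re_complex_of_real Re_divide_of_real cos_double)
         (simp add: power2_eq_square algebra_simps)
    also have "(a * r * cos (2 * pi * t) + 2 * (b * r\<^sup>2) * cos (2 * (2 * pi * t))) / cov_symbol_polar r (2 * pi * t) = 1 - g t"
    proof -
      have gt: "g t = (1 + (a * r) * cos (2 * pi * t)) / cov_symbol_polar r (2 * pi * t)" unfolding g_def cov_symbol_polar_def ..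
      have num: "a * r * cos (2 * pi * t) + 2 * (b * r\<^sup>2) * cos (2 * (2 * pi * t)) = cov_symbol_polar r (2 * pi * t) - (1 + (a * r) * cos (2 * pi * t))"
        unfolding cov_symbol_polar_def by simp
      show ?thesis unfolding num gt diff_divide_distrib using D0 by simp
    qed
    finally show ?thesis by simp
  qed
  have "I = (\<integral>t. (\<integral>\<omega>. ratio r t \<omega> \<partial>M) \<partial>N)"
    unfolding I_def by (rule P.Fubini_integral[OF pint])
  hence "Re I = (\<integral>t. Re (\<integral>\<omega>. ratio r t \<omega> \<partial>M) \<partial>N)"
    using P.integrable_fst[OF pint] by simp
  also have "\<dots> = (\<integral>t. r\<^sup>2 / (1 - r\<^sup>2) + 1 - g t \<partial>N)" unfolding Rek ..
  also have "\<dots> = r\<^sup>2 / (1 - r\<^sup>2) + 1 - (\<integral>t. g t \<partial>N)"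
  proof -
    have "integrable N (\<lambda>t. r\<^sup>2 / (1 - r\<^sup>2) + 1 - Re (\<integral>\<omega>. ratio r t \<omega> \<partial>M))"
      using P.integrable_fst[OF pint] by (intro Bochner_Integration.integrable_diff integrable_Re) auto
    hence "integrable N g" unfolding Rek by simp
    thus ?thesis using N.prob_space by simp
  qed
  also have "(\<integral>t. g t \<partial>N) = mean_fun (a * r) (b * r\<^sup>2)"
  proof -
    have pos: "1 + 2 * (a * r) * x + 2 * (b * r\<^sup>2) * (2 * x\<^sup>2 - 1) > 0" if "\<bar>x\<bar> \<le> 1" for x
      using region_P_spectral_dilated_pos[OF ab that r0 r(2)] r by (smt (verit) zero_less_power)
    have D0: "cov_symbol_polar r \<theta> > 0" for \<theta> using cov_symbol_polar_ge[OF r0 r(2), of \<theta>] r by (smt (verit) zero_less_power)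
    have "continuous_on {0..1} g" unfolding g_def using D0[unfolded cov_symbol_polar_def]
      by (intro continuous_intros) (metis less_irrefl)
    hence si: "set_integrable lborel {0..1} g" by (intro borel_integrable_compact[folded set_integrable_def]) auto
    have "(\<integral>t. g t \<partial>N) = (LINT t:{0..1}|lborel. g t)"
      unfolding N_def set_lebesgue_integral_def by (rule integral_restrict_space) simp
    also have "\<dots> = integral {0..1} g" by (rule set_borel_integral_eq_integral[OF si])
    also have "\<dots> = mean_fun (a * r) (b * r\<^sup>2)"
      unfolding g_def by (rule integral_unique[OF circle_mean[OF pos]])
    finally show ?thesis .
  qed
  finally show ?thesis unfolding E .
qed

end

text \<open>The endpoint \<open>(0, -1/2)\<close> shared by the two segments is listed on its own,
  since the two zeros of the density there double the coefficient. In the last case \<open>C\<close>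
  is chosen before \<open>M\<close> and \<open>\<xi>\<close>, so it depends on \<open>(a, b)\<close>
  only.\<close>

theorem theorem1p1:
  fixes a b :: real
  assumes "(a, b) \<in> region_P"
  shows
    "(a\<^sup>2 / 8 + (b - 1/4)\<^sup>2 = 1/16 \<and> 1/6 < b \<and> b \<le> 1/2 \<longrightarrow>
        (\<forall>(M :: 'w measure) \<xi>. stationary_gaussian M \<xi> (cov_fun a b) \<longrightarrow>
          (\<lambda>r. expected_zeros M \<xi> r -
             (r\<^sup>2 / (1 - r\<^sup>2) - sqrt (2 * b / (6 * b - 1)) * (1 / (1 - r\<^sup>2) powr (1/2))))
          \<in> O[at_left 1](\<lambda>r. 1)))
   \<and> (b = \<bar>a\<bar> - 1/2 \<and> -1/2 < b \<and> b < 1/6 \<longrightarrow>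
        (\<forall>(M :: 'w measure) \<xi>. stationary_gaussian M \<xi> (cov_fun a b) \<longrightarrow>
          (\<lambda>r. expected_zeros M \<xi> r -
             (r\<^sup>2 / (1 - r\<^sup>2)
               - 1/2 * sqrt ((1 - 2 * b) / (1 - 6 * b)) * (1 / (1 - r\<^sup>2) powr (1/2))))
          \<in> O[at_left 1](\<lambda>r. 1)))
   \<and> ((a, b) = (0, -1/2) \<longrightarrow>
        (\<forall>(M :: 'w measure) \<xi>. stationary_gaussian M \<xi> (cov_fun a b) \<longrightarrow>
          (\<lambda>r. expected_zeros M \<xi> r -
             (r\<^sup>2 / (1 - r\<^sup>2)
               - sqrt ((1 - 2 * b) / (1 - 6 * b)) * (1 / (1 - r\<^sup>2) powr (1/2))))
          \<in> O[at_left 1](\<lambda>r. 1)))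
   \<and> ((a, b) = (2/3, 1/6) \<or> (a, b) = (-2/3, 1/6) \<longrightarrow>
        (\<forall>(M :: 'w measure) \<xi>. stationary_gaussian M \<xi> (cov_fun a b) \<longrightarrow>
          (\<lambda>r. expected_zeros M \<xi> r -
             (r\<^sup>2 / (1 - r\<^sup>2) - 1 / 2 powr (5/4) * (1 / (1 - r\<^sup>2) powr (3/4))))
          \<in> O[at_left 1](\<lambda>r. 1 / (1 - r\<^sup>2) powr (1/4))))
   \<and> ((a, b) \<in> interior region_P \<longrightarrow>
        (\<exists>C::real. C \<ge> 0 \<and> (C > 0 \<longleftrightarrow> (a, b) \<noteq> (0, 0)) \<and>
          (\<forall>(M :: 'w measure) \<xi>. stationary_gaussian M \<xi> (cov_fun a b) \<longrightarrow>
            (\<lambda>r. expected_zeros M \<xi> r - (r\<^sup>2 / (1 - r\<^sup>2) - C))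
            \<in> O[at_left 1](\<lambda>r. 1 - r\<^sup>2))))"
proof -
  define J where "J = (\<lambda>r. mean_fun (a * r) (b * r\<^sup>2))"
  have transfer: "(\<lambda>r. expected_zeros M \<xi> r - (r\<^sup>2 / (1 - r\<^sup>2) - g r)) \<in> O[at_left 1](h)"
    if sg: "stationary_gaussian M \<xi> (cov_fun a b)" and bo: "(\<lambda>r. J r - 1 - g r) \<in> O[at_left 1](h)"
    for M :: "'w measure" and \<xi> g and h :: "real \<Rightarrow> real"
  proof -
    interpret moving_average M \<xi> a b
      by standard (use sg assms in \<open>auto simp: cov_fun_def\<close>)
    have "eventually (\<lambda>r. r \<in> {0<..<1}) (at_left (1::real))"
      by (rule eventually_at_leftI[of 0]) auto
    hence "eventually (\<lambda>r. expected_zeros M \<xi> r - (r\<^sup>2 / (1 - r\<^sup>2) - g r) = - (J r - 1 - g r)) (at_left 1)"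
      by eventually_elim (simp add: expected_zeros_eq J_def)
    from landau_o.big.in_cong[OF this] bo show ?thesis by (simp only: landau_o.big.uminus_in_iff)
  qed
  \<comment> \<open>The constant in \<open>r^2 / (1 - r^2) + 1\<close> is absorbed by the error term
    in all singular cases; in the interior it becomes part of \<open>C\<close>.\<close>
  have shift: "(\<lambda>r. J r - 1 - g r) \<in> O[at_left 1](h)" 
    if "(\<lambda>r. J r - g r) \<in> O[at_left 1](h)" "(\<lambda>_. 1) \<in> O[at_left 1](h)" for g h :: "real \<Rightarrow> real"
    using sum_in_bigo(2)[OF that] by (simp add: algebra_simps)
  show ?thesis
  proof (intro conjI impI allI)
    fix M :: "'w measure" and \<xi>
    assume h: "a\<^sup>2 / 8 + (b - 1/4)\<^sup>2 = 1/16 \<and> 1/6 < b \<and> b \<le> 1/2" and sg: "stationary_gaussian M \<xi> (cov_fun a b)"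
    show "(\<lambda>r. expected_zeros M \<xi> r - (r\<^sup>2 / (1 - r\<^sup>2) - sqrt (2 * b / (6 * b - 1)) * (1 / (1 - r\<^sup>2) powr (1/2)))) \<in> O[at_left 1](\<lambda>r. 1)"
      by (intro transfer[OF sg] shift) (use h in \<open>auto simp: J_def intro!: mean_fun_asymp_ellipse simp del: times_divide_eq_right mult_1_right\<close>)
  next
    fix M :: "'w measure" and \<xi>
    assume h: "b = \<bar>a\<bar> - 1/2 \<and> -1/2 < b \<and> b < 1/6" and sg: "stationary_gaussian M \<xi> (cov_fun a b)"
    show "(\<lambda>r. expected_zeros M \<xi> r - (r\<^sup>2 / (1 - r\<^sup>2) - 1/2 * sqrt ((1 - 2 * b) / (1 - 6 * b)) * (1 / (1 - r\<^sup>2) powr (1/2)))) \<in> O[at_left 1](\<lambda>r. 1)"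
    proof (intro transfer[OF sg] shift)
      show "(\<lambda>r. J r - 1/2 * sqrt ((1 - 2 * b) / (1 - 6 * b)) * (1 / (1 - r\<^sup>2) powr (1/2))) \<in> O[at_left 1](\<lambda>r. 1)"
        unfolding J_def by (rule mean_fun_asymp_segment) (use h in auto)
    qed simp
  next
    fix M :: "'w measure" and \<xi>
    assume h: "(a, b) = (0, -1/2)" and sg: "stationary_gaussian M \<xi> (cov_fun a b)"
    hence ab: "a = 0" "b = -1/2" by auto
    have s: "sqrt ((1 - 2 * b) / (1 - 6 * b)) = sqrt (1/2)" unfolding ab by simp
    show "(\<lambda>r. expected_zeros M \<xi> r - (r\<^sup>2 / (1 - r\<^sup>2) - sqrt ((1 - 2 * b) / (1 - 6 * b)) * (1 / (1 - r\<^sup>2) powr (1/2)))) \<in> O[at_left 1](\<lambda>r. 1)"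
      unfolding s
    proof (intro transfer[OF sg] shift)
      show "(\<lambda>r. J r - sqrt (1/2) * (1 / (1 - r\<^sup>2) powr (1/2))) \<in> O[at_left 1](\<lambda>r. 1)"
        unfolding J_def ab using mean_fun_asymp_vertex by (simp only: mult_zero_left)
    qed simp
  next
    fix M :: "'w measure" and \<xi>
    assume h: "(a, b) = (2/3, 1/6) \<or> (a, b) = (-2/3, 1/6)" and sg: "stationary_gaussian M \<xi> (cov_fun a b)"
    hence "a = 2/3 \<or> a = - (2/3)" and b: "b = 1/6" by auto
    hence "a\<^sup>2 = (2/3)\<^sup>2" by (metis power2_minus)
    hence ab: "a\<^sup>2 = 4/9" "b = 1/6" using b by (simp_all add: power_divide)
    show "(\<lambda>r. expected_zeros M \<xi> r - (r\<^sup>2 / (1 - r\<^sup>2) - 1 / 2 powr (5/4) * (1 / (1 - r\<^sup>2) powr (3/4)))) \<in> O[at_left 1](\<lambda>r. 1 / (1 - r\<^sup>2) powr (1/4))"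
    proof (intro transfer[OF sg] shift)
      show "(\<lambda>r. J r - 1 / 2 powr (5/4) * (1 / (1 - r\<^sup>2) powr (3/4))) \<in> O[at_left 1](\<lambda>r. 1 / (1 - r\<^sup>2) powr (1/4))"
        unfolding J_def ab(2) by (rule mean_fun_asymp_corner[OF ab(1)])
    qed real_asymp
  next
    assume int: "(a, b) \<in> interior region_P"
    note pos = interior_region_P_spectral_pos[OF int]
    show "\<exists>C::real. C \<ge> 0 \<and> (C > 0 \<longleftrightarrow> (a, b) \<noteq> (0, 0)) \<and>
          (\<forall>(M :: 'w measure) \<xi>. stationary_gaussian M \<xi> (cov_fun a b) \<longrightarrow>
            (\<lambda>r. expected_zeros M \<xi> r - (r\<^sup>2 / (1 - r\<^sup>2) - C)) \<in> O[at_left 1](\<lambda>r. 1 - r\<^sup>2))"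
    \<comment> \<open>\<open>C\<close> is the excess over 1 of the mean at \<open>r = 1\<close>,
      where the density has no zeros; the equality case of the bound
      \<open>mean_fun a b \<ge> 1\<close> identifies when \<open>C\<close> vanishes.\<close>
    proof (intro exI[of _ "mean_fun a b - 1"] conjI allI impI)
      show "mean_fun a b - 1 \<ge> 0" using mean_fun_ge_1[OF pos] by simp
      show "mean_fun a b - 1 > 0 \<longleftrightarrow> (a, b) \<noteq> (0, 0)" using mean_fun_ge_1[OF pos] mean_fun_eq_1_iff[OF pos] by auto
      fix M :: "'w measure" and \<xi>
      assume sg: "stationary_gaussian M \<xi> (cov_fun a b)"
      show "(\<lambda>r. expected_zeros M \<xi> r - (r\<^sup>2 / (1 - r\<^sup>2) - (mean_fun a b - 1))) \<in> O[at_left 1](\<lambda>r. 1 - r\<^sup>2)"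
        by (rule transfer[OF sg]) (use mean_fun_asymp_regular[OF pos] in \<open>simp add: J_def\<close>)
    qed
  qed
qed

end
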